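(* In a linear stochastic volatility model $(X,Y)$ on $[0,T]$ with correlation $\rho\in(-1,1)$ (as defined in the context), fix $t\in(0,T]$ and put $$\mu_Z(t)=\rho\int_0^tY_u\,dZ_u-\frac12\int_0^tY_u^2\,du,\qquad \sigma_Z^2(t)=(1-\rho^2)\int_0^tY_u^2\,du,\qquad \sigma_Z(t)=\sqrt{\sigma_Z^2(t)}.$$ Let $\phi$ and $\Phi$ be the density function and the cumulative distribution function of the standard Gaussian distribution $N(0,1)$. Then: (1) For every $r>0$, $$\mathbb{P}(X_t\le r)=\mathbb{E}\,\Phi\!\left(\frac{\ln\frac{r}{X_0}-\mu_Z(t)}{\sigma_Z(t)}\right).$$ (2) The random variable $X_t$ has a density function $g_{X_t}$, which has the representation $$g_{X_t}(r)=\mathbb{E}\left[\frac{1}{r\,\sigma_Z(t)}\,\phi\!\left(\frac{\ln\frac{r}{X_0}-\mu_Z(t)}{\sigma_Z(t)}\right)\right],\qquad r>0.$$ (3) If $\mathbb{E}\Big(\int_0^tY_u^2\,du\Big)^{-1/2}<\infty$, then the density function $g_{X_t}$ (given by the formula in (2)) is continuous on $(0,\infty)$.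
   Context: Linear stochastic volatility model: let $(\Omega,\mathcal{F},\mathbb{P})$ be a complete probability space with a filtration $(\mathcal{F}_t)_{t\in[0,T]}$, $0<T<\infty$, satisfying the usual conditions, $\mathcal{F}=\mathcal{F}_T$. Let $W,Z$ be standard Brownian motions with respect to this filtration, correlated with $d\langle W,Z\rangle_t=\rho\,dt$ for a constant $\rho\in(-1,1)$. The pair $(X,Y)$ satisfies $$dX_t=Y_tX_t\,dW_t,\qquad dY_t=\mu(t,Y_t)\,dt+\sigma(t,Y_t)\,dZ_t,$$ where $X_0,Y_0$ are positive constants and $\mu,\sigma:\mathbb{R}_+\times\mathbb{R}_+\to\mathbb{R}$ are continuous functions such that the equation for $Y$ has a unique strong solution, which is positive and satisfies $\int_0^TY_u^2\,du<\infty$ $\mathbb{P}$-a.s. Then $X_t=X_0\exp\big(\int_0^tY_u\,dW_u-\frac12\int_0^tY_u^2\,du\big)$. *)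

theory Defs
  imports "HOL-Probability.Probability"
begin

text \<open>
  Processes on the time interval \<open>[0, T]\<close> are functions \<open>real \<Rightarrow> 'a \<Rightarrow> real\<close>, and filtrations are
  functions \<open>real \<Rightarrow> 'a measure\<close>. Only their values at times in \<open>{0..T}\<close> matter; the times outside
  are never constrained, which is why the locale \<open>filtration\<close>, whose index set is a whole type,
  is not used.
\<close>

definition usual_filtration :: "'a measure \<Rightarrow> real \<Rightarrow> (real \<Rightarrow> 'a measure) \<Rightarrow> bool" where
  "usual_filtration M T F \<longleftrightarrow>
     (\<forall>t\<in>{0..T}. subalgebra M (F t)) \<and>
     (\<forall>s\<in>{0..T}. \<forall>t\<in>{s..T}. sets (F s) \<subseteq> sets (F t)) \<and>
     null_sets M \<subseteq> sets (F 0) \<and>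
     (\<forall>t\<in>{0..<T}. sets (F t) = (\<Inter>s\<in>{t<..T}. sets (F s)))"

definition adapted :: "real \<Rightarrow> (real \<Rightarrow> 'a measure) \<Rightarrow> (real \<Rightarrow> 'a \<Rightarrow> real) \<Rightarrow> bool" where
  "adapted T F X \<longleftrightarrow> (\<forall>t\<in>{0..T}. X t \<in> borel_measurable (F t))"

definition continuous_paths :: "'a measure \<Rightarrow> real \<Rightarrow> (real \<Rightarrow> 'a \<Rightarrow> real) \<Rightarrow> bool" where
  "continuous_paths M T X \<longleftrightarrow> (AE \<omega> in M. continuous_on {0..T} (\<lambda>t. X t \<omega>))"

definition brownian_motion ::
  "'a measure \<Rightarrow> real \<Rightarrow> (real \<Rightarrow> 'a measure) \<Rightarrow> (real \<Rightarrow> 'a \<Rightarrow> real) \<Rightarrow> bool" where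
  "brownian_motion M T F B \<longleftrightarrow>
     adapted T F B \<and>
     continuous_paths M T B \<and>
     (AE \<omega> in M. B 0 \<omega> = 0) \<and>
     (\<forall>s\<in>{0..T}. \<forall>t\<in>{s<..T}.
        prob_space.indep_set M (sets (F s))
          {(\<lambda>\<omega>. B t \<omega> - B s \<omega>) -` A \<inter> space M | A. A \<in> sets borel} \<and>
        distributed M lborel (\<lambda>\<omega>. B t \<omega> - B s \<omega>) (normal_density 0 (sqrt (t - s))))"

definition martingale ::
  "'a measure \<Rightarrow> real \<Rightarrow> (real \<Rightarrow> 'a measure) \<Rightarrow> (real \<Rightarrow> 'a \<Rightarrow> real) \<Rightarrow> bool" where
  "martingale M T F N \<longleftrightarrow>
     adapted T F N \<and>
     (\<forall>t\<in>{0..T}. integrable M (N t)) \<and>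
     (\<forall>s\<in>{0..T}. \<forall>t\<in>{s..T}. AE \<omega> in M. real_cond_exp M (F s) (N t) \<omega> = N s \<omega>)"

definition bounded_variation :: "real \<Rightarrow> (real \<Rightarrow> real) \<Rightarrow> bool" where
  "bounded_variation T f \<longleftrightarrow>
     (\<exists>C. \<forall>n (\<tau>::nat \<Rightarrow> real). mono \<tau> \<longrightarrow> range \<tau> \<subseteq> {0..T} \<longrightarrow>
        (\<Sum>i<n. \<bar>f (\<tau> (Suc i)) - f (\<tau> i)\<bar>) \<le> C)"

text \<open>
  The bracket \<open>\<langle>U, V\<rangle>\<close> of two continuous square-integrable martingales is the
  (up to indistinguishability unique) continuous adapted process \<open>A\<close> of bounded variation
  with \<open>A\<^sub>0 = 0\<close> for which \<open>U V - A\<close> is a martingale.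
\<close>

definition is_bracket :: "'a measure \<Rightarrow> real \<Rightarrow> (real \<Rightarrow> 'a measure) \<Rightarrow>
    (real \<Rightarrow> 'a \<Rightarrow> real) \<Rightarrow> (real \<Rightarrow> 'a \<Rightarrow> real) \<Rightarrow> (real \<Rightarrow> 'a \<Rightarrow> real) \<Rightarrow> bool" where
  "is_bracket M T F U V A \<longleftrightarrow>
     adapted T F A \<and>
     continuous_paths M T A \<and>
     (AE \<omega> in M. A 0 \<omega> = 0) \<and>
     (AE \<omega> in M. bounded_variation T (\<lambda>t. A t \<omega>)) \<and>
     martingale M T F (\<lambda>t \<omega>. U t \<omega> * V t \<omega> - A t \<omega>)"

text \<open>
  A simple integrand is given by a number \<open>n\<close>, times \<open>0 = \<tau> 0 < \<dots> < \<tau> n = T\<close> and bounded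
  \<open>F (\<tau> i)\<close>-measurable variables \<open>\<xi> i\<close>; it has the value \<open>\<xi> i\<close> on the interval \<open>(\<tau> i, \<tau> (i + 1)]\<close>.
\<close>

definition simple_integrand :: "'a measure \<Rightarrow> real \<Rightarrow> (real \<Rightarrow> 'a measure) \<Rightarrow>
    nat \<Rightarrow> (nat \<Rightarrow> real) \<Rightarrow> (nat \<Rightarrow> 'a \<Rightarrow> real) \<Rightarrow> bool" where
  "simple_integrand M T F n \<tau> \<xi> \<longleftrightarrow>
     \<tau> 0 = 0 \<and> \<tau> n = T \<and>
     (\<forall>i<n. \<tau> i < \<tau> (Suc i) \<and>
        \<xi> i \<in> borel_measurable (F (\<tau> i)) \<and>
        (\<exists>C. \<forall>\<omega>\<in>space M. \<bar>\<xi> i \<omega>\<bar> \<le> C))"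

definition simple_process ::
  "nat \<Rightarrow> (nat \<Rightarrow> real) \<Rightarrow> (nat \<Rightarrow> 'a \<Rightarrow> real) \<Rightarrow> real \<Rightarrow> 'a \<Rightarrow> real" where
  "simple_process n \<tau> \<xi> t \<omega> = (\<Sum>i<n. \<xi> i \<omega> * indicator {\<tau> i<..\<tau> (Suc i)} t)"

definition simple_integral :: "nat \<Rightarrow> (nat \<Rightarrow> real) \<Rightarrow> (nat \<Rightarrow> 'a \<Rightarrow> real) \<Rightarrow>
    (real \<Rightarrow> 'a \<Rightarrow> real) \<Rightarrow> real \<Rightarrow> 'a \<Rightarrow> real" where
  "simple_integral n \<tau> \<xi> B t \<omega> =
     (\<Sum>i<n. \<xi> i \<omega> * (B (min (\<tau> (Suc i)) t) \<omega> - B (min (\<tau> i) t) \<omega>))"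

text \<open>
  \<open>has_ito_integral M T F B H I\<close>: the process \<open>I\<close> is a (continuous) version of \<open>\<integral>\<^sub>0\<^sup>t H\<^sub>s dB\<^sub>s\<close>,
  \<open>t \<in> [0, T]\<close>. The integrand is adapted with almost surely square-integrable paths, and \<open>I\<close> is
  the limit, uniformly in \<open>t\<close>, of integrals of simple processes converging to \<open>H\<close> in
  \<open>L\<^sup>2([0, T])\<close>. Both limits are taken almost surely rather than in probability, which gives the
  same integral because one may pass to subsequences. Any two versions are indistinguishable.
\<close>

definition has_ito_integral :: "'a measure \<Rightarrow> real \<Rightarrow> (real \<Rightarrow> 'a measure) \<Rightarrow>
    (real \<Rightarrow> 'a \<Rightarrow> real) \<Rightarrow> (real \<Rightarrow> 'a \<Rightarrow> real) \<Rightarrow> (real \<Rightarrow> 'a \<Rightarrow> real) \<Rightarrow> bool" where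
  "has_ito_integral M T F B H I \<longleftrightarrow>
     adapted T F H \<and>
     (AE \<omega> in M. set_borel_measurable lborel {0..T} (\<lambda>s. H s \<omega>) \<and>
        set_integrable lborel {0..T} (\<lambda>s. (H s \<omega>)\<^sup>2)) \<and>
     adapted T F I \<and>
     continuous_paths M T I \<and>
     (\<exists>(n :: nat \<Rightarrow> nat) \<tau> \<xi>.
        (\<forall>k. simple_integrand M T F (n k) (\<tau> k) (\<xi> k)) \<and>
        (AE \<omega> in M. (\<lambda>k. LINT s:{0..T}|lborel.
           (simple_process (n k) (\<tau> k) (\<xi> k) s \<omega> - H s \<omega>)\<^sup>2) \<longlonglongrightarrow> 0) \<and>
        (AE \<omega> in M. uniform_limit {0..T}
           (\<lambda>k t. simple_integral (n k) (\<tau> k) (\<xi> k) B t \<omega>) (\<lambda>t. I t \<omega>) sequentially))"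

text \<open>\<open>dX\<^sub>t = a\<^sub>t dt + c\<^sub>t dB\<^sub>t\<close> on \<open>[0, T]\<close> with \<open>X\<^sub>0 = x0\<close>, in integrated form.\<close>

definition has_ito_differential :: "'a measure \<Rightarrow> real \<Rightarrow> (real \<Rightarrow> 'a measure) \<Rightarrow>
    (real \<Rightarrow> 'a \<Rightarrow> real) \<Rightarrow> real \<Rightarrow> (real \<Rightarrow> 'a \<Rightarrow> real) \<Rightarrow> (real \<Rightarrow> 'a \<Rightarrow> real) \<Rightarrow>
    (real \<Rightarrow> 'a \<Rightarrow> real) \<Rightarrow> bool" where
  "has_ito_differential M T F B x0 a c X \<longleftrightarrow>
     adapted T F X \<and>
     continuous_paths M T X \<and>
     (AE \<omega> in M. X 0 \<omega> = x0) \<and>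
     (AE \<omega> in M. set_integrable lborel {0..T} (\<lambda>s. a s \<omega>)) \<and>
     has_ito_integral M T F B c (\<lambda>t \<omega>. X t \<omega> - x0 - (LINT s:{0..t}|lborel. a s \<omega>))"

definition augmented_natural_filtration ::
  "'a measure \<Rightarrow> (real \<Rightarrow> 'a \<Rightarrow> real) \<Rightarrow> real \<Rightarrow> 'a measure" where
  "augmented_natural_filtration M B t =
     sigma (space M)
       ({B s -` A \<inter> space M | s A. s \<in> {0..t} \<and> A \<in> sets borel} \<union> null_sets M)"

text \<open>
  A strong solution is adapted to the augmented filtration generated by the driving Brownian
  motion alone (the initial value is a constant). The coefficients \<open>\<mu>\<close>, \<open>\<sigma>\<close> are only given
  on \<open>[0, \<infinity>) \<times> [0, \<infinity>)\<close>, so a solution must take its values in \<open>[0, \<infinity>)\<close>.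
\<close>

definition strong_solution :: "'a measure \<Rightarrow> real \<Rightarrow> (real \<Rightarrow> 'a \<Rightarrow> real) \<Rightarrow>
    (real \<Rightarrow> real \<Rightarrow> real) \<Rightarrow> (real \<Rightarrow> real \<Rightarrow> real) \<Rightarrow> real \<Rightarrow> (real \<Rightarrow> 'a \<Rightarrow> real) \<Rightarrow> bool" where
  "strong_solution M T B \<mu> \<sigma> y0 Y \<longleftrightarrow>
     (AE \<omega> in M. \<forall>t\<in>{0..T}. 0 \<le> Y t \<omega>) \<and>
     has_ito_differential M T (augmented_natural_filtration M B) B y0
       (\<lambda>t \<omega>. \<mu> t (Y t \<omega>)) (\<lambda>t \<omega>. \<sigma> t (Y t \<omega>)) Y"

definition unique_strong_solution :: "'a measure \<Rightarrow> real \<Rightarrow> (real \<Rightarrow> 'a \<Rightarrow> real) \<Rightarrow>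
    (real \<Rightarrow> real \<Rightarrow> real) \<Rightarrow> (real \<Rightarrow> real \<Rightarrow> real) \<Rightarrow> real \<Rightarrow> (real \<Rightarrow> 'a \<Rightarrow> real) \<Rightarrow> bool" where
  "unique_strong_solution M T B \<mu> \<sigma> y0 Y \<longleftrightarrow>
     strong_solution M T B \<mu> \<sigma> y0 Y \<and>
     (\<forall>Y'. strong_solution M T B \<mu> \<sigma> y0 Y' \<longrightarrow>
        (AE \<omega> in M. \<forall>t\<in>{0..T}. Y' t \<omega> = Y t \<omega>))"

definition linear_sv_model :: "'a measure \<Rightarrow> real \<Rightarrow> (real \<Rightarrow> 'a measure) \<Rightarrow> real \<Rightarrow>
    (real \<Rightarrow> 'a \<Rightarrow> real) \<Rightarrow> (real \<Rightarrow> 'a \<Rightarrow> real) \<Rightarrow>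
    (real \<Rightarrow> real \<Rightarrow> real) \<Rightarrow> (real \<Rightarrow> real \<Rightarrow> real) \<Rightarrow> real \<Rightarrow> real \<Rightarrow>
    (real \<Rightarrow> 'a \<Rightarrow> real) \<Rightarrow> (real \<Rightarrow> 'a \<Rightarrow> real) \<Rightarrow> bool" where
  "linear_sv_model M T F \<rho> W Z \<mu> \<sigma> x0 y0 X Y \<longleftrightarrow>
     prob_space M \<and> complete_measure M \<and> 0 < T \<and>
     usual_filtration M T F \<and> sets (F T) = sets M \<and>
     brownian_motion M T F W \<and> brownian_motion M T F Z \<and>
     - 1 < \<rho> \<and> \<rho> < 1 \<and> is_bracket M T F W Z (\<lambda>t \<omega>. \<rho> * t) \<and>
     0 < x0 \<and> 0 < y0 \<and>
     continuous_on ({0..} \<times> {0..}) (\<lambda>(t, y). \<mu> t y) \<and>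
     continuous_on ({0..} \<times> {0..}) (\<lambda>(t, y). \<sigma> t y) \<and>
     unique_strong_solution M T Z \<mu> \<sigma> y0 Y \<and>
     (AE \<omega> in M. \<forall>t\<in>{0..T}. 0 < Y t \<omega>) \<and>
     (AE \<omega> in M. set_integrable lborel {0..T} (\<lambda>u. (Y u \<omega>)\<^sup>2)) \<and>
     has_ito_differential M T F W x0 (\<lambda>t \<omega>. 0) (\<lambda>t \<omega>. Y t \<omega> * X t \<omega>) X"

definition integrated_variance :: "(real \<Rightarrow> 'a \<Rightarrow> real) \<Rightarrow> real \<Rightarrow> 'a \<Rightarrow> real" where
  "integrated_variance Y t \<omega> = (LINT u:{0..t}|lborel. (Y u \<omega>)\<^sup>2)"

text \<open>\<open>I\<close> stands for a version of \<open>\<integral>\<^sub>0\<^sup>t Y\<^sub>u dZ\<^sub>u\<close>.\<close>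

definition mu_Z ::
  "real \<Rightarrow> (real \<Rightarrow> 'a \<Rightarrow> real) \<Rightarrow> (real \<Rightarrow> 'a \<Rightarrow> real) \<Rightarrow> real \<Rightarrow> 'a \<Rightarrow> real" where
  "mu_Z \<rho> I Y t \<omega> = \<rho> * I t \<omega> - 1 / 2 * integrated_variance Y t \<omega>"

definition sigma_Z :: "real \<Rightarrow> (real \<Rightarrow> 'a \<Rightarrow> real) \<Rightarrow> real \<Rightarrow> 'a \<Rightarrow> real" where
  "sigma_Z \<rho> Y t \<omega> = sqrt ((1 - \<rho>\<^sup>2) * integrated_variance Y t \<omega>)"

text \<open>
  The expectation of a nonnegative variable, hence an element of \<open>[0, \<infinity>]\<close>: without the
  hypothesis on the negative moment it may be infinite for exceptional \<open>r\<close>.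
\<close>

definition density_X :: "'a measure \<Rightarrow> real \<Rightarrow> real \<Rightarrow> (real \<Rightarrow> 'a \<Rightarrow> real) \<Rightarrow>
    (real \<Rightarrow> 'a \<Rightarrow> real) \<Rightarrow> real \<Rightarrow> real \<Rightarrow> ennreal" where
  "density_X M \<rho> x0 I Y t r =
     (\<integral>\<^sup>+ \<omega>. ennreal (1 / (r * sigma_Z \<rho> Y t \<omega>) *
        std_normal_density ((ln (r / x0) - mu_Z \<rho> I Y t \<omega>) / sigma_Z \<rho> Y t \<omega>)) \<partial>M)"

end

theory Submission
  imports Defs
begin

text \<open>
  Everything is done on time grids. Along fine grids the Ito integrals defining \<open>X\<close> and \<open>\<integral> Y dZ\<close>
  are martingale transforms, and a discrete \<open>L\<^sup>2\<close> Gronwall estimate shows that \<open>X\<^sub>t\<close> is the limit in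
  probability of \<open>X\<^sub>0 exp L\<^sub>k\<close> with \<open>L\<^sub>k = \<Sum> Y \<Delta>W - 1/2 \<Sum> Y\<^sup>2 \<Delta>t\<close>; this replaces Ito's formula.
  The bracket condition yields, by a Lindeberg type expansion of characteristic functions, that
  \<open>B = W - \<rho> Z\<close> has Gaussian increments independent of the augmented filtration of \<open>Z\<close>, to which \<open>Y\<close>
  is adapted. Hence, conditionally on \<open>Z\<close>, \<open>L\<^sub>k\<close> is Gaussian, its characteristic function converges to
  that of \<open>\<mu>\<^sub>Z(t) + \<sigma>\<^sub>Z(t) N\<close> with \<open>N\<close> standard normal and independent of \<open>Z\<close>, and Levy's continuity theorem
  identifies the law of \<open>X\<^sub>t\<close>. The three assertions are then computations with this lognormal mixture.
\<close>

section \<open>Gaussian increments independent of the past\<close>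

text \<open>The model prescribes only the bracket of \<open>W\<close> and \<open>Z\<close>; that the
  pair is jointly Gaussian, and hence that \<open>W - \<rho> Z\<close> is independent of
  \<open>Z\<close>, must be extracted from it, which is Levy's characterisation in disguise. The
  sums approximating \<open>X\<close> may be negative, so their logarithms cannot be studied. They
  are compared with \<open>x0 * exp (L k)\<close> on the scale of \<open>X\<close>, in probability;
  the law of \<open>L k\<close> is found separately, and the two limits meet only at the end, when
  the limit law of \<open>L k\<close> is pushed forward by the exponential. Convergence of
  \<open>L k\<close> in law is enough for this. \<open>Y\<close> enters with two measurabilities.
  Adapted to \<open>F\<close>, it is independent of the next increment of \<open>W\<close> or
  \<open>Z\<close>, which gives the second moment estimates. Measurable with respect to the
  filtration of \<open>Z\<close>, which is what strongness of the solution provides, it can be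
  frozen while the orthogonal part of \<open>W\<close> is integrated out. No moments of
  \<open>Y\<close> are available. Its paths are bounded, though, so it is cut off at a level
  \<open>K\<close> exceeded with small probability, and \<open>K\<close> is fixed before the mesh
  tends to 0.\<close>

definition indep_normal :: "'a measure \<Rightarrow> 'a measure \<Rightarrow> real \<Rightarrow> ('a \<Rightarrow> real) \<Rightarrow> bool" where
  "indep_normal M G h N \<longleftrightarrow> 0 < h \<and> subalgebra M G \<and> N \<in> borel_measurable M \<and>
     prob_space.indep_set M (sets G) {N -` A \<inter> space M | A. A \<in> sets borel} \<and>
     distributed M lborel N (normal_density 0 (sqrt h))"

lemma (in prob_space) distr_indep_normal:
  assumes N: "indep_normal M G h N" and U: "U \<in> measurable G L"
  shows "distr M L U \<Otimes>\<^sub>M density lborel (normal_density 0 (sqrt h)) = distr M (L \<Otimes>\<^sub>M borel) (\<lambda>\<omega>. (U \<omega>, N \<omega>))"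
proof -
  have sub: "subalgebra M G" and NM[measurable]: "N \<in> borel_measurable M"
    and ind: "indep_set (sets G) {N -` A \<inter> space M | A. A \<in> sets borel}"
    using N by (simp_all add: indep_normal_def)
  have UM[measurable]: "U \<in> measurable M L"
    by (rule measurable_from_subalg[OF sub U])
  have dN: "distr M borel N = density lborel (normal_density 0 (sqrt h))"
    using N distributed_distr_eq_density[of M lborel N "normal_density 0 (sqrt h)"] distr_cong[of M M lborel borel N N]
    by (simp add: indep_normal_def)
  interpret D: prob_space "distr M borel N" by (rule prob_space_distr) measurable
  interpret DU: prob_space "distr M L U" by (rule prob_space_distr) measurable
  have "distr M L U \<Otimes>\<^sub>M distr M borel N = distr M (L \<Otimes>\<^sub>M borel) (\<lambda>\<omega>. (U \<omega>, N \<omega>))"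
  proof (rule pair_measure_eqI)
    show "sigma_finite_measure (distr M L U)" "sigma_finite_measure (distr M borel N)"
      by unfold_locales
    show "sets (distr M L U \<Otimes>\<^sub>M distr M borel N) = sets (distr M (L \<Otimes>\<^sub>M borel) (\<lambda>\<omega>. (U \<omega>, N \<omega>)))"
      unfolding sets_distr by (intro sets_pair_measure_cong) simp_all
    fix A B assume "A \<in> sets (distr M L U)" "B \<in> sets (distr M borel N)"
    then have A[measurable]: "A \<in> sets L" and B[measurable]: "B \<in> sets borel" by simp_all
    have UG: "U -` A \<inter> space M \<in> sets G"
      using measurable_sets[OF U A] sub by (simp add: subalgebra_def)
    have "prob ((U -` A \<inter> space M) \<inter> (N -` B \<inter> space M)) = prob (U -` A \<inter> space M) * prob (N -` B \<inter> space M)"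
      using ind UG B unfolding indep_sets2_eq by blast
    moreover have "(\<lambda>\<omega>. (U \<omega>, N \<omega>)) -` (A \<times> B) \<inter> space M = (U -` A \<inter> space M) \<inter> (N -` B \<inter> space M)"
      by auto
    ultimately show "emeasure (distr M L U) A * emeasure (distr M borel N) B =
        emeasure (distr M (L \<Otimes>\<^sub>M borel) (\<lambda>\<omega>. (U \<omega>, N \<omega>))) (A \<times> B)"
      by (simp add: emeasure_distr emeasure_eq_measure ennreal_mult[symmetric])
  qed
  then show ?thesis by (simp add: dN)
qed

text \<open>Freezing: the joint law of past and increment is a product, so the past \<open>U\<close>
  is held fixed while \<open>N\<close> is integrated against its density. Working with nonnegative
  integrals lets second moments be computed before they are known to be finite.\<close>

lemma (in prob_space) nn_integral_indep_normal:
  assumes N: "indep_normal M G h N" and U: "U \<in> measurable G L"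
    and f[measurable]: "f \<in> borel_measurable (L \<Otimes>\<^sub>M borel)"
  shows "(\<integral>\<^sup>+\<omega>. f (U \<omega>, N \<omega>) \<partial>M) =
    (\<integral>\<^sup>+\<omega>. (\<integral>\<^sup>+x. ennreal (normal_density 0 (sqrt h) x) * f (U \<omega>, x) \<partial>lborel) \<partial>M)"
proof -
  have sub: "subalgebra M G" and [measurable]: "N \<in> borel_measurable M" and h: "0 < sqrt h"
    using N by (simp_all add: indep_normal_def)
  have [measurable]: "U \<in> measurable M L"
    by (rule measurable_from_subalg[OF sub U])
  interpret D: prob_space "density lborel (normal_density 0 (sqrt h))"
    by (rule prob_space_normal_density[OF h])
  have sp: "sets (distr M L U \<Otimes>\<^sub>M density lborel (normal_density 0 (sqrt h))) = sets (L \<Otimes>\<^sub>M borel)"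
    by (rule sets_pair_measure_cong) simp_all
  have f': "f \<in> borel_measurable (distr M L U \<Otimes>\<^sub>M density lborel (normal_density 0 (sqrt h)))"
    using f by (subst measurable_cong_sets[OF sp refl])
  have "(\<integral>\<^sup>+\<omega>. f (U \<omega>, N \<omega>) \<partial>M) = (\<integral>\<^sup>+z. f z \<partial>distr M (L \<Otimes>\<^sub>M borel) (\<lambda>\<omega>. (U \<omega>, N \<omega>)))"
    by (subst nn_integral_distr) auto
  also have "\<dots> = (\<integral>\<^sup>+z. f z \<partial>(distr M L U \<Otimes>\<^sub>M density lborel (normal_density 0 (sqrt h))))"
    by (simp only: distr_indep_normal[OF N U])
  also have "\<dots> = (\<integral>\<^sup>+u. (\<integral>\<^sup>+x. f (u, x) \<partial>density lborel (normal_density 0 (sqrt h))) \<partial>distr M L U)"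
    by (rule D.nn_integral_fst[OF f', symmetric])
  also have "\<dots> = (\<integral>\<^sup>+\<omega>. (\<integral>\<^sup>+x. f (U \<omega>, x) \<partial>density lborel (normal_density 0 (sqrt h))) \<partial>M)"
    by (subst nn_integral_distr) auto
  also have "\<dots> = (\<integral>\<^sup>+\<omega>. (\<integral>\<^sup>+x. ennreal (normal_density 0 (sqrt h) x) * f (U \<omega>, x) \<partial>lborel) \<partial>M)"
  proof (rule nn_integral_cong)
    fix \<omega> assume "\<omega> \<in> space M"
    then have "U \<omega> \<in> space L" using measurable_space[of U M L] by auto
    then show "(\<integral>\<^sup>+x. f (U \<omega>, x) \<partial>density lborel (normal_density 0 (sqrt h))) =
      (\<integral>\<^sup>+x. ennreal (normal_density 0 (sqrt h) x) * f (U \<omega>, x) \<partial>lborel)"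
      by (intro nn_integral_density) measurable
  qed
  finally show ?thesis .
qed

text \<open>Completing the square: the exponential martingale factor tilts \<open>N(0, h)\<close> to
  mean \<open>y * h\<close>, a one-step Girsanov transformation.\<close>

lemma normal_density_shift:
  assumes "0 < h"
  shows "normal_density 0 (sqrt h) x * exp (y * x - y\<^sup>2 * h / 2) = normal_density (y * h) (sqrt h) x"
proof -
  have "- x\<^sup>2 / (2 * h) + (y * x - y\<^sup>2 * h / 2) = - (x - y * h)\<^sup>2 / (2 * h)"
    using assms by (simp add: field_simps power2_eq_square)
  then show ?thesis
    using assms by (simp add: normal_density_def exp_add[symmetric])
qed

text \<open>
  The variables \<open>1\<close>, \<open>x\<close> and \<open>exp (y x - y\<^sup>2 h / 2) - 1 - y x\<close> are orthogonal under \<open>N(0, h)\<close>.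
\<close>

lemma has_bochner_integral_normal_quadratic_exp:
  assumes h: "0 < h"
  shows "has_bochner_integral lborel
    (\<lambda>x. normal_density 0 (sqrt h) x * (e + c * x - p * (exp (y * x - y\<^sup>2 * h / 2) - 1 - y * x))\<^sup>2)
    (e\<^sup>2 + c\<^sup>2 * h + p\<^sup>2 * (exp (y\<^sup>2 * h) - 1 - y\<^sup>2 * h))"
proof -
  define n where "n a = normal_density a (sqrt h)" for a
  \<comment> \<open>Expanding the bracket as \<open>a + b * x - p * E\<close>, with \<open>E\<close>
    the exponential, the constants \<open>a\<close> and \<open>b\<close> collect the terms free of
    \<open>x\<close> and linear in \<open>x\<close>.\<close>
  define a where "a = e + p"
  define b where "b = c + p * y"
  have s: "0 < sqrt h" using h by simp
  have i0: "has_bochner_integral lborel (n z) 1" for z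
    using normal_moment_even[OF s, of z 0] by (simp add: n_def)
  have i1: "has_bochner_integral lborel (\<lambda>x. n z x * x) z" for z
    using normal_moment_nz_1[OF s, of z] by (simp add: n_def)
  have i2: "has_bochner_integral lborel (\<lambda>x. n 0 x * x\<^sup>2) h"
    using normal_moment_even[OF s, of 0 1] h by (simp add: n_def power2_eq_square[symmetric])
  have s1: "n 0 x * exp (y * x - y\<^sup>2 * h / 2) = n (y * h) x" for x
    unfolding n_def by (rule normal_density_shift[OF h])
  \<comment> \<open>The square of the tilt by \<open>y\<close> is the tilt by \<open>2 * y\<close>
    times a constant; that constant is the growth factor of the second moment.\<close>
  have s2: "n 0 x * (exp (y * x - y\<^sup>2 * h / 2))\<^sup>2 = exp (y\<^sup>2 * h) * n (2 * y * h) x" for x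
  proof -
    have "(exp (y * x - y\<^sup>2 * h / 2))\<^sup>2 = exp (2 * y * x - (2*y)\<^sup>2 * h / 2) * exp (y\<^sup>2 * h)"
      by (simp add: exp_add[symmetric] exp_double[symmetric] power2_eq_square field_simps)
    then show ?thesis
      using normal_density_shift[OF h, of x "2*y"] by (simp add: n_def mult_ac)
  qed
  have "has_bochner_integral lborel
    (\<lambda>x. a\<^sup>2 * n 0 x + (2 * a * b) * (n 0 x * x) + b\<^sup>2 * (n 0 x * x\<^sup>2) + (p\<^sup>2 * exp (y\<^sup>2 * h)) * n (2 * y * h) x
       - (2 * a * p) * n (y * h) x - (2 * b * p) * (n (y * h) x * x))
    (a\<^sup>2 * 1 + (2 * a * b) * 0 + b\<^sup>2 * h + (p\<^sup>2 * exp (y\<^sup>2 * h)) * 1 - (2 * a * p) * 1 - (2 * b * p) * (y * h))"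
    by (intro has_bochner_integral_add has_bochner_integral_diff has_bochner_integral_mult_right i0 i1 i2)
  moreover have "a\<^sup>2 * n 0 x + (2 * a * b) * (n 0 x * x) + b\<^sup>2 * (n 0 x * x\<^sup>2) + (p\<^sup>2 * exp (y\<^sup>2 * h)) * n (2 * y * h) x
       - (2 * a * p) * n (y * h) x - (2 * b * p) * (n (y * h) x * x) =
      n 0 x * (e + c * x - p * (exp (y * x - y\<^sup>2 * h / 2) - 1 - y * x))\<^sup>2" for x
  proof -
    define E where "E = exp (y * x - y\<^sup>2 * h / 2)"
    have "n 0 x * (e + c * x - p * (E - 1 - y * x))\<^sup>2 =
      a\<^sup>2 * n 0 x + (2 * a * b) * (n 0 x * x) + b\<^sup>2 * (n 0 x * x\<^sup>2) + p\<^sup>2 * (n 0 x * E\<^sup>2)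
       - (2 * a * p) * (n 0 x * E) - (2 * b * p) * (n 0 x * E * x)"
      unfolding a_def b_def by algebra
    then show ?thesis unfolding E_def s1 s2 by simp
  qed
  moreover have "a\<^sup>2 * 1 + (2 * a * b) * 0 + b\<^sup>2 * h + (p\<^sup>2 * exp (y\<^sup>2 * h)) * 1 - (2 * a * p) * 1 - (2 * b * p) * (y * h)
     = e\<^sup>2 + c\<^sup>2 * h + p\<^sup>2 * (exp (y\<^sup>2 * h) - 1 - y\<^sup>2 * h)"
    unfolding a_def b_def by algebra
  ultimately show ?thesis by (simp add: n_def)
qed

text \<open>Given \<open>G\<close> the four coefficients are constants, so the Gaussian integral
  above applies pointwise in \<open>\<omega>\<close> and the three orthogonal parts contribute
  without cross terms.\<close>

lemma (in prob_space) second_moment_step: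
  assumes N: "indep_normal M G h N"
    and [measurable]: "e \<in> borel_measurable G" "c \<in> borel_measurable G" "p \<in> borel_measurable G" "y \<in> borel_measurable G"
  shows "(\<integral>\<^sup>+\<omega>. ennreal ((e \<omega> + c \<omega> * N \<omega> - p \<omega> * (exp (y \<omega> * N \<omega> - (y \<omega>)\<^sup>2 * h / 2) - 1 - y \<omega> * N \<omega>))\<^sup>2) \<partial>M) =
    (\<integral>\<^sup>+\<omega>. ennreal ((e \<omega>)\<^sup>2 + (c \<omega>)\<^sup>2 * h + (p \<omega>)\<^sup>2 * (exp ((y \<omega>)\<^sup>2 * h) - 1 - (y \<omega>)\<^sup>2 * h)) \<partial>M)"
proof -
  have h: "0 < h" using N by (simp add: indep_normal_def)
  define U where "U \<omega> = (e \<omega>, c \<omega>, p \<omega>, y \<omega>)" for \<omega>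
  define f where "f = (\<lambda>((e, c, p, y), x). ennreal ((e + c * x - p * (exp (y * x - y\<^sup>2 * h / 2) - 1 - y * x))\<^sup>2))"
  have U: "U \<in> measurable G (borel \<Otimes>\<^sub>M borel \<Otimes>\<^sub>M borel \<Otimes>\<^sub>M borel)"
    unfolding U_def by measurable
  have f: "f \<in> borel_measurable ((borel \<Otimes>\<^sub>M borel \<Otimes>\<^sub>M borel \<Otimes>\<^sub>M borel) \<Otimes>\<^sub>M borel)"
    unfolding f_def split_beta' by measurable
  have "(\<integral>\<^sup>+\<omega>. f (U \<omega>, N \<omega>) \<partial>M) = (\<integral>\<^sup>+\<omega>. (\<integral>\<^sup>+x. ennreal (normal_density 0 (sqrt h) x) * f (U \<omega>, x) \<partial>lborel) \<partial>M)"
    by (rule nn_integral_indep_normal[OF N U f])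
  also have "\<dots> = (\<integral>\<^sup>+\<omega>. ennreal ((e \<omega>)\<^sup>2 + (c \<omega>)\<^sup>2 * h + (p \<omega>)\<^sup>2 * (exp ((y \<omega>)\<^sup>2 * h) - 1 - (y \<omega>)\<^sup>2 * h)) \<partial>M)"
  proof (rule nn_integral_cong)
    fix \<omega>
    note hb = has_bochner_integral_normal_quadratic_exp[OF h, of "e \<omega>" "c \<omega>" "p \<omega>" "y \<omega>"]
    have "(\<integral>\<^sup>+x. ennreal (normal_density 0 (sqrt h) x) * f (U \<omega>, x) \<partial>lborel) =
       (\<integral>\<^sup>+x. ennreal (normal_density 0 (sqrt h) x * (e \<omega> + c \<omega> * x - p \<omega> * (exp (y \<omega> * x - (y \<omega>)\<^sup>2 * h / 2) - 1 - y \<omega> * x))\<^sup>2) \<partial>lborel)"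
      by (simp add: f_def U_def ennreal_mult)
    also have "\<dots> = ennreal ((e \<omega>)\<^sup>2 + (c \<omega>)\<^sup>2 * h + (p \<omega>)\<^sup>2 * (exp ((y \<omega>)\<^sup>2 * h) - 1 - (y \<omega>)\<^sup>2 * h))"
      using hb by (subst nn_integral_eq_integral) (auto simp: has_bochner_integral_iff)
    finally show "(\<integral>\<^sup>+x. ennreal (normal_density 0 (sqrt h) x) * f (U \<omega>, x) \<partial>lborel) = \<dots>" .
  qed
  finally show ?thesis by (simp add: f_def U_def)
qed

text \<open>Special case \<open>e = - p\<close>, \<open>c = - p * y\<close> of the previous step:
  constant and linear parts cancel and only \<open>- p\<close> times the exponential
  survives.\<close>

lemma (in prob_space) second_moment_exp_step:
  assumes N: "indep_normal M G h N"
    and [measurable]: "p \<in> borel_measurable G" "y \<in> borel_measurable G"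
  shows "(\<integral>\<^sup>+\<omega>. ennreal ((p \<omega> * exp (y \<omega> * N \<omega> - (y \<omega>)\<^sup>2 * h / 2))\<^sup>2) \<partial>M) =
    (\<integral>\<^sup>+\<omega>. ennreal ((p \<omega>)\<^sup>2 * exp ((y \<omega>)\<^sup>2 * h)) \<partial>M)"
proof -
  have *: "- p \<omega> + - p \<omega> * y \<omega> * N \<omega> - p \<omega> * (exp (y \<omega> * N \<omega> - (y \<omega>)\<^sup>2 * h / 2) - 1 - y \<omega> * N \<omega>) =
    - (p \<omega> * exp (y \<omega> * N \<omega> - (y \<omega>)\<^sup>2 * h / 2))" for \<omega>
    by (simp add: algebra_simps)
  have **: "(- p \<omega>)\<^sup>2 + (- p \<omega> * y \<omega>)\<^sup>2 * h + (p \<omega>)\<^sup>2 * (exp ((y \<omega>)\<^sup>2 * h) - 1 - (y \<omega>)\<^sup>2 * h)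
    = (p \<omega>)\<^sup>2 * exp ((y \<omega>)\<^sup>2 * h)" for \<omega>
    by (simp add: algebra_simps power_mult_distrib)
  have [measurable]: "(\<lambda>\<omega>. - p \<omega>) \<in> borel_measurable G" "(\<lambda>\<omega>. - p \<omega> * y \<omega>) \<in> borel_measurable G" by measurable
  show ?thesis
    using second_moment_step[OF N, of "\<lambda>\<omega>. - p \<omega>" "\<lambda>\<omega>. - p \<omega> * y \<omega>" p y, OF _ _ assms(2,3)]
    unfolding * ** by simp
qed

section \<open>A discrete Gronwall estimate\<close>

text \<open>The outer exponential is the Gronwall factor, with rate \<open>2 * K^2\<close> from
  \<open>(a + b)^2 \<le> 2 * a^2 + 2 * b^2\<close>, which also yields \<open>2 * \<delta>\<close>
  for the perturbation. The other summand is the linearisation error: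
  \<open>x0^2 * exp (K^2 * \<tau>)\<close> bounds the second moment of \<open>wexp\<close>, and
  \<open>\<eta> * \<tau>\<close> the sum of the squared gaps.\<close>

definition err_bound :: "real \<Rightarrow> real \<Rightarrow> real \<Rightarrow> real \<Rightarrow> real \<Rightarrow> real" where
  "err_bound x0 K \<tau> \<eta> \<delta> = exp (2 * K\<^sup>2 * \<tau>) * (2 * \<delta> + K^4 * exp (K\<^sup>2 * \<tau>) * (x0\<^sup>2 * exp (K\<^sup>2 * \<tau>)) * \<eta> * \<tau>)"

text \<open>Multiplying \<open>1 - a \<le> exp (- a)\<close> by \<open>exp a\<close> gives
  \<open>exp a - 1 \<le> a * exp a\<close>; using this bound twice produces the square.\<close>

lemma exp_minus_1_minus_id_le:
  assumes "0 \<le> (a::real)"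
  shows "exp a - 1 - a \<le> a\<^sup>2 * exp a"
proof -
  have "1 - a \<le> exp (- a)" using exp_ge_add_one_self[of "-a"] by simp
  then have "(1 - a) * exp a \<le> exp (- a) * exp a" by (intro mult_right_mono) auto
  then have 1: "exp a - 1 \<le> a * exp a" by (simp add: algebra_simps exp_minus)
  have "exp a - 1 - a \<le> a * (exp a - 1)" using 1 by (simp add: algebra_simps)
  also have "\<dots> \<le> a * (a * exp a)" using 1 assms by (intro mult_left_mono) auto
  finally show ?thesis by (simp add: power2_eq_square mult.assoc)
qed

text \<open>What the Gronwall estimate uses of a Brownian motion on one grid. It is applied to
  \<open>W\<close>, to compare the sums for \<open>X\<close> with an exponential, and to
  \<open>Z\<close>, to compare two approximations of the same stochastic integral.\<close>

locale normal_increments = prob_space M for M :: "'a measure" +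
  fixes G :: "nat \<Rightarrow> 'a measure" and dt :: "nat \<Rightarrow> real" and N :: "nat \<Rightarrow> 'a \<Rightarrow> real" and m :: nat
  assumes incr: "i < m \<Longrightarrow> indep_normal M (G i) (dt i) (N i)"
    and incr_adapted: "i < m \<Longrightarrow> N i \<in> borel_measurable (G (Suc i))"
    and filt: "i < m \<Longrightarrow> subalgebra (G (Suc i)) (G i)"
    and sub: "i \<le> m \<Longrightarrow> subalgebra M (G i)"
begin

lemma dt_pos: "i < m \<Longrightarrow> 0 < dt i"
  using incr by (auto simp: indep_normal_def)

lemma measurable_later:
  assumes "i \<le> j" "j \<le> m" "f \<in> measurable (G i) L"
  shows "f \<in> measurable (G j) L"
  using assms(1,2)
proof (induction j rule: dec_induct)
  case base show ?case by fact
next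
  case (step j)
  then show ?case by (intro measurable_from_subalg[OF filt]) auto
qed

lemma measurable_Suc: "i < m \<Longrightarrow> f \<in> measurable (G i) L \<Longrightarrow> f \<in> measurable (G (Suc i)) L"
  by (rule measurable_from_subalg[OF filt])

lemma measurable_ambient: "i \<le> m \<Longrightarrow> f \<in> measurable (G i) L \<Longrightarrow> f \<in> measurable M L"
  by (rule measurable_from_subalg[OF sub])

text \<open>The stochastic exponential of the discrete martingale with increments
  \<open>y j * N j\<close>, started at \<open>x0\<close>.\<close>

definition wexp :: "real \<Rightarrow> (nat \<Rightarrow> 'a \<Rightarrow> real) \<Rightarrow> nat \<Rightarrow> 'a \<Rightarrow> real" where
  "wexp x0 y i \<omega> = x0 * exp (\<Sum>j<i. y j \<omega> * N j \<omega> - (y j \<omega>)\<^sup>2 * dt j / 2)"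

lemma wexp_Suc: "wexp x0 y (Suc i) \<omega> = wexp x0 y i \<omega> * exp (y i \<omega> * N i \<omega> - (y i \<omega>)\<^sup>2 * dt i / 2)"
  by (simp add: wexp_def exp_add mult_ac)

text \<open>
  If \<open>S\<close> has increments \<open>(y S + h) N\<close>, then \<open>err\<close> is the difference \<open>S - wexp\<close>. It is driven by martingale
  increments, and the last summand, the error of replacing the exponential by its linear part, has
  a second moment of order \<open>dt\<^sup>2\<close>.
\<close>

primrec err :: "real \<Rightarrow> (nat \<Rightarrow> 'a \<Rightarrow> real) \<Rightarrow> (nat \<Rightarrow> 'a \<Rightarrow> real) \<Rightarrow> nat \<Rightarrow> 'a \<Rightarrow> real" where
  "err x0 y h 0 \<omega> = 0"
| "err x0 y h (Suc i) \<omega> = err x0 y h i \<omega> + (y i \<omega> * err x0 y h i \<omega> + h i \<omega>) * N i \<omega>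
     - wexp x0 y i \<omega> * (exp (y i \<omega> * N i \<omega> - (y i \<omega>)\<^sup>2 * dt i / 2) - 1 - y i \<omega> * N i \<omega>)"

lemma wexp_measurable:
  assumes "\<And>i. i < m \<Longrightarrow> y i \<in> borel_measurable (G i)" "i \<le> m"
  shows "wexp x0 y i \<in> borel_measurable (G i)"
  using assms(2)
proof (induction i)
  case 0 then show ?case by (simp add: wexp_def)
next
  case (Suc i)
  then have [measurable]: "wexp x0 y i \<in> borel_measurable (G (Suc i))" "y i \<in> borel_measurable (G (Suc i))"
    "N i \<in> borel_measurable (G (Suc i))"
    using Suc_le_lessD[OF Suc.prems] by (simp_all add: measurable_Suc assms(1) incr_adapted)
  show ?case unfolding wexp_Suc[abs_def] by measurable
qed

lemma err_measurable:
  assumes "\<And>i. i < m \<Longrightarrow> y i \<in> borel_measurable (G i)" "\<And>i. i < m \<Longrightarrow> h i \<in> borel_measurable (G i)" "i \<le> m"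
  shows "err x0 y h i \<in> borel_measurable (G i)"
  using assms(3)
proof (induction i)
  case 0 then show ?case by (simp cong: measurable_cong)
next
  case (Suc i)
  then have [measurable]: "wexp x0 y i \<in> borel_measurable (G (Suc i))" "y i \<in> borel_measurable (G (Suc i))"
    "h i \<in> borel_measurable (G (Suc i))" "err x0 y h i \<in> borel_measurable (G (Suc i))"
    "N i \<in> borel_measurable (G (Suc i))"
    using Suc_le_lessD[OF Suc.prems] by (simp_all add: measurable_Suc assms(1,2) incr_adapted wexp_measurable)
  show ?case unfolding err.simps(2)[abs_def] by measurable
qed

text \<open>By the exact one-step formula each step multiplies the second moment by at most
  \<open>exp (K^2 * dt i)\<close>.\<close>

lemma wexp_moment:
  assumes y: "\<And>i. i < m \<Longrightarrow> y i \<in> borel_measurable (G i)"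
    and K: "\<And>i \<omega>. i < m \<Longrightarrow> \<bar>y i \<omega>\<bar> \<le> K" and i: "i \<le> m"
  shows "(\<integral>\<^sup>+\<omega>. ennreal ((wexp x0 y i \<omega>)\<^sup>2) \<partial>M) \<le> ennreal (x0\<^sup>2 * exp (K\<^sup>2 * (\<Sum>j<i. dt j)))"
  using i
proof (induction i)
  case 0 then show ?case by (simp add: wexp_def emeasure_space_1)
next
  case (Suc i)
  then have i: "i < m" "i \<le> m" by auto
  have [measurable]: "wexp x0 y i \<in> borel_measurable M"
    by (intro measurable_ambient[OF i(2)] wexp_measurable[OF y]) (use i in auto)
  have "(\<integral>\<^sup>+\<omega>. ennreal ((wexp x0 y (Suc i) \<omega>)\<^sup>2) \<partial>M) = (\<integral>\<^sup>+\<omega>. ennreal ((wexp x0 y i \<omega>)\<^sup>2 * exp ((y i \<omega>)\<^sup>2 * dt i)) \<partial>M)"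
    unfolding wexp_Suc by (rule second_moment_exp_step[OF incr[OF i(1)]]) (use wexp_measurable[OF y] y i in auto)
  also have "\<dots> \<le> (\<integral>\<^sup>+\<omega>. ennreal (exp (K\<^sup>2 * dt i)) * ennreal ((wexp x0 y i \<omega>)\<^sup>2) \<partial>M)"
  proof (rule nn_integral_mono)
    fix \<omega>
    have "(y i \<omega>)\<^sup>2 \<le> K\<^sup>2" using power_mono[OF K[OF i(1), of \<omega>], of 2] by simp
    then have "exp ((y i \<omega>)\<^sup>2 * dt i) \<le> exp (K\<^sup>2 * dt i)"
      using dt_pos[OF i(1)] by (simp add: mult_right_mono)
    then show "ennreal ((wexp x0 y i \<omega>)\<^sup>2 * exp ((y i \<omega>)\<^sup>2 * dt i)) \<le> ennreal (exp (K\<^sup>2 * dt i)) * ennreal ((wexp x0 y i \<omega>)\<^sup>2)"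
      by (subst ennreal_mult[symmetric]) (auto intro!: ennreal_leI mult_mono simp: mult.commute[of _ "exp _"])
  qed
  also have "\<dots> = ennreal (exp (K\<^sup>2 * dt i)) * (\<integral>\<^sup>+\<omega>. ennreal ((wexp x0 y i \<omega>)\<^sup>2) \<partial>M)"
    by (rule nn_integral_cmult) measurable
  also have "\<dots> \<le> ennreal (exp (K\<^sup>2 * dt i)) * ennreal (x0\<^sup>2 * exp (K\<^sup>2 * (\<Sum>j<i. dt j)))"
    by (intro mult_left_mono Suc.IH i) auto
  also have "\<dots> = ennreal (x0\<^sup>2 * exp (K\<^sup>2 * (\<Sum>j<Suc i. dt j)))"
    by (subst ennreal_mult[symmetric]) (auto simp: algebra_simps exp_add)
  finally show ?case .
qed

text \<open>The martingale increment and the linearisation error are orthogonal, so second moments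
  satisfy a linear recursion without cross terms, and Gronwall's argument solves it. The bounds
  \<open>K\<close> and \<open>\<delta>\<close> are required at every \<open>\<omega>\<close>; the
  truncation in \<open>wexp_comparison\<close> arranges that.\<close>

lemma err_moment:
  assumes y: "\<And>i. i < m \<Longrightarrow> y i \<in> borel_measurable (G i)"
    and h: "\<And>i. i < m \<Longrightarrow> h i \<in> borel_measurable (G i)"
    and K: "\<And>i \<omega>. i < m \<Longrightarrow> \<bar>y i \<omega>\<bar> \<le> K"
    and \<delta>: "\<And>\<omega>. (\<Sum>i<m. (h i \<omega>)\<^sup>2 * dt i) \<le> \<delta>"
    and \<eta>: "\<And>i. i < m \<Longrightarrow> dt i \<le> \<eta>" and \<tau>: "(\<Sum>i<m. dt i) \<le> \<tau>"
  shows "(\<integral>\<^sup>+\<omega>. ennreal ((err x0 y h m \<omega>)\<^sup>2) \<partial>M) \<le> ennreal (err_bound x0 K \<tau> \<eta> \<delta>)"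
proof -
  define C where "C = K^4 * exp (K\<^sup>2 * \<tau>) * (x0\<^sup>2 * exp (K\<^sup>2 * \<tau>)) * \<eta>"
  define a where "a i = (\<integral>\<^sup>+\<omega>. ennreal (2 * (h i \<omega>)\<^sup>2 * dt i) \<partial>M) + ennreal (C * dt i)" for i
  define e where "e i = (\<integral>\<^sup>+\<omega>. ennreal ((err x0 y h i \<omega>)\<^sup>2) \<partial>M)" for i
  have dt0: "0 \<le> dt i" if "i < m" for i using dt_pos[OF that] by simp
  have sum_le: "(\<Sum>j<i. dt j) \<le> \<tau>" if "i \<le> m" for i
  proof -
    have "(\<Sum>j<i. dt j) \<le> (\<Sum>j<m. dt j)" using that dt0 by (intro sum_mono2) auto
    then show ?thesis using \<tau> by simp
  qed
  have step: "e (Suc i) \<le> ennreal (1 + 2 * K\<^sup>2 * dt i) * e i + a i" if i: "i < m" for i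
  proof -
    have dti: "0 \<le> dt i" "dt i \<le> \<eta>" "dt i \<le> \<tau>"
    proof -
      have "0 \<le> (\<Sum>j<i. dt j)" using dt0 i by (intro sum_nonneg) auto
      then show "0 \<le> dt i" "dt i \<le> \<eta>" "dt i \<le> \<tau>"
        using dt0[OF i] \<eta>[OF i] sum_le[of "Suc i"] i by simp_all
    qed
    have [measurable]: "wexp x0 y i \<in> borel_measurable (G i)" "err x0 y h i \<in> borel_measurable (G i)"
      "y i \<in> borel_measurable (G i)" "h i \<in> borel_measurable (G i)"
      using i by (auto intro!: wexp_measurable err_measurable y h)
    have [measurable]: "wexp x0 y i \<in> borel_measurable M" "err x0 y h i \<in> borel_measurable M"
      "y i \<in> borel_measurable M" "h i \<in> borel_measurable M"
      using i by (auto intro!: measurable_ambient[of i])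
    have "e (Suc i) = (\<integral>\<^sup>+\<omega>. ennreal ((err x0 y h i \<omega>)\<^sup>2 + (y i \<omega> * err x0 y h i \<omega> + h i \<omega>)\<^sup>2 * dt i
        + (wexp x0 y i \<omega>)\<^sup>2 * (exp ((y i \<omega>)\<^sup>2 * dt i) - 1 - (y i \<omega>)\<^sup>2 * dt i)) \<partial>M)"
      unfolding e_def err.simps(2) by (rule second_moment_step[OF incr[OF i]]) measurable
    also have "\<dots> \<le> (\<integral>\<^sup>+\<omega>. ennreal (1 + 2 * K\<^sup>2 * dt i) * ennreal ((err x0 y h i \<omega>)\<^sup>2) + ennreal (2 * (h i \<omega>)\<^sup>2 * dt i)
       + ennreal (K^4 * exp (K\<^sup>2 * \<tau>) * \<eta> * dt i) * ennreal ((wexp x0 y i \<omega>)\<^sup>2) \<partial>M)"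
    proof (rule nn_integral_mono)
      fix \<omega>
      define E Y H P where "E = err x0 y h i \<omega>" and "Y = y i \<omega>" and "H = h i \<omega>" and "P = wexp x0 y i \<omega>"
      have Y2: "Y\<^sup>2 \<le> K\<^sup>2" using power_mono[OF K[OF i, of \<omega>], of 2] by (simp add: Y_def)
      have "(Y * E + H)\<^sup>2 \<le> 2 * (Y * E)\<^sup>2 + 2 * H\<^sup>2"
        using zero_le_power2[of "Y * E - H"] by (simp add: power2_eq_square algebra_simps)
      also have "\<dots> \<le> 2 * K\<^sup>2 * E\<^sup>2 + 2 * H\<^sup>2"
        using mult_right_mono[OF Y2, of "E\<^sup>2"] by (simp add: power_mult_distrib)
      finally have 1: "(Y * E + H)\<^sup>2 * dt i \<le> (2 * K\<^sup>2 * E\<^sup>2 + 2 * H\<^sup>2) * dt i"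
        using dti by (intro mult_right_mono)
      have Yd: "0 \<le> Y\<^sup>2 * dt i" "Y\<^sup>2 * dt i \<le> K\<^sup>2 * dt i" "K\<^sup>2 * dt i \<le> K\<^sup>2 * \<tau>"
        using dti Y2 by (auto intro!: mult_right_mono mult_left_mono)
      have "exp (Y\<^sup>2 * dt i) - 1 - Y\<^sup>2 * dt i \<le> (Y\<^sup>2 * dt i)\<^sup>2 * exp (Y\<^sup>2 * dt i)"
        by (rule exp_minus_1_minus_id_le) (use Yd in auto)
      also have "\<dots> \<le> (K\<^sup>2 * dt i)\<^sup>2 * exp (K\<^sup>2 * \<tau>)"
        by (rule mult_mono[OF power_mono[OF Yd(2,1)]]) (use Yd in simp_all)
      also have "\<dots> = (K^4 * exp (K\<^sup>2 * \<tau>) * dt i) * dt i" by (simp add: power2_eq_square power4_eq_xxxx)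
      \<comment> \<open>Of the two factors \<open>dt i\<close>, one is traded for the mesh
        \<open>\<eta>\<close>; the other is kept and sums to at most \<open>\<tau>\<close>.\<close>
      also have "\<dots> \<le> (K^4 * exp (K\<^sup>2 * \<tau>) * dt i) * \<eta>" using dti by (intro mult_left_mono) auto
      finally have 2: "P\<^sup>2 * (exp (Y\<^sup>2 * dt i) - 1 - Y\<^sup>2 * dt i) \<le> P\<^sup>2 * (K^4 * exp (K\<^sup>2 * \<tau>) * dt i * \<eta>)"
        by (intro mult_left_mono) auto
      have "E\<^sup>2 + (Y * E + H)\<^sup>2 * dt i + P\<^sup>2 * (exp (Y\<^sup>2 * dt i) - 1 - Y\<^sup>2 * dt i)
        \<le> (1 + 2 * K\<^sup>2 * dt i) * E\<^sup>2 + 2 * H\<^sup>2 * dt i + K^4 * exp (K\<^sup>2 * \<tau>) * \<eta> * dt i * P\<^sup>2"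
        using 1 2 by (simp add: algebra_simps)
      moreover have "0 \<le> \<eta>" using dti by simp
      ultimately show "ennreal (E\<^sup>2 + (Y * E + H)\<^sup>2 * dt i + P\<^sup>2 * (exp (Y\<^sup>2 * dt i) - 1 - Y\<^sup>2 * dt i))
        \<le> ennreal (1 + 2 * K\<^sup>2 * dt i) * ennreal (E\<^sup>2) + ennreal (2 * H\<^sup>2 * dt i) + ennreal (K^4 * exp (K\<^sup>2 * \<tau>) * \<eta> * dt i) * ennreal (P\<^sup>2)"
        using dti by (simp add: ennreal_mult[symmetric] ennreal_plus[symmetric] del: ennreal_plus)
    qed
    also have "\<dots> = ennreal (1 + 2 * K\<^sup>2 * dt i) * e i + (\<integral>\<^sup>+\<omega>. ennreal (2 * (h i \<omega>)\<^sup>2 * dt i) \<partial>M)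
       + ennreal (K^4 * exp (K\<^sup>2 * \<tau>) * \<eta> * dt i) * (\<integral>\<^sup>+\<omega>. ennreal ((wexp x0 y i \<omega>)\<^sup>2) \<partial>M)"
      by (simp add: nn_integral_add nn_integral_cmult e_def)
    also have "\<dots> \<le> ennreal (1 + 2 * K\<^sup>2 * dt i) * e i + (\<integral>\<^sup>+\<omega>. ennreal (2 * (h i \<omega>)\<^sup>2 * dt i) \<partial>M)
       + ennreal (K^4 * exp (K\<^sup>2 * \<tau>) * \<eta> * dt i) * ennreal (x0\<^sup>2 * exp (K\<^sup>2 * \<tau>))"
    proof (intro add_left_mono mult_left_mono)
      have "ennreal (x0\<^sup>2 * exp (K\<^sup>2 * (\<Sum>j<i. dt j))) \<le> ennreal (x0\<^sup>2 * exp (K\<^sup>2 * \<tau>))"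
        using sum_le[of i] i by (intro ennreal_leI mult_left_mono) (auto intro: mult_left_mono)
      moreover have "(\<integral>\<^sup>+\<omega>. ennreal ((wexp x0 y i \<omega>)\<^sup>2) \<partial>M) \<le> ennreal (x0\<^sup>2 * exp (K\<^sup>2 * (\<Sum>j<i. dt j)))"
        using i by (intro wexp_moment y K) auto
      ultimately show "(\<integral>\<^sup>+\<omega>. ennreal ((wexp x0 y i \<omega>)\<^sup>2) \<partial>M) \<le> ennreal (x0\<^sup>2 * exp (K\<^sup>2 * \<tau>))"
        by (rule order_trans[rotated])
    qed simp
    also have "\<dots> = ennreal (1 + 2 * K\<^sup>2 * dt i) * e i + a i"
      using dti by (simp add: a_def C_def ennreal_mult[symmetric] mult_ac add.assoc)
    finally show ?thesis .
  qed
  \<comment> \<open>Gronwall with \<open>1 + x \<le> exp x\<close>. The weight of each new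
    \<open>a i\<close> is enlarged from 1 to the full exponential, so that a single factor stands in
    front of the sum.\<close>
  have main: "e i \<le> ennreal (exp (2 * K\<^sup>2 * (\<Sum>j<i. dt j))) * (\<Sum>j<i. a j)" if "i \<le> m" for i
    using that
  proof (induction i)
    case 0 then show ?case by (simp add: e_def)
  next
    case (Suc i)
    then have i: "i < m" by simp
    have "1 + 2 * K\<^sup>2 * dt i \<le> exp (2 * K\<^sup>2 * dt i)" by (rule exp_ge_add_one_self)
    then have 1: "ennreal (1 + 2 * K\<^sup>2 * dt i) \<le> ennreal (exp (2 * K\<^sup>2 * dt i))" by (rule ennreal_leI)
    have 2: "1 \<le> ennreal (exp (2 * K\<^sup>2 * (\<Sum>j<Suc i. dt j)))"
      unfolding ennreal_1[symmetric] using dt0 i by (intro ennreal_leI) (auto intro!: mult_nonneg_nonneg sum_nonneg add_nonneg_nonneg)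
    have "e (Suc i) \<le> ennreal (1 + 2 * K\<^sup>2 * dt i) * e i + a i" by (rule step[OF i])
    also have "\<dots> \<le> ennreal (exp (2 * K\<^sup>2 * dt i)) * (ennreal (exp (2 * K\<^sup>2 * (\<Sum>j<i. dt j))) * (\<Sum>j<i. a j))
        + ennreal (exp (2 * K\<^sup>2 * (\<Sum>j<Suc i. dt j))) * a i"
      using Suc i 1 mult_right_mono[OF 2, of "a i"] by (intro add_mono mult_mono) auto
    also have "\<dots> = ennreal (exp (2 * K\<^sup>2 * (\<Sum>j<Suc i. dt j))) * (\<Sum>j<Suc i. a j)"
    proof -
      have "exp (2 * K\<^sup>2 * dt i) * exp (2 * K\<^sup>2 * (\<Sum>j<i. dt j)) = exp (2 * K\<^sup>2 * (\<Sum>j<Suc i. dt j))"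
        by (simp add: exp_add[symmetric] distrib_left add.commute)
      then have "ennreal (exp (2 * K\<^sup>2 * dt i)) * ennreal (exp (2 * K\<^sup>2 * (\<Sum>j<i. dt j))) = ennreal (exp (2 * K\<^sup>2 * (\<Sum>j<Suc i. dt j)))"
        by (subst ennreal_mult[symmetric]) simp_all
      then show ?thesis by (simp only: mult.assoc[symmetric] sum.lessThan_Suc distrib_left)
    qed
    finally show ?case .
  qed
  have hM: "(\<lambda>\<omega>. ennreal (2 * (h j \<omega>)\<^sup>2 * dt j)) \<in> borel_measurable M" if "j < m" for j
  proof -
    have [measurable]: "h j \<in> borel_measurable M" by (rule measurable_ambient[OF _ h]) (use that in auto)
    show ?thesis by measurable
  qed
  have "(\<Sum>j<m. a j) = (\<integral>\<^sup>+\<omega>. (\<Sum>j<m. ennreal (2 * (h j \<omega>)\<^sup>2 * dt j)) \<partial>M) + (\<Sum>j<m. ennreal (C * dt j))"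
    unfolding a_def sum.distrib
    by (subst nn_integral_sum) (simp_all add: hM)
  also have "\<dots> \<le> ennreal (2 * \<delta>) + ennreal (C * \<tau>)"
  proof (rule add_mono)
    have "(\<integral>\<^sup>+\<omega>. (\<Sum>j<m. ennreal (2 * (h j \<omega>)\<^sup>2 * dt j)) \<partial>M) \<le> (\<integral>\<^sup>+\<omega>. ennreal (2 * \<delta>) \<partial>M)"
    proof (rule nn_integral_mono)
      fix \<omega>
      have "(\<Sum>j<m. 2 * (h j \<omega>)\<^sup>2 * dt j) = 2 * (\<Sum>j<m. (h j \<omega>)\<^sup>2 * dt j)" by (simp add: sum_distrib_left mult.assoc)
      then show "(\<Sum>j<m. ennreal (2 * (h j \<omega>)\<^sup>2 * dt j)) \<le> ennreal (2 * \<delta>)"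
        using \<delta>[of \<omega>] dt0 by (subst sum_ennreal) (auto intro!: ennreal_leI)
    qed
    then show "(\<integral>\<^sup>+\<omega>. (\<Sum>j<m. ennreal (2 * (h j \<omega>)\<^sup>2 * dt j)) \<partial>M) \<le> ennreal (2 * \<delta>)"
      by (simp add: emeasure_space_1)
    show "(\<Sum>j<m. ennreal (C * dt j)) \<le> ennreal (C * \<tau>)"
    proof (cases "m = 0")
      case False
      then have "0 \<le> \<eta>" using \<eta>[of 0] dt0[of 0] by simp
      then have "0 \<le> C" by (simp add: C_def)
      then show ?thesis using \<tau> dt0
        by (subst sum_ennreal) (auto simp: sum_distrib_left[symmetric] intro!: ennreal_leI mult_left_mono)
    qed simp
  qed
  finally have sa: "(\<Sum>j<m. a j) \<le> ennreal (2 * \<delta>) + ennreal (C * \<tau>)" .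
  show ?thesis
  \<comment> \<open>If \<open>m > 0\<close>, the hypotheses force \<open>\<eta>\<close>,
    \<open>\<tau>\<close> and \<open>\<delta>\<close> to be nonnegative. If \<open>m = 0\<close> the
    left side is 0, and nothing about these signs has to be known.\<close>
  proof (cases "m = 0")
    case False
    then have "0 \<le> \<eta>" "0 \<le> \<tau>" using \<eta>[of 0] dt0[of 0] sum_le[of 0] by auto
    then have C: "0 \<le> C * \<tau>" by (simp add: C_def)
    have d: "0 \<le> \<delta>"
      using dt0 by (intro order_trans[OF _ \<delta>[of undefined]] sum_nonneg) auto
    have "e m \<le> ennreal (exp (2 * K\<^sup>2 * (\<Sum>j<m. dt j))) * (\<Sum>j<m. a j)" by (rule main) simp
    also have "\<dots> \<le> ennreal (exp (2 * K\<^sup>2 * \<tau>)) * ennreal (2 * \<delta> + C * \<tau>)"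
      using sa C d \<tau> by (intro mult_mono ennreal_leI) (auto intro: mult_left_mono)
    also have "\<dots> = ennreal (err_bound x0 K \<tau> \<eta> \<delta>)"
      using C d by (subst ennreal_mult[symmetric]) (auto simp: err_bound_def C_def)
    finally show ?thesis by (simp add: e_def)
  qed simp
qed


text \<open>Writing \<open>\<xi> = y * S + h\<close> makes \<open>S\<close> a perturbed linear
  equation with defect \<open>h\<close>. Both \<open>y\<close> and \<open>h\<close> are switched off
  once \<open>K\<close> or \<open>\<delta>\<close> is exceeded; the second moment bound and Markov's
  inequality apply to the truncated processes, and off the first two events of the bound nothing has
  been truncated.\<close>

lemma wexp_comparison:
  assumes y: "\<And>i. i < m \<Longrightarrow> y i \<in> borel_measurable (G i)"
    and \<xi>: "\<And>i. i < m \<Longrightarrow> \<xi> i \<in> borel_measurable (G i)"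
    and S0: "\<And>\<omega>. S 0 \<omega> = x0" and S: "\<And>i \<omega>. S (Suc i) \<omega> = S i \<omega> + \<xi> i \<omega> * N i \<omega>"
    and \<eta>: "\<And>i. i < m \<Longrightarrow> dt i \<le> \<eta>" and \<tau>: "(\<Sum>i<m. dt i) \<le> \<tau>" "0 \<le> \<eta>" "0 \<le> \<tau>"
    and pos: "0 < \<epsilon>" "0 \<le> K" "0 \<le> \<delta>"
  shows "prob {\<omega>\<in>space M. \<epsilon> < \<bar>S m \<omega> - wexp x0 y m \<omega>\<bar>} \<le>
     prob {\<omega>\<in>space M. \<exists>i<m. K < \<bar>y i \<omega>\<bar>}
     + prob {\<omega>\<in>space M. \<delta> < (\<Sum>i<m. (\<xi> i \<omega> - y i \<omega> * S i \<omega>)\<^sup>2 * dt i)}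
     + err_bound x0 K \<tau> \<eta> \<delta> / \<epsilon>\<^sup>2"
proof -
  define h where "h i \<omega> = \<xi> i \<omega> - y i \<omega> * S i \<omega>" for i \<omega>
  have Sm: "S i \<in> borel_measurable (G i)" if "i \<le> m" for i
    using that
  proof (induction i)
    case 0 then show ?case using S0 by (simp cong: measurable_cong)
  next
    case (Suc i)
    then have [measurable]: "\<xi> i \<in> borel_measurable (G (Suc i))" "S i \<in> borel_measurable (G (Suc i))"
      "N i \<in> borel_measurable (G (Suc i))"
      using Suc_le_lessD[OF Suc.prems] by (simp_all add: measurable_Suc \<xi> incr_adapted)
    show ?case unfolding S[abs_def] by measurable
  qed
  have h: "h i \<in> borel_measurable (G i)" if "i < m" for i
  proof -
    have [measurable]: "\<xi> i \<in> borel_measurable (G i)" "S i \<in> borel_measurable (G i)" "y i \<in> borel_measurable (G i)"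
      using that by (auto intro: \<xi> Sm y)
    show ?thesis unfolding h_def[abs_def] by measurable
  qed
  \<comment> \<open>a discrete stopping time: \<open>good i\<close> is known at time \<open>i\<close>, and it is decreasing in \<open>i\<close>\<close>
  define good where "good i \<omega> \<longleftrightarrow> (\<forall>j\<in>{..i}. \<bar>y j \<omega>\<bar> \<le> K) \<and> (\<Sum>j\<le>i. (h j \<omega>)\<^sup>2 * dt j) \<le> \<delta>" for i \<omega>
  have good_meas: "Measurable.pred (G i) (good i)" if "i < m" for i
  proof -
    have [measurable]: "y j \<in> borel_measurable (G i)" "h j \<in> borel_measurable (G i)" if "j \<in> {..i}" for j
      using that \<open>i < m\<close> by (auto intro: measurable_later[OF _ _ y] measurable_later[OF _ _ h])
    show ?thesis unfolding good_def[abs_def] by measurable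
  qed
  define y' where "y' i \<omega> = (if good i \<omega> then y i \<omega> else 0)" for i \<omega>
  define h' where "h' i \<omega> = (if good i \<omega> then h i \<omega> else 0)" for i \<omega>
  have y': "y' i \<in> borel_measurable (G i)" and h': "h' i \<in> borel_measurable (G i)" if "i < m" for i
    using good_meas[OF that] y[OF that] h[OF that] by (auto simp: y'_def[abs_def] h'_def[abs_def])
  have K': "\<bar>y' i \<omega>\<bar> \<le> K" for i \<omega>
    using pos by (auto simp: y'_def good_def)
  \<comment> \<open>The test \<open>good k\<close> includes the term with index \<open>k\<close>
    itself, which is known at time \<open>k\<close>; the sum is therefore stopped before it can
    exceed \<open>\<delta>\<close>, and all later terms are 0.\<close>
  have \<delta>': "(\<Sum>i<k. (h' i \<omega>)\<^sup>2 * dt i) \<le> \<delta>" if "k \<le> m" for k \<omega>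
    using that
  proof (induction k)
    case 0 then show ?case using pos by simp
  next
    case (Suc k)
    show ?case
    proof (cases "good k \<omega>")
      case True
      have "(\<Sum>i<Suc k. (h' i \<omega>)\<^sup>2 * dt i) \<le> (\<Sum>i<Suc k. (h i \<omega>)\<^sup>2 * dt i)"
        using Suc.prems by (intro sum_mono) (auto simp: h'_def dt_pos less_imp_le)
      then show ?thesis using True by (simp add: good_def lessThan_Suc_atMost)
    next
      case False
      then show ?thesis using Suc by (simp add: h'_def)
    qed
  qed
  define bad where "bad = {\<omega>\<in>space M. \<exists>i<m. K < \<bar>y i \<omega>\<bar>}
      \<union> {\<omega>\<in>space M. \<delta> < (\<Sum>i<m. (h i \<omega>)\<^sup>2 * dt i)}"
  have yM[measurable]: "y i \<in> borel_measurable M" and hM[measurable]: "h i \<in> borel_measurable M" if "i < m" for i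
    using that by (auto intro: measurable_ambient[OF _ y] measurable_ambient[OF _ h])
  have bad1: "{\<omega>\<in>space M. \<exists>i<m. K < \<bar>y i \<omega>\<bar>} \<in> events"
  proof -
    have "{\<omega>\<in>space M. \<exists>i<m. K < \<bar>y i \<omega>\<bar>} = (\<Union>i\<in>{..<m}. {\<omega>\<in>space M. K < \<bar>y i \<omega>\<bar>})" by auto
    also have "\<dots> \<in> events" by (intro sets.finite_UN) auto
    finally show ?thesis .
  qed
  have bad2: "{\<omega>\<in>space M. \<delta> < (\<Sum>i<m. (h i \<omega>)\<^sup>2 * dt i)} \<in> events"
  proof -
    have [measurable]: "(\<lambda>\<omega>. \<Sum>i<m. (h i \<omega>)\<^sup>2 * dt i) \<in> borel_measurable M"
      by (intro borel_measurable_sum) auto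
    show ?thesis by measurable
  qed
  have errM[measurable]: "err x0 y' h' m \<in> borel_measurable M"
    by (intro measurable_ambient[OF order_refl] err_measurable y' h') auto
  have eq: "S m \<omega> - wexp x0 y m \<omega> = err x0 y' h' m \<omega>" if "\<omega> \<in> space M" "\<omega> \<notin> bad" for \<omega>
  proof -
    have "\<forall>i<m. \<not> K < \<bar>y i \<omega>\<bar>" using that unfolding bad_def by blast
    then have b: "\<bar>y i \<omega>\<bar> \<le> K" if "i < m" for i using that by (simp add: not_less)
    have "(\<Sum>j\<le>i. (h j \<omega>)\<^sup>2 * dt j) \<le> (\<Sum>j<m. (h j \<omega>)\<^sup>2 * dt j)" if "i < m" for i
      using that by (intro sum_mono2) (auto simp: dt_pos less_imp_le)
    moreover have "(\<Sum>j<m. (h j \<omega>)\<^sup>2 * dt j) \<le> \<delta>"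
      using that by (force simp: bad_def not_less)
    ultimately have g: "good i \<omega>" if "i < m" for i
      using b that by (force simp: good_def)
    have w: "wexp x0 y' i \<omega> = wexp x0 y i \<omega>" if "i \<le> m" for i
      using that by (simp add: wexp_def y'_def g)
    have "S i \<omega> - wexp x0 y i \<omega> = err x0 y' h' i \<omega>" if "i \<le> m" for i
      using that
    proof (induction i)
      case 0 then show ?case by (simp add: S0 wexp_def)
    next
      case (Suc i)
      then have i: "i < m" and IH: "err x0 y' h' i \<omega> = S i \<omega> - wexp x0 y i \<omega>" by auto
      have yh: "y' i \<omega> = y i \<omega>" "h' i \<omega> = \<xi> i \<omega> - y i \<omega> * S i \<omega>" "wexp x0 y' i \<omega> = wexp x0 y i \<omega>"
        using g[OF i] w[of i] i by (simp_all add: y'_def h'_def h_def)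
      show ?case unfolding err.simps yh IH S wexp_Suc by algebra
    qed
    then show ?thesis by simp
  qed
  have "emeasure M {\<omega>\<in>space M. \<epsilon> < \<bar>err x0 y' h' m \<omega>\<bar>} \<le>
      emeasure M {\<omega>\<in>space M. 1 \<le> ennreal (1 / \<epsilon>\<^sup>2) * ennreal ((err x0 y' h' m \<omega>)\<^sup>2)}"
  proof (rule emeasure_mono)
    show "{\<omega>\<in>space M. \<epsilon> < \<bar>err x0 y' h' m \<omega>\<bar>} \<subseteq> {\<omega>\<in>space M. 1 \<le> ennreal (1 / \<epsilon>\<^sup>2) * ennreal ((err x0 y' h' m \<omega>)\<^sup>2)}"
    proof safe
      fix \<omega> assume "\<epsilon> < \<bar>err x0 y' h' m \<omega>\<bar>"
      then have "\<epsilon>\<^sup>2 \<le> (err x0 y' h' m \<omega>)\<^sup>2" using pos power_mono[of \<epsilon> "\<bar>err x0 y' h' m \<omega>\<bar>" 2] by simp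
      then have "1 \<le> 1 / \<epsilon>\<^sup>2 * (err x0 y' h' m \<omega>)\<^sup>2" using pos by (simp add: field_simps)
      then show "1 \<le> ennreal (1 / \<epsilon>\<^sup>2) * ennreal ((err x0 y' h' m \<omega>)\<^sup>2)"
        by (simp add: ennreal_mult[symmetric] del: ennreal_1 add: ennreal_1[symmetric])
    qed
  qed measurable
  also have "\<dots> \<le> ennreal (1 / \<epsilon>\<^sup>2) * (\<integral>\<^sup>+\<omega>. ennreal ((err x0 y' h' m \<omega>)\<^sup>2) * indicator (space M) \<omega> \<partial>M)"
    by (rule nn_integral_Markov_inequality) measurable
  also have "\<dots> = ennreal (1 / \<epsilon>\<^sup>2) * (\<integral>\<^sup>+\<omega>. ennreal ((err x0 y' h' m \<omega>)\<^sup>2) \<partial>M)"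
    by (intro arg_cong2[where f="(*)"] refl nn_integral_cong) simp
  also have "\<dots> \<le> ennreal (1 / \<epsilon>\<^sup>2) * ennreal (err_bound x0 K \<tau> \<eta> \<delta>)"
    by (intro mult_left_mono err_moment y' h' K' \<delta>' \<eta> \<tau>) auto
  also have "\<dots> = ennreal (err_bound x0 K \<tau> \<eta> \<delta> / \<epsilon>\<^sup>2)"
    using pos \<tau> by (subst ennreal_mult[symmetric]) (auto simp: err_bound_def)
  finally have "prob {\<omega>\<in>space M. \<epsilon> < \<bar>err x0 y' h' m \<omega>\<bar>} \<le> err_bound x0 K \<tau> \<eta> \<delta> / \<epsilon>\<^sup>2"
    using \<tau> pos by (simp add: emeasure_eq_measure err_bound_def)
  moreover have "prob {\<omega>\<in>space M. \<epsilon> < \<bar>S m \<omega> - wexp x0 y m \<omega>\<bar>} \<le>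
      prob (({\<omega>\<in>space M. \<exists>i<m. K < \<bar>y i \<omega>\<bar>} \<union> {\<omega>\<in>space M. \<delta> < (\<Sum>i<m. (h i \<omega>)\<^sup>2 * dt i)})
        \<union> {\<omega>\<in>space M. \<epsilon> < \<bar>err x0 y' h' m \<omega>\<bar>})"
  proof (rule finite_measure_mono)
    have "{\<omega>\<in>space M. \<epsilon> < \<bar>S m \<omega> - wexp x0 y m \<omega>\<bar>} \<subseteq> bad \<union> {\<omega>\<in>space M. \<epsilon> < \<bar>err x0 y' h' m \<omega>\<bar>}"
      using eq by auto
    then show "{\<omega>\<in>space M. \<epsilon> < \<bar>S m \<omega> - wexp x0 y m \<omega>\<bar>} \<subseteq>
      ({\<omega>\<in>space M. \<exists>i<m. K < \<bar>y i \<omega>\<bar>} \<union> {\<omega>\<in>space M. \<delta> < (\<Sum>i<m. (h i \<omega>)\<^sup>2 * dt i)})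
        \<union> {\<omega>\<in>space M. \<epsilon> < \<bar>err x0 y' h' m \<omega>\<bar>}"
      by (simp only: bad_def)
    show "({\<omega>\<in>space M. \<exists>i<m. K < \<bar>y i \<omega>\<bar>} \<union> {\<omega>\<in>space M. \<delta> < (\<Sum>i<m. (h i \<omega>)\<^sup>2 * dt i)})
        \<union> {\<omega>\<in>space M. \<epsilon> < \<bar>err x0 y' h' m \<omega>\<bar>} \<in> events"
      by (intro sets.Un bad1 bad2) measurable
  qed
  moreover have "\<dots> \<le> prob ({\<omega>\<in>space M. \<exists>i<m. K < \<bar>y i \<omega>\<bar>} \<union> {\<omega>\<in>space M. \<delta> < (\<Sum>i<m. (h i \<omega>)\<^sup>2 * dt i)})
      + prob {\<omega>\<in>space M. \<epsilon> < \<bar>err x0 y' h' m \<omega>\<bar>}"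
    using bad1 bad2 by (intro measure_Un_le) auto
  moreover have "prob ({\<omega>\<in>space M. \<exists>i<m. K < \<bar>y i \<omega>\<bar>} \<union> {\<omega>\<in>space M. \<delta> < (\<Sum>i<m. (h i \<omega>)\<^sup>2 * dt i)})
     \<le> prob {\<omega>\<in>space M. \<exists>i<m. K < \<bar>y i \<omega>\<bar>} + prob {\<omega>\<in>space M. \<delta> < (\<Sum>i<m. (h i \<omega>)\<^sup>2 * dt i)}"
    using bad1 bad2 by (intro measure_Un_le) auto
  ultimately show ?thesis by (simp add: h_def)
qed

end

section \<open>Characteristic functions of correlated Brownian motions\<close>

text \<open>Expectations of independent variables factor. The weight \<open>\<xi>\<close> is complex
  because it will be the exponential of the past increments; independence passes to
  \<open>\<xi>\<close> and \<open>f N\<close> since their preimages lie in \<open>G\<close> and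
  among the preimages of \<open>N\<close>.\<close>

lemma (in prob_space) indep_normal_mult:
  fixes \<xi> :: "'a \<Rightarrow> complex" and f :: "real \<Rightarrow> real"
  assumes N: "indep_normal M G h N" and \<xi>: "\<xi> \<in> borel_measurable G" "integrable M \<xi>"
    and f[measurable]: "f \<in> borel_measurable borel" and fi: "integrable lborel (\<lambda>x. normal_density 0 (sqrt h) x * f x)"
  shows "integrable M (\<lambda>\<omega>. \<xi> \<omega> * of_real (f (N \<omega>)))"
    and "(\<integral>\<omega>. \<xi> \<omega> * of_real (f (N \<omega>)) \<partial>M) = (\<integral>\<omega>. \<xi> \<omega> \<partial>M) * of_real (\<integral>x. normal_density 0 (sqrt h) x * f x \<partial>lborel)"
proof -
  have sub: "subalgebra M G" and NM[measurable]: "N \<in> borel_measurable M"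
    and ind: "indep_set (sets G) {N -` A \<inter> space M | A. A \<in> sets borel}"
    and D: "distributed M lborel N (normal_density 0 (sqrt h))"
    using N by (simp_all add: indep_normal_def)
  have [measurable]: "\<xi> \<in> borel_measurable M" by (rule measurable_from_subalg[OF sub \<xi>(1)])
  have stable: "Int_stable {X -` A \<inter> space M |A. A \<in> sets borel}" for X :: "'a \<Rightarrow> complex"
  proof (rule Int_stableI)
    fix a b assume "a \<in> {X -` A \<inter> space M |A. A \<in> sets borel}" "b \<in> {X -` A \<inter> space M |A. A \<in> sets borel}"
    then obtain A B where "a = X -` A \<inter> space M" "b = X -` B \<inter> space M" "A \<in> sets borel" "B \<in> sets borel" by blast
    then show "a \<inter> b \<in> {X -` A \<inter> space M |A. A \<in> sets borel}"
      by (intro CollectI exI[of _ "A \<inter> B"]) auto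
  qed
  have "indep_set {\<xi> -` A \<inter> space M |A. A \<in> sets borel} {(\<lambda>\<omega>. complex_of_real (f (N \<omega>))) -` A \<inter> space M |A. A \<in> sets borel}"
    unfolding indep_sets2_eq
  proof (intro conjI ballI)
    show "{\<xi> -` A \<inter> space M |A. A \<in> sets borel} \<subseteq> events"
      by (auto intro!: measurable_sets)
    show "{(\<lambda>\<omega>. complex_of_real (f (N \<omega>))) -` A \<inter> space M |A. A \<in> sets borel} \<subseteq> events"
      by (auto intro!: measurable_sets)
    fix a b assume "a \<in> {\<xi> -` A \<inter> space M |A. A \<in> sets borel}" "b \<in> {(\<lambda>\<omega>. complex_of_real (f (N \<omega>))) -` A \<inter> space M |A. A \<in> sets borel}"
    then obtain A B where a: "a = \<xi> -` A \<inter> space M" and b: "b = (\<lambda>\<omega>. complex_of_real (f (N \<omega>))) -` B \<inter> space M"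
      and [measurable]: "A \<in> sets borel" "B \<in> sets borel" by blast
    have "a \<in> sets G" using measurable_sets[OF \<xi>(1), of A] sub unfolding a by (simp add: subalgebra_def)
    moreover have "b \<in> {N -` A \<inter> space M | A. A \<in> sets borel}"
      unfolding b by (intro CollectI exI[of _ "(\<lambda>x. complex_of_real (f x)) -` B"])
        (auto intro: measurable_sets_borel[of _ _, OF _ \<open>B \<in> sets borel\<close>])
    ultimately show "prob (a \<inter> b) = prob a * prob b"
      using ind unfolding indep_sets2_eq by blast
  qed
  then have iv: "indep_var borel \<xi> borel (\<lambda>\<omega>. complex_of_real (f (N \<omega>)))"
    unfolding indep_var_eq by (intro conjI indep_set_sigma_sets stable) measurable
  have i: "integrable M (\<lambda>\<omega>. f (N \<omega>))"
    using distributed_integrable[OF D, of f] fi by (simp add: normal_density_nonneg)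
  then have i': "integrable M (\<lambda>\<omega>. complex_of_real (f (N \<omega>)))" by simp
  show "integrable M (\<lambda>\<omega>. \<xi> \<omega> * of_real (f (N \<omega>)))"
    by (rule indep_var_integrable[OF iv \<xi>(2) i'])
  show "(\<integral>\<omega>. \<xi> \<omega> * of_real (f (N \<omega>)) \<partial>M) = (\<integral>\<omega>. \<xi> \<omega> \<partial>M) * of_real (\<integral>x. normal_density 0 (sqrt h) x * f x \<partial>lborel)"
    using indep_var_lebesgue_integral[OF iv \<xi>(2) i'] distributed_integral[OF D, of f] by (simp add: normal_density_nonneg)
qed

lemma (in prob_space) indep_normal_moments:
  fixes \<xi> :: "'a \<Rightarrow> complex"
  assumes N: "indep_normal M G h N" and \<xi>: "\<xi> \<in> borel_measurable G" "integrable M \<xi>"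
  shows "integrable M (\<lambda>\<omega>. \<xi> \<omega> * of_real (N \<omega>))" "(\<integral>\<omega>. \<xi> \<omega> * of_real (N \<omega>) \<partial>M) = 0"
    and "integrable M (\<lambda>\<omega>. \<xi> \<omega> * of_real ((N \<omega>)\<^sup>2))" "(\<integral>\<omega>. \<xi> \<omega> * of_real ((N \<omega>)\<^sup>2) \<partial>M) = (\<integral>\<omega>. \<xi> \<omega> \<partial>M) * of_real h"
proof -
  have s: "0 < sqrt h" using N by (simp add: indep_normal_def)
  have 1: "has_bochner_integral lborel (\<lambda>x. normal_density 0 (sqrt h) x * x) 0"
    using normal_moment_nz_1[OF s, of 0] by simp
  have 2: "has_bochner_integral lborel (\<lambda>x. normal_density 0 (sqrt h) x * x\<^sup>2) h"
    using normal_moment_even[OF s, of 0 1] s by (simp add: power2_eq_square[symmetric])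
  show "integrable M (\<lambda>\<omega>. \<xi> \<omega> * of_real (N \<omega>))" "(\<integral>\<omega>. \<xi> \<omega> * of_real (N \<omega>) \<partial>M) = 0"
    using indep_normal_mult[OF N \<xi>, of "\<lambda>x. x"] 1 by (simp_all add: has_bochner_integral_iff)
  show "integrable M (\<lambda>\<omega>. \<xi> \<omega> * of_real ((N \<omega>)\<^sup>2))" "(\<integral>\<omega>. \<xi> \<omega> * of_real ((N \<omega>)\<^sup>2) \<partial>M) = (\<integral>\<omega>. \<xi> \<omega> \<partial>M) * of_real h"
    using indep_normal_mult[OF N \<xi>, of "\<lambda>x. x\<^sup>2"] 2 by (simp_all add: has_bochner_integral_iff)
qed

text \<open>The exact value is \<open>2 * sqrt (2 / pi) * (h * sqrt h)\<close>. The order 3/2, being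
  larger than 1, makes the errors of \<open>n\<close> steps of length of order \<open>1 / n\<close>
  vanish in total.\<close>

lemma (in prob_space) indep_normal_abs_cube:
  assumes N: "indep_normal M G h N"
  shows "integrable M (\<lambda>\<omega>. \<bar>N \<omega>\<bar>^3)" "(\<integral>\<omega>. \<bar>N \<omega>\<bar>^3 \<partial>M) \<le> 2 * (h * sqrt h)"
proof -
  have s: "0 < sqrt h" and D: "distributed M lborel N (normal_density 0 (sqrt h))" using N by (simp_all add: indep_normal_def)
  have 3: "has_bochner_integral lborel (\<lambda>x. normal_density 0 (sqrt h) x * \<bar>x\<bar>^3) (2 * (sqrt h)^3 * sqrt (2 / pi))"
    using normal_moment_abs_odd[OF s, of 0 1] by (simp add: eval_nat_numeral)
  show "integrable M (\<lambda>\<omega>. \<bar>N \<omega>\<bar>^3)"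
    using distributed_integrable[OF D, of "\<lambda>x. \<bar>x\<bar>^3"] 3 by (simp add: normal_density_nonneg has_bochner_integral_iff)
  have "sqrt (2 / pi) \<le> 1" using pi_ge_two by (simp add: field_simps)
  moreover have "(sqrt h)^3 = h * sqrt h" using s by (simp add: eval_nat_numeral)
  ultimately have "2 * (sqrt h)^3 * sqrt (2 / pi) \<le> 2 * (h * sqrt h)"
    using s by (simp add: mult_left_le)
  then show "(\<integral>\<omega>. \<bar>N \<omega>\<bar>^3 \<partial>M) \<le> 2 * (h * sqrt h)"
    using distributed_integral[OF D, of "\<lambda>x. \<bar>x\<bar>^3"] 3 by (simp add: normal_density_nonneg has_bochner_integral_iff)
qed

lemma iexp_second_order:
  "cmod (iexp x - (1 + \<i> * complex_of_real x - complex_of_real (x\<^sup>2) / 2)) \<le> \<bar>x\<bar>^3 / 6"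
proof -
  have "(\<Sum>k\<le>2. (\<i> * complex_of_real x)^k / fact k) = 1 + \<i> * complex_of_real x - complex_of_real (x\<^sup>2) / 2"
    by (simp add: numeral_2_eq_2 power_mult_distrib)
  then show ?thesis using iexp_approx1[of x 2] by (simp add: eval_nat_numeral)
qed

lemma (in prob_space) integrable_bounded_mult:
  fixes \<xi> :: "'a \<Rightarrow> complex" and h :: "'a \<Rightarrow> real"
  assumes [measurable]: "\<xi> \<in> borel_measurable M" and b: "\<And>\<omega>. cmod (\<xi> \<omega>) \<le> C" and h: "integrable M h"
  shows "integrable M (\<lambda>\<omega>. \<xi> \<omega> * of_real (h \<omega>))"
proof (rule Bochner_Integration.integrable_bound[where f="\<lambda>\<omega>. C * h \<omega>"])
  show "integrable M (\<lambda>\<omega>. C * h \<omega>)" using h by simp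
  show "(\<lambda>\<omega>. \<xi> \<omega> * of_real (h \<omega>)) \<in> borel_measurable M" using h by measurable
  show "AE \<omega> in M. norm (\<xi> \<omega> * of_real (h \<omega>)) \<le> norm (C * h \<omega>)"
    by (intro always_eventually allI) (simp add: norm_mult abs_mult mult_right_mono[OF order_trans[OF b abs_ge_self]])
qed

locale correlated_brownian_motions = prob_space M for M :: "'a measure" +
  fixes T :: real and F :: "real \<Rightarrow> 'a measure" and W Z :: "real \<Rightarrow> 'a \<Rightarrow> real" and \<rho> :: real
  assumes T: "0 < T" and usual: "usual_filtration M T F"
    and W: "brownian_motion M T F W" and Z: "brownian_motion M T F Z"
    and \<rho>: "- 1 < \<rho>" "\<rho> < 1" and bracket: "is_bracket M T F W Z (\<lambda>t \<omega>. \<rho> * t)"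
begin

lemma sub: "0 \<le> t \<Longrightarrow> t \<le> T \<Longrightarrow> subalgebra M (F t)"
  using usual by (auto simp: usual_filtration_def)

lemma filtration_mono:
  assumes "0 \<le> s" "s \<le> t" "t \<le> T"
  shows "subalgebra (F t) (F s)"
  using usual sub[of s] sub[of t] assms by (auto simp: usual_filtration_def subalgebra_def)

lemma measurable_F_mono: "0 \<le> s \<Longrightarrow> s \<le> t \<Longrightarrow> t \<le> T \<Longrightarrow> f \<in> measurable (F s) L \<Longrightarrow> f \<in> measurable (F t) L"
  by (rule measurable_from_subalg[OF filtration_mono])

lemma W_adapted: "0 \<le> t \<Longrightarrow> t \<le> T \<Longrightarrow> W t \<in> borel_measurable (F t)"
  and Z_adapted: "0 \<le> t \<Longrightarrow> t \<le> T \<Longrightarrow> Z t \<in> borel_measurable (F t)"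
  using W Z by (auto simp: brownian_motion_def adapted_def)

lemma W_measurable: "0 \<le> t \<Longrightarrow> t \<le> T \<Longrightarrow> W t \<in> borel_measurable M"
  and Z_measurable: "0 \<le> t \<Longrightarrow> t \<le> T \<Longrightarrow> Z t \<in> borel_measurable M"
  by (auto intro: measurable_from_subalg[OF sub] W_adapted Z_adapted)

lemma bm_measurable:
  assumes "brownian_motion M T F B" "0 \<le> t" "t \<le> T"
  shows "B t \<in> borel_measurable M"
  by (rule measurable_from_subalg[OF sub[OF assms(2,3)]]) (use assms in \<open>simp add: brownian_motion_def adapted_def\<close>)

lemma incr_indep_normal:
  assumes "0 \<le> s" "s < t" "t \<le> T" and B: "brownian_motion M T F B"
  shows "indep_normal M (F s) (t - s) (\<lambda>\<omega>. B t \<omega> - B s \<omega>)"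
proof -
  have [measurable]: "B t \<in> borel_measurable M" "B s \<in> borel_measurable M"
    using assms by (auto intro: bm_measurable[OF B])
  show ?thesis
    using B assms sub[of s] by (auto simp: indep_normal_def brownian_motion_def)
qed

lemmas W_incr = incr_indep_normal[OF _ _ _ W] and Z_incr = incr_indep_normal[OF _ _ _ Z]

lemma integrable_bm:
  assumes "0 \<le> t" "t \<le> T" and B: "brownian_motion M T F B"
  shows "integrable M (B t)"
proof (cases "t = 0")
  case True
  have [measurable]: "B 0 \<in> borel_measurable M"
    using assms by (auto intro: bm_measurable[OF B])
  have "AE \<omega> in M. B 0 \<omega> = 0" using B by (simp add: brownian_motion_def)
  then have "integrable M (B 0) \<longleftrightarrow> integrable M (\<lambda>_. 0::real)" by (intro integrable_cong_AE) auto
  then show ?thesis using True by simp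
next
  case False
  have [measurable]: "B 0 \<in> borel_measurable M" "B t \<in> borel_measurable M"
    using assms by (auto intro: bm_measurable[OF B])
  have "integrable M (\<lambda>\<omega>. 1 * complex_of_real (B t \<omega> - B 0 \<omega>))"
    using False assms by (intro indep_normal_moments(1)[OF incr_indep_normal[of 0 t]] B) auto
  then have "integrable M (\<lambda>\<omega>. B t \<omega> - B 0 \<omega>)" by (simp add: complex_of_real_integrable_eq del: of_real_diff)
  moreover have "AE \<omega> in M. B 0 \<omega> = 0" using B by (simp add: brownian_motion_def)
  then have "integrable M (\<lambda>\<omega>. B t \<omega> - B 0 \<omega>) \<longleftrightarrow> integrable M (B t)" by (intro integrable_cong_AE) auto
  ultimately show ?thesis by simp
qed


text \<open>Conditional expectation is available for real variables, so the complex weight is split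
  into real and imaginary parts, each bounded by \<open>C\<close>.\<close>

lemma integral_cond_exp_complex:
  fixes \<xi> :: "'a \<Rightarrow> complex" and f g :: "'a \<Rightarrow> real"
  assumes t: "0 \<le> s" "s \<le> T"
    and \<xi>: "\<xi> \<in> borel_measurable (F s)" and b: "\<And>\<omega>. cmod (\<xi> \<omega>) \<le> C"
    and f: "integrable M f" and g: "integrable M g" and eq: "AE \<omega> in M. real_cond_exp M (F s) f \<omega> = g \<omega>"
  shows "(\<integral>\<omega>. \<xi> \<omega> * of_real (f \<omega>) \<partial>M) = (\<integral>\<omega>. \<xi> \<omega> * of_real (g \<omega>) \<partial>M)"
proof -
  interpret S: finite_measure_subalgebra M "F s"
    by unfold_locales (rule sub[OF t])
  have \<xi>M[measurable]: "\<xi> \<in> borel_measurable M" by (rule measurable_from_subalg[OF sub[OF t] \<xi>])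
  note ib = integrable_bounded_mult[OF \<xi>M b]
  have r: "(\<integral>\<omega>. k \<omega> * f \<omega> \<partial>M) = (\<integral>\<omega>. k \<omega> * g \<omega> \<partial>M)"
    if k: "k \<in> borel_measurable (F s)" "\<And>\<omega>. \<bar>k \<omega>\<bar> \<le> C" for k :: "'a \<Rightarrow> real"
  proof -
    have [measurable]: "k \<in> borel_measurable M" by (rule measurable_from_subalg[OF sub[OF t] k(1)])
    have [measurable]: "f \<in> borel_measurable M" using f by simp
    have "integrable M (\<lambda>\<omega>. k \<omega> * f \<omega>)"
    proof (rule Bochner_Integration.integrable_bound[where f="\<lambda>\<omega>. C * f \<omega>"])
      show "integrable M (\<lambda>\<omega>. C * f \<omega>)" using f by simp
      show "AE \<omega> in M. norm (k \<omega> * f \<omega>) \<le> norm (C * f \<omega>)"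
        by (intro always_eventually allI) (simp add: norm_mult abs_mult mult_right_mono[OF order_trans[OF k(2) abs_ge_self]])
    qed measurable
    then have "(\<integral>\<omega>. k \<omega> * real_cond_exp M (F s) f \<omega> \<partial>M) = (\<integral>\<omega>. k \<omega> * f \<omega> \<partial>M)"
      using k(1) f by (intro S.real_cond_exp_intg(2)) auto
    moreover have "(\<integral>\<omega>. k \<omega> * real_cond_exp M (F s) f \<omega> \<partial>M) = (\<integral>\<omega>. k \<omega> * g \<omega> \<partial>M)"
      using eq g by (intro integral_cong_AE) (auto elim!: eventually_mono)
    ultimately show ?thesis by simp
  qed
  show ?thesis
  proof (rule complex_eqI)
    have "(\<integral>\<omega>. Re (\<xi> \<omega>) * f \<omega> \<partial>M) = (\<integral>\<omega>. Re (\<xi> \<omega>) * g \<omega> \<partial>M)"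
      using \<xi> by (intro r) (auto intro: order_trans[OF abs_Re_le_cmod b])
    then show "Re (\<integral>\<omega>. \<xi> \<omega> * of_real (f \<omega>) \<partial>M) = Re (\<integral>\<omega>. \<xi> \<omega> * of_real (g \<omega>) \<partial>M)"
      using ib[OF f] ib[OF g] by (simp flip: integral_Re)
    have "(\<integral>\<omega>. Im (\<xi> \<omega>) * f \<omega> \<partial>M) = (\<integral>\<omega>. Im (\<xi> \<omega>) * g \<omega> \<partial>M)"
      using \<xi> by (intro r) (auto intro: order_trans[OF abs_Im_le_cmod b])
    then show "Im (\<integral>\<omega>. \<xi> \<omega> * of_real (f \<omega>) \<partial>M) = Im (\<integral>\<omega>. \<xi> \<omega> * of_real (g \<omega>) \<partial>M)"
      using ib[OF f] ib[OF g] by (simp flip: integral_Im)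
  qed
qed

text \<open>Here the bracket enters. The product of the increments is the increment of the
  martingale \<open>W * Z - \<rho> * t\<close>, plus \<open>\<rho> * (t - s)\<close>, minus two
  products of a past value with a future increment. The martingale property removes the first
  contribution, independence of the increments the last two.\<close>

lemma integral_incr_product:
  fixes \<xi> :: "'a \<Rightarrow> complex"
  assumes t: "0 \<le> s" "s < t" "t \<le> T"
    and \<xi>: "\<xi> \<in> borel_measurable (F s)" and b: "\<And>\<omega>. cmod (\<xi> \<omega>) \<le> C"
  shows "integrable M (\<lambda>\<omega>. \<xi> \<omega> * of_real ((W t \<omega> - W s \<omega>) * (Z t \<omega> - Z s \<omega>)))"
    and "(\<integral>\<omega>. \<xi> \<omega> * of_real ((W t \<omega> - W s \<omega>) * (Z t \<omega> - Z s \<omega>)) \<partial>M) = of_real (\<rho> * (t - s)) * (\<integral>\<omega>. \<xi> \<omega> \<partial>M)"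
proof -
  have sT: "s \<le> T" "0 \<le> t" using t by auto
  have \<xi>M: "\<xi> \<in> borel_measurable M" by (rule measurable_from_subalg[OF sub[OF t(1) sT(1)] \<xi>])
  have \<xi>i: "integrable M \<xi>" by (rule integrable_const_bound[of _ C]) (use b \<xi>M in auto)
  have mart: "martingale M T F (\<lambda>t \<omega>. W t \<omega> * Z t \<omega> - \<rho> * t)"
    using bracket by (simp add: is_bracket_def)
  have wz: "integrable M (\<lambda>\<omega>. W r \<omega> * Z r \<omega> - \<rho> * r)" if "0 \<le> r" "r \<le> T" for r
    using mart that by (auto simp: martingale_def)
  note b' = integrable_bounded_mult[OF \<xi>M b]
  have wz': "integrable M (\<lambda>\<omega>. \<xi> \<omega> * of_real (W r \<omega> * Z r \<omega> - \<rho> * r))" if "0 \<le> r" "r \<le> T" for r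
    by (rule b'[OF wz[OF that]])
  have e1: "(\<integral>\<omega>. \<xi> \<omega> * of_real (W t \<omega> * Z t \<omega> - \<rho> * t) \<partial>M) = (\<integral>\<omega>. \<xi> \<omega> * of_real (W s \<omega> * Z s \<omega> - \<rho> * s) \<partial>M)"
    using mart t sT by (intro integral_cond_exp_complex[OF _ _ \<xi> b] wz) (auto simp: martingale_def)
  have cross: "integrable M (\<lambda>\<omega>. \<xi> \<omega> * of_real (B s \<omega>) * of_real (B' t \<omega> - B' s \<omega>))"
    "(\<integral>\<omega>. \<xi> \<omega> * of_real (B s \<omega>) * of_real (B' t \<omega> - B' s \<omega>) \<partial>M) = 0"
    if B: "brownian_motion M T F B" and B': "brownian_motion M T F B'" for B B'
  proof -
    have [measurable]: "B s \<in> borel_measurable (F s)" "\<xi> \<in> borel_measurable (F s)"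
      using B \<xi> t sT by (auto simp: brownian_motion_def adapted_def)
    have *: "(\<lambda>\<omega>. \<xi> \<omega> * of_real (B s \<omega>)) \<in> borel_measurable (F s)" by measurable
    have **: "integrable M (\<lambda>\<omega>. \<xi> \<omega> * of_real (B s \<omega>))"
      by (intro b' integrable_bm B t sT)
    show "integrable M (\<lambda>\<omega>. \<xi> \<omega> * of_real (B s \<omega>) * of_real (B' t \<omega> - B' s \<omega>))"
      by (rule indep_normal_moments(1)[OF incr_indep_normal[OF t B'] * **])
    show "(\<integral>\<omega>. \<xi> \<omega> * of_real (B s \<omega>) * of_real (B' t \<omega> - B' s \<omega>) \<partial>M) = 0"
      by (rule indep_normal_moments(2)[OF incr_indep_normal[OF t B'] * **])
  qed
  have eq: "\<xi> \<omega> * of_real ((W t \<omega> - W s \<omega>) * (Z t \<omega> - Z s \<omega>)) =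
      (\<xi> \<omega> * of_real (W t \<omega> * Z t \<omega> - \<rho> * t) - \<xi> \<omega> * of_real (W s \<omega> * Z s \<omega> - \<rho> * s)
      + of_real (\<rho> * (t - s)) * \<xi> \<omega>)
      - \<xi> \<omega> * of_real (W s \<omega>) * of_real (Z t \<omega> - Z s \<omega>) - \<xi> \<omega> * of_real (Z s \<omega>) * of_real (W t \<omega> - W s \<omega>)" for \<omega>
    by (simp add: algebra_simps)
  show "integrable M (\<lambda>\<omega>. \<xi> \<omega> * of_real ((W t \<omega> - W s \<omega>) * (Z t \<omega> - Z s \<omega>)))"
    unfolding eq using wz'[of t] wz'[of s] t sT cross(1)[OF W Z] cross(1)[OF Z W] \<xi>i
    by (intro Bochner_Integration.integrable_diff Bochner_Integration.integrable_add) auto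
  show "(\<integral>\<omega>. \<xi> \<omega> * of_real ((W t \<omega> - W s \<omega>) * (Z t \<omega> - Z s \<omega>)) \<partial>M) = of_real (\<rho> * (t - s)) * (\<integral>\<omega>. \<xi> \<omega> \<partial>M)"
    unfolding eq using wz'[of t] wz'[of s] t sT cross[OF W Z] cross[OF Z W] \<xi>i e1
    by (simp only: Bochner_Integration.integral_diff Bochner_Integration.integral_add Bochner_Integration.integrable_diff
        Bochner_Integration.integrable_add integral_mult_right integrable_mult_right simp_thms order_refl less_imp_le) simp
qed

text \<open>The joint law of the two increments is still unknown, but a second order expansion of
  the exponential involves only their moments up to order two, which the bracket supplies, and the
  third absolute moments of each increment separately.\<close>

lemma iexp_incr_approx:
  fixes \<xi> :: "'a \<Rightarrow> complex"
  assumes t: "0 \<le> s" "s < t" "t \<le> T"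
    and \<xi>: "\<xi> \<in> borel_measurable (F s)" and b: "\<And>\<omega>. cmod (\<xi> \<omega>) \<le> C"
  shows "cmod ((\<integral>\<omega>. \<xi> \<omega> * iexp (u * (W t \<omega> - W s \<omega>) + v * (Z t \<omega> - Z s \<omega>)) \<partial>M)
     - of_real (1 - (u\<^sup>2 + v\<^sup>2 + 2 * \<rho> * u * v) / 2 * (t - s)) * (\<integral>\<omega>. \<xi> \<omega> \<partial>M))
    \<le> C * (4 * (\<bar>u\<bar>^3 + \<bar>v\<bar>^3)) * ((t - s) * sqrt (t - s))"
proof -
  have sT: "s \<le> T" "0 \<le> t" using t by auto
  have C0: "0 \<le> C" using order_trans[OF norm_ge_zero b] .
  define D where "D \<omega> = W t \<omega> - W s \<omega>" for \<omega>
  define E where "E \<omega> = Z t \<omega> - Z s \<omega>" for \<omega>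
  define N where "N \<omega> = u * D \<omega> + v * E \<omega>" for \<omega>
  define h where "h = t - s"
  have D: "indep_normal M (F s) h D" and E: "indep_normal M (F s) h E"
    unfolding D_def E_def h_def by (intro W_incr Z_incr t)+
  have \<xi>M[measurable]: "\<xi> \<in> borel_measurable M" by (rule measurable_from_subalg[OF sub[OF t(1) sT(1)] \<xi>])
  have [measurable]: "D \<in> borel_measurable M" "E \<in> borel_measurable M" using D E by (simp_all add: indep_normal_def)
  have NM[measurable]: "N \<in> borel_measurable M" unfolding N_def by measurable
  have \<xi>i: "integrable M \<xi>" by (rule integrable_const_bound[of _ C]) (use b in auto)
  note mD = indep_normal_moments[OF D \<xi> \<xi>i] and mE = indep_normal_moments[OF E \<xi> \<xi>i]
  note mDE = integral_incr_product[OF t \<xi> b, folded D_def E_def h_def]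
  have N1: "has_bochner_integral M (\<lambda>\<omega>. \<xi> \<omega> * of_real (N \<omega>)) 0"
  proof -
    have "has_bochner_integral M (\<lambda>\<omega>. of_real u * (\<xi> \<omega> * of_real (D \<omega>)) + of_real v * (\<xi> \<omega> * of_real (E \<omega>))) (of_real u * 0 + of_real v * 0)"
      using mD mE by (intro has_bochner_integral_add has_bochner_integral_mult_right) (auto simp: has_bochner_integral_iff)
    then show ?thesis by (simp add: N_def algebra_simps)
  qed
  have N2: "has_bochner_integral M (\<lambda>\<omega>. \<xi> \<omega> * of_real ((N \<omega>)\<^sup>2)) (of_real ((u\<^sup>2 + v\<^sup>2 + 2 * \<rho> * u * v) * h) * (\<integral>\<omega>. \<xi> \<omega> \<partial>M))"
  proof -
    have "has_bochner_integral M (\<lambda>\<omega>. of_real (u\<^sup>2) * (\<xi> \<omega> * of_real ((D \<omega>)\<^sup>2)) + of_real (v\<^sup>2) * (\<xi> \<omega> * of_real ((E \<omega>)\<^sup>2))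
       + of_real (2 * u * v) * (\<xi> \<omega> * of_real (D \<omega> * E \<omega>)))
       (of_real (u\<^sup>2) * ((\<integral>\<omega>. \<xi> \<omega> \<partial>M) * of_real h) + of_real (v\<^sup>2) * ((\<integral>\<omega>. \<xi> \<omega> \<partial>M) * of_real h)
         + of_real (2 * u * v) * (of_real (\<rho> * h) * (\<integral>\<omega>. \<xi> \<omega> \<partial>M)))"
      using mD mE mDE by (intro has_bochner_integral_add has_bochner_integral_mult_right) (auto simp: has_bochner_integral_iff)
    moreover have "of_real (u\<^sup>2) * (\<xi> \<omega> * of_real ((D \<omega>)\<^sup>2)) + of_real (v\<^sup>2) * (\<xi> \<omega> * of_real ((E \<omega>)\<^sup>2))
       + of_real (2 * u * v) * (\<xi> \<omega> * of_real (D \<omega> * E \<omega>)) = \<xi> \<omega> * of_real ((N \<omega>)\<^sup>2)" for \<omega>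
      by (simp add: N_def power2_eq_square algebra_simps)
    moreover have "of_real (u\<^sup>2) * ((\<integral>\<omega>. \<xi> \<omega> \<partial>M) * of_real h) + of_real (v\<^sup>2) * ((\<integral>\<omega>. \<xi> \<omega> \<partial>M) * of_real h)
         + of_real (2 * u * v) * (of_real (\<rho> * h) * (\<integral>\<omega>. \<xi> \<omega> \<partial>M)) = of_real ((u\<^sup>2 + v\<^sup>2 + 2 * \<rho> * u * v) * h) * (\<integral>\<omega>. \<xi> \<omega> \<partial>M)"
      by (simp add: algebra_simps)
    ultimately show ?thesis by simp
  qed
  define R where "R \<omega> = iexp (N \<omega>) - (1 + \<i> * complex_of_real (N \<omega>) - complex_of_real ((N \<omega>)\<^sup>2) / 2)" for \<omega>
  have i0: "integrable M (\<lambda>\<omega>. \<xi> \<omega> * iexp (N \<omega>))"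
    by (rule integrable_const_bound[of _ C]) (auto simp: norm_mult b)
  have main: "has_bochner_integral M (\<lambda>\<omega>. \<xi> \<omega> * iexp (N \<omega>) - (\<xi> \<omega> + \<i> * (\<xi> \<omega> * of_real (N \<omega>)) - (\<xi> \<omega> * of_real ((N \<omega>)\<^sup>2)) * (1/2)))
     ((\<integral>\<omega>. \<xi> \<omega> * iexp (N \<omega>) \<partial>M) - ((\<integral>\<omega>. \<xi> \<omega> \<partial>M) + \<i> * 0 - (of_real ((u\<^sup>2 + v\<^sup>2 + 2 * \<rho> * u * v) * h) * (\<integral>\<omega>. \<xi> \<omega> \<partial>M)) * (1/2)))"
    using N1 N2 i0 \<xi>i
    by (intro has_bochner_integral_add has_bochner_integral_diff has_bochner_integral_mult_right has_bochner_integral_mult_left)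
      (auto simp: has_bochner_integral_iff)
  have R: "\<xi> \<omega> * iexp (N \<omega>) - (\<xi> \<omega> + \<i> * (\<xi> \<omega> * of_real (N \<omega>)) - (\<xi> \<omega> * of_real ((N \<omega>)\<^sup>2)) * (1/2)) = \<xi> \<omega> * R \<omega>" for \<omega>
    by (simp add: R_def algebra_simps)
  have "(\<integral>\<omega>. \<xi> \<omega> * iexp (N \<omega>) \<partial>M) - of_real (1 - (u\<^sup>2 + v\<^sup>2 + 2 * \<rho> * u * v) / 2 * h) * (\<integral>\<omega>. \<xi> \<omega> \<partial>M)
    = (\<integral>\<omega>. \<xi> \<omega> * R \<omega> \<partial>M)" and iR: "integrable M (\<lambda>\<omega>. \<xi> \<omega> * R \<omega>)"
    using main unfolding R by (auto simp: has_bochner_integral_iff algebra_simps)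
  then have "cmod ((\<integral>\<omega>. \<xi> \<omega> * iexp (N \<omega>) \<partial>M) - of_real (1 - (u\<^sup>2 + v\<^sup>2 + 2 * \<rho> * u * v) / 2 * h) * (\<integral>\<omega>. \<xi> \<omega> \<partial>M))
     \<le> (\<integral>\<omega>. cmod (\<xi> \<omega> * R \<omega>) \<partial>M)"
    by simp
  also have "\<dots> \<le> (\<integral>\<omega>. C * (2 * (\<bar>u\<bar>^3 * \<bar>D \<omega>\<bar>^3 + \<bar>v\<bar>^3 * \<bar>E \<omega>\<bar>^3)) \<partial>M)"
  proof (rule integral_mono)
    show "integrable M (\<lambda>\<omega>. cmod (\<xi> \<omega> * R \<omega>))" using iR by simp
    show "integrable M (\<lambda>\<omega>. C * (2 * (\<bar>u\<bar>^3 * \<bar>D \<omega>\<bar>^3 + \<bar>v\<bar>^3 * \<bar>E \<omega>\<bar>^3)))"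
      using indep_normal_abs_cube(1)[OF D] indep_normal_abs_cube(1)[OF E] by simp
    fix \<omega>
    define a c where "a = \<bar>u * D \<omega>\<bar>" and "c = \<bar>v * E \<omega>\<bar>"
    have "\<bar>N \<omega>\<bar> \<le> 2 * max a c" by (simp add: N_def a_def c_def)
    then have "\<bar>N \<omega>\<bar>^3 \<le> (2 * max a c)^3" by (rule power_mono) simp
    also have "\<dots> = 8 * (max a c)^3" by (simp add: power_mult_distrib)
    also have "\<dots> \<le> 8 * (a^3 + c^3)" by (simp add: max_def a_def c_def)
    \<comment> \<open>Rounding 8 up to 12 turns the division by 6 into the factor 2; the bound
      \<open>2 * (h * sqrt h)\<close> on the third moments then gives the constant 4.\<close>
    also have "\<dots> \<le> 12 * (a^3 + c^3)" by (simp add: a_def c_def)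
    finally have "\<bar>N \<omega>\<bar>^3 / 6 \<le> 2 * (a^3 + c^3)" by simp
    then have "cmod (R \<omega>) \<le> 2 * (\<bar>u\<bar>^3 * \<bar>D \<omega>\<bar>^3 + \<bar>v\<bar>^3 * \<bar>E \<omega>\<bar>^3)"
      using iexp_second_order[of "N \<omega>"] unfolding R_def a_def c_def abs_mult power_mult_distrib by linarith
    then show "cmod (\<xi> \<omega> * R \<omega>) \<le> C * (2 * (\<bar>u\<bar>^3 * \<bar>D \<omega>\<bar>^3 + \<bar>v\<bar>^3 * \<bar>E \<omega>\<bar>^3))"
      unfolding norm_mult using b C0 by (intro mult_mono) auto
  qed
  also have "\<dots> = C * (2 * (\<bar>u\<bar>^3 * (\<integral>\<omega>. \<bar>D \<omega>\<bar>^3 \<partial>M) + \<bar>v\<bar>^3 * (\<integral>\<omega>. \<bar>E \<omega>\<bar>^3 \<partial>M)))"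
    using indep_normal_abs_cube(1)[OF D] indep_normal_abs_cube(1)[OF E] by simp
  also have "\<dots> \<le> C * (2 * (\<bar>u\<bar>^3 * (2 * (h * sqrt h)) + \<bar>v\<bar>^3 * (2 * (h * sqrt h))))"
    using indep_normal_abs_cube(2)[OF D] indep_normal_abs_cube(2)[OF E] C0
    by (intro mult_left_mono add_mono) auto
  also have "\<dots> = C * (4 * (\<bar>u\<bar>^3 + \<bar>v\<bar>^3)) * (h * sqrt h)" by (simp add: algebra_simps)
  finally show ?thesis by (simp add: N_def D_def E_def h_def)
qed

end

section \<open>Finite time grids\<close>

abbreviation gap :: "(nat \<Rightarrow> real) \<Rightarrow> nat \<Rightarrow> real" where
  "gap g i \<equiv> g (Suc i) - g i"

abbreviation incr :: "(real \<Rightarrow> 'a \<Rightarrow> real) \<Rightarrow> (nat \<Rightarrow> real) \<Rightarrow> nat \<Rightarrow> 'a \<Rightarrow> real" where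
  "incr B g i \<omega> \<equiv> B (g (Suc i)) \<omega> - B (g i) \<omega>"

text \<open>An increment over a coarse interval becomes a sum over the whole fine grid with weights
  0 and 1. As the range of summation no longer depends on the interval, sums over coarse and fine
  grids can be interchanged.\<close>

lemma sum_indicator_increments:
  fixes f :: "nat \<Rightarrow> real"
  assumes "a \<le> b" "b \<le> N"
  shows "f b - f a = (\<Sum>j<N. (if a \<le> j \<and> j < b then 1 else 0) * (f (Suc j) - f j))"
proof -
  have "(\<Sum>j<N. (if a \<le> j \<and> j < b then 1 else 0) * (f (Suc j) - f j)) = (\<Sum>j\<in>{a..<b}. f (Suc j) - f j)"
    using assms by (intro sum.mono_neutral_cong_right) auto
  also have "\<dots> = f b - f a" using sum_Suc_diff'[OF assms(1), of f] by simp
  finally show ?thesis by simp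
qed

lemma finite_strict_enumeration:
  fixes P :: "real set"
  assumes "finite P" "P \<noteq> {}"
  obtains \<gamma> N where "\<And>i. i < N \<Longrightarrow> \<gamma> i < \<gamma> (Suc i)" "\<gamma> ` {..N::nat} = P"
proof -
  define xs where "xs = sorted_list_of_set P"
  have xs: "set xs = P" "sorted_wrt (<) xs" using assms by (simp_all add: xs_def)
  define N where "N = length xs - 1"
  have N: "length xs = Suc N" using xs assms by (cases xs) (auto simp: N_def)
  show ?thesis
  proof (rule that)
    show "xs ! i < xs ! Suc i" if "i < N" for i
      using sorted_wrt_nth_less[OF xs(2), of i "Suc i"] that N by simp
    show "(!) xs ` {..N} = P"
      using N unfolding xs(1)[symmetric] set_conv_nth by (auto simp: less_Suc_eq_le)
  qed
qed

lemma strict_grid_less: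
  fixes g :: "nat \<Rightarrow> real"
  assumes "\<And>i. i < m \<Longrightarrow> g i < g (Suc i)" "i < j" "j \<le> m"
  shows "g i < g j"
  using assms(2,3)
proof (induction j)
  case (Suc j)
  then show ?case using assms(1)[of j] by (cases "i = j") auto
qed simp

lemma strict_grid_le:
  fixes g :: "nat \<Rightarrow> real"
  assumes "\<And>i. i < m \<Longrightarrow> g i < g (Suc i)" "i \<le> j" "j \<le> m"
  shows "g i \<le> g j"
  using strict_grid_less[of m g i j, OF assms(1)] assms(2,3) by (cases "i = j") auto

lemma strict_grid_range:
  fixes g :: "nat \<Rightarrow> real"
  assumes "\<And>i. i < m \<Longrightarrow> g i < g (Suc i)" "0 \<le> g 0" "g m \<le> T" "i \<le> m"
  shows "0 \<le> g i" "g i \<le> T"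
  using strict_grid_le[of m g 0 i] strict_grid_le[of m g i m] assms by auto

context correlated_brownian_motions
begin

lemma W_measurable_F: "0 \<le> r \<Longrightarrow> r \<le> s \<Longrightarrow> s \<le> T \<Longrightarrow> W r \<in> borel_measurable (F s)"
  and Z_measurable_F: "0 \<le> r \<Longrightarrow> r \<le> s \<Longrightarrow> s \<le> T \<Longrightarrow> Z r \<in> borel_measurable (F s)"
  using measurable_F_mono[of r s] W_adapted[of r] Z_adapted[of r] by auto

text \<open>Lindeberg's argument: \<open>[s, t]\<close> is cut into \<open>n\<close> equal pieces
  and the expansion is applied to each, the exponential of the earlier pieces being absorbed into
  the weight, whose bound \<open>C\<close> does not change. The errors add up to order
  \<open>1 / sqrt n\<close>, while the product of the main terms, \<open>(1 - c / n) ^ n\<close>,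
  tends to \<open>exp (- c)\<close>.\<close>

lemma integral_iexp_incr:
  fixes \<xi> :: "'a \<Rightarrow> complex"
  assumes t: "0 \<le> s" "s < t" "t \<le> T"
    and \<xi>: "\<xi> \<in> borel_measurable (F s)" and b: "\<And>\<omega>. cmod (\<xi> \<omega>) \<le> C"
  shows "(\<integral>\<omega>. \<xi> \<omega> * iexp (u * (W t \<omega> - W s \<omega>) + v * (Z t \<omega> - Z s \<omega>)) \<partial>M)
     = of_real (exp (- (u\<^sup>2 + v\<^sup>2 + 2 * \<rho> * u * v) / 2 * (t - s))) * (\<integral>\<omega>. \<xi> \<omega> \<partial>M)" (is "?X = _")
proof -
  define c where "c = (u\<^sup>2 + v\<^sup>2 + 2 * \<rho> * u * v) / 2 * (t - s)"
  define A where "A = C * (4 * (\<bar>u\<bar>^3 + \<bar>v\<bar>^3))"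
  have C0: "0 \<le> C" using order_trans[OF norm_ge_zero b] .
  have "u\<^sup>2 + v\<^sup>2 + 2 * \<rho> * u * v = (u + \<rho> * v)\<^sup>2 + (1 - \<rho>\<^sup>2) * v\<^sup>2" by (simp add: power2_eq_square algebra_simps)
  moreover have "\<rho>\<^sup>2 \<le> 1" using \<rho> by (simp add: abs_square_le_1)
  \<comment> \<open>Completing the square shows \<open>0 \<le> c\<close>. Hence
    \<open>1 - c / n\<close> lies in \<open>[0, 1]\<close> for \<open>n \<ge> c\<close>, and
    multiplying by it does not amplify the errors made so far.\<close>
  ultimately have c0: "0 \<le> c" using t by (simp add: c_def)
  have bound: "cmod (?X - of_real ((1 - c / n) ^ n) * (\<integral>\<omega>. \<xi> \<omega> \<partial>M)) \<le> A * ((t - s) * sqrt ((t - s) / n))"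
    if n: "c \<le> real n" "n \<noteq> 0" for n :: nat
  proof -
    define h where "h = (t - s) / n"
    have h: "0 < h" using t n by (simp add: h_def)
    define r where "r k = s + real k * h" for k :: nat
    have r0: "r 0 = s" by (simp add: r_def)
    have rn: "r n = t" using n by (simp add: r_def h_def)
    have r_Suc: "r (Suc k) - r k = h" for k by (simp add: r_def algebra_simps)
    have r_ge: "s \<le> r k" for k using h by (simp add: r_def)
    have r_le: "r k \<le> t" if "k \<le> n" for k
    proof -
      have "real k * h \<le> real n * h" using that h by (intro mult_right_mono) auto
      then show ?thesis using rn by (simp add: r_def)
    qed
    define X where "X k = (\<integral>\<omega>. \<xi> \<omega> * iexp (u * (W (r k) \<omega> - W s \<omega>) + v * (Z (r k) \<omega> - Z s \<omega>)) \<partial>M)" for k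
    have step: "cmod (X (Suc k) - of_real (1 - c / n) * X k) \<le> A * (h * sqrt h)" if k: "k < n" for k
    proof -
      have rk: "0 \<le> r k" "r k < r (Suc k)" "r (Suc k) \<le> T" "r k \<le> T"
        using r_ge[of k] r_le[of "Suc k"] r_le[of k] t k h r_Suc[of k] by auto
      define \<eta> where "\<eta> \<omega> = \<xi> \<omega> * iexp (u * (W (r k) \<omega> - W s \<omega>) + v * (Z (r k) \<omega> - Z s \<omega>))" for \<omega>
      have [measurable]: "\<xi> \<in> borel_measurable (F (r k))" "W s \<in> borel_measurable (F (r k))" "Z s \<in> borel_measurable (F (r k))"
        "W (r k) \<in> borel_measurable (F (r k))" "Z (r k) \<in> borel_measurable (F (r k))"
        using r_ge[of k] rk t measurable_F_mono[OF t(1) r_ge[of k] rk(4) \<xi>] by (simp_all add: W_measurable_F Z_measurable_F)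
      have 1: "\<eta> \<in> borel_measurable (F (r k))" unfolding \<eta>_def by measurable
      have 2: "cmod (\<eta> \<omega>) \<le> C" for \<omega> using b[of \<omega>] by (simp add: \<eta>_def norm_mult)
      have 3: "\<eta> \<omega> * iexp (u * (W (r (Suc k)) \<omega> - W (r k) \<omega>) + v * (Z (r (Suc k)) \<omega> - Z (r k) \<omega>)) =
        \<xi> \<omega> * iexp (u * (W (r (Suc k)) \<omega> - W s \<omega>) + v * (Z (r (Suc k)) \<omega> - Z s \<omega>))" for \<omega>
        unfolding \<eta>_def mult.assoc exp_add[symmetric] by (simp add: algebra_simps)
      have 4: "(u\<^sup>2 + v\<^sup>2 + 2 * \<rho> * u * v) / 2 * h = c / n"
        by (simp add: h_def c_def)
      show ?thesis
        using iexp_incr_approx[OF rk(1-3) 1 2, of u v] 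
        by (simp only: 3 r_Suc 4 A_def[symmetric]) (simp only: X_def \<eta>_def)
    qed
    have q: "0 \<le> 1 - c / n" "1 - c / n \<le> 1" using n c0 by (auto simp: field_simps)
    have "cmod (X k - of_real ((1 - c / n) ^ k) * X 0) \<le> real k * (A * (h * sqrt h))" if "k \<le> n" for k
      using that
    proof (induction k)
      case (Suc k)
      have "X (Suc k) - of_real ((1 - c / n) ^ Suc k) * X 0 =
        (X (Suc k) - of_real (1 - c / n) * X k) + of_real (1 - c / n) * (X k - of_real ((1 - c / n) ^ k) * X 0)"
        by (simp add: algebra_simps)
      then have "cmod (X (Suc k) - of_real ((1 - c / n) ^ Suc k) * X 0) \<le>
        cmod (X (Suc k) - of_real (1 - c / n) * X k) + cmod (of_real (1 - c / n) * (X k - of_real ((1 - c / n) ^ k) * X 0))"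
        by (metis norm_triangle_ineq)
      also have "cmod (of_real (1 - c / n) * (X k - of_real ((1 - c / n) ^ k) * X 0)) \<le> 1 * cmod (X k - of_real ((1 - c / n) ^ k) * X 0)"
        unfolding norm_mult norm_of_real using q by (intro mult_right_mono) auto
      also have "\<dots> \<le> real k * (A * (h * sqrt h))" using Suc by simp
      also have "cmod (X (Suc k) - of_real (1 - c / n) * X k) \<le> A * (h * sqrt h)" using step Suc by simp
      finally show ?case by (simp add: algebra_simps)
    qed simp
    from this[of n] have "cmod (X n - of_real ((1 - c / n) ^ n) * X 0) \<le> A * ((real n * h) * sqrt h)"
      by (simp add: mult_ac)
    moreover have "real n * h = t - s" using n by (simp add: h_def)
    ultimately show ?thesis by (simp add: X_def rn r0 h_def)
  qed
  have "(\<lambda>n. of_real ((1 - c / real n) ^ n) * (\<integral>\<omega>. \<xi> \<omega> \<partial>M)) \<longlonglongrightarrow> ?X"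
  proof (rule Lim_transform2[where f="\<lambda>_. ?X"])
    show "(\<lambda>n. ?X) \<longlonglongrightarrow> ?X" by simp
    have "(\<lambda>n. A * ((t - s) * sqrt ((t - s) / real n))) \<longlonglongrightarrow> A * ((t - s) * sqrt 0)"
      by (intro tendsto_intros tendsto_real_sqrt lim_const_over_n)
    then have lim: "(\<lambda>n. A * ((t - s) * sqrt ((t - s) / real n))) \<longlonglongrightarrow> 0" by simp
    show "(\<lambda>n. ?X - of_real ((1 - c / real n) ^ n) * (\<integral>\<omega>. \<xi> \<omega> \<partial>M)) \<longlonglongrightarrow> 0"
    proof (rule Lim_null_comparison[OF _ lim])
      obtain m :: nat where m: "c \<le> real m" using real_arch_simple by blast
      show "\<forall>\<^sub>F n in sequentially. cmod (?X - of_real ((1 - c / real n) ^ n) * (\<integral>\<omega>. \<xi> \<omega> \<partial>M)) \<le> A * ((t - s) * sqrt ((t - s) / real n))"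
        using eventually_ge_at_top[of "Suc m"]
      proof eventually_elim
        case (elim n)
        then show ?case using m by (intro bound) auto
      qed
    qed
  qed
  moreover have "(\<lambda>n. (1 - c / real n) ^ n) \<longlonglongrightarrow> exp (- c)"
    using tendsto_exp_limit_sequentially[of "-c"] by simp
  then have "(\<lambda>n. of_real ((1 - c / real n) ^ n) * (\<integral>\<omega>. \<xi> \<omega> \<partial>M)) \<longlonglongrightarrow> of_real (exp (-c)) * (\<integral>\<omega>. \<xi> \<omega> \<partial>M)"
    by (intro tendsto_intros tendsto_of_real)
  ultimately have "?X = of_real (exp (-c)) * (\<integral>\<omega>. \<xi> \<omega> \<partial>M)" by (rule LIMSEQ_unique)
  then show ?thesis by (simp only: c_def minus_mult_left minus_divide_left)
qed

text \<open>The part of \<open>W\<close> that is orthogonal to \<open>Z\<close>, not normalised: its variance at time \<open>t\<close> is \<open>(1 - \<rho>\<^sup>2) t\<close>.\<close>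

definition Bp :: "real \<Rightarrow> 'a \<Rightarrow> real" where "Bp t \<omega> = W t \<omega> - \<rho> * Z t \<omega>"

lemma Bp_measurable_F: "0 \<le> r \<Longrightarrow> r \<le> s \<Longrightarrow> s \<le> T \<Longrightarrow> Bp r \<in> borel_measurable (F s)"
  unfolding Bp_def[abs_def] by (intro borel_measurable_diff borel_measurable_times W_measurable_F Z_measurable_F) auto

lemma Bp_measurable: "0 \<le> t \<Longrightarrow> t \<le> T \<Longrightarrow> Bp t \<in> borel_measurable M"
  by (rule measurable_from_subalg[OF sub Bp_measurable_F]) auto

text \<open>On one gap \<open>u * Bp + v * Z\<close> is \<open>u * W + (v - \<rho> * u) * Z\<close>,
  and for these coefficients the quadratic form of the previous lemma has no mixed term. The last
  gap is split off repeatedly, the exponential of the others serving as the weight known at its left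
  end.\<close>

lemma joint_char_grid:
  assumes g: "\<And>i. i < m \<Longrightarrow> g i < g (Suc i)" "0 \<le> g 0" "g m \<le> T"
  shows "(\<integral>\<omega>. iexp (\<Sum>j<m. u j * (incr Bp g j \<omega>) + v j * (incr Z g j \<omega>)) \<partial>M)
    = of_real (exp (- (\<Sum>j<m. ((1 - \<rho>\<^sup>2) * (u j)\<^sup>2 + (v j)\<^sup>2) / 2 * (gap g j))))"
proof -
  note gT = strict_grid_range[of m g T, OF g]
  define J where "J k \<omega> = (\<Sum>j<k. u j * (incr Bp g j \<omega>) + v j * (incr Z g j \<omega>))" for k \<omega>
  have "(\<integral>\<omega>. iexp (J k \<omega>) \<partial>M) = of_real (exp (- (\<Sum>j<k. ((1 - \<rho>\<^sup>2) * (u j)\<^sup>2 + (v j)\<^sup>2) / 2 * (gap g j))))" if "k \<le> m" for k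
    using that
  proof (induction k)
    case 0 then show ?case by (simp add: J_def prob_space)
  next
    case (Suc k)
    then have k: "k < m" by simp
    have "(\<lambda>\<omega>. u j * (incr Bp g j \<omega>) + v j * (incr Z g j \<omega>)) \<in> borel_measurable (F (g k))"
      if "j < k" for j
    proof -
      have j: "g j \<le> g k" "g (Suc j) \<le> g k" using strict_grid_le[of m g _ k] g that k by auto
      have [measurable]: "Bp (g (Suc j)) \<in> borel_measurable (F (g k))" "Bp (g j) \<in> borel_measurable (F (g k))"
        "Z (g (Suc j)) \<in> borel_measurable (F (g k))" "Z (g j) \<in> borel_measurable (F (g k))"
        using j gT[of k] gT[of j] gT[of "Suc j"] that k by (simp_all add: Bp_measurable_F Z_measurable_F)
      show ?thesis by measurable
    qed
    then have [measurable]: "J k \<in> borel_measurable (F (g k))" unfolding J_def[abs_def] by (intro borel_measurable_sum) auto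
    have 1: "(\<lambda>\<omega>. iexp (J k \<omega>)) \<in> borel_measurable (F (g k))" by measurable
    have 2: "iexp (J (Suc k) \<omega>) = iexp (J k \<omega>) * iexp (u k * (incr W g k \<omega>) + (v k - \<rho> * u k) * (incr Z g k \<omega>))" for \<omega>
      unfolding exp_add[symmetric] by (simp add: J_def Bp_def algebra_simps)
    have "(\<integral>\<omega>. iexp (J (Suc k) \<omega>) \<partial>M) = of_real (exp (- ((u k)\<^sup>2 + (v k - \<rho> * u k)\<^sup>2 + 2 * \<rho> * u k * (v k - \<rho> * u k)) / 2 * (gap g k)))
       * (\<integral>\<omega>. iexp (J k \<omega>) \<partial>M)"
      unfolding 2 using k gT[of k] gT[of "Suc k"] g(1)[of k] by (intro integral_iexp_incr[OF _ _ _ 1, of _ 1]) auto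
    also have "(u k)\<^sup>2 + (v k - \<rho> * u k)\<^sup>2 + 2 * \<rho> * u k * (v k - \<rho> * u k) = (1 - \<rho>\<^sup>2) * (u k)\<^sup>2 + (v k)\<^sup>2"
      by (simp add: power2_eq_square algebra_simps)
    also have "(\<integral>\<omega>. iexp (J k \<omega>) \<partial>M) = of_real (exp (- (\<Sum>j<k. ((1 - \<rho>\<^sup>2) * (u j)\<^sup>2 + (v j)\<^sup>2) / 2 * (gap g j))))"
      using Suc by simp
    finally have "(\<integral>\<omega>. iexp (J (Suc k) \<omega>) \<partial>M) = of_real (exp (- ((1 - \<rho>\<^sup>2) * (u k)\<^sup>2 + (v k)\<^sup>2) / 2 * (gap g k)
        + - (\<Sum>j<k. ((1 - \<rho>\<^sup>2) * (u j)\<^sup>2 + (v j)\<^sup>2) / 2 * (gap g j))))"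
      by (simp only: of_real_mult[symmetric] exp_add[symmetric])
    moreover have "- a / 2 * d + - b = - (b + a / 2 * d)" for a b d :: real by simp
    ultimately show ?case by (simp only: sum.lessThan_Suc)
  qed
  from this[of m] show ?thesis by (simp add: J_def)
qed

end

section \<open>Independence from the filtration of Z\<close>

text \<open>
  Since \<open>1 + V / c\<close> is a probability density for large \<open>c\<close>, Levy's uniqueness theorem applies to the law of \<open>X\<close>
  under it. The several-variable version below integrates one coordinate at a time, which avoids a
  multivariate uniqueness theorem.
\<close>

lemma (in prob_space) fourier_null_real:
  fixes V X :: "'a \<Rightarrow> real"
  assumes [measurable]: "V \<in> borel_measurable M" "X \<in> borel_measurable M" and b: "\<And>\<omega>. \<bar>V \<omega>\<bar> \<le> C"
    and 0: "\<And>v. (\<integral>\<omega>. of_real (V \<omega>) * iexp (v * X \<omega>) \<partial>M) = 0" and D[measurable]: "D \<in> sets borel"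
  shows "(\<integral>\<omega>. V \<omega> * indicator D (X \<omega>) \<partial>M) = 0"
proof -
  define c where "c = C + 1"
  have c: "0 < c" using order_trans[OF abs_ge_zero b] by (auto simp: c_def intro: add_nonneg_pos)
  define w where "w \<omega> = 1 + V \<omega> / c" for \<omega>
  have w0: "0 \<le> w \<omega>" for \<omega>
  proof -
    have "- V \<omega> \<le> c" using b[of \<omega>] by (simp add: c_def abs_le_iff)
    then show ?thesis using c by (simp add: w_def field_simps)
  qed
  have [measurable]: "w \<in> borel_measurable M" unfolding w_def by measurable
  have Vi: "integrable M V" by (rule integrable_const_bound[of _ C]) (use b in auto)
  have Vii: "integrable M (\<lambda>\<omega>. of_real (V \<omega>) * iexp (v * X \<omega>))" for v
    by (rule integrable_const_bound[of _ C]) (use b in \<open>auto simp: norm_mult\<close>)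
  \<comment> \<open>The frequency 0 says that \<open>V\<close> has mean 0, so \<open>w\<close>
    integrates to 1.\<close>
  have "complex_of_real (\<integral>\<omega>. V \<omega> \<partial>M) = 0" using 0[of 0] by simp
  then have EV: "(\<integral>\<omega>. V \<omega> \<partial>M) = 0" by simp
  have "(\<integral>\<^sup>+\<omega>. ennreal (w \<omega>) \<partial>M) = ennreal (\<integral>\<omega>. w \<omega> \<partial>M)"
    using Vi w0 by (intro nn_integral_eq_integral) (auto simp: w_def)
  also have "\<dots> = 1" using Vi EV by (simp add: w_def prob_space)
  finally have "emeasure (density M (\<lambda>\<omega>. ennreal (w \<omega>))) (space M) = 1"
    by (simp add: emeasure_density cong: nn_integral_cong)
  then interpret Q: prob_space "density M (\<lambda>\<omega>. ennreal (w \<omega>))" by (intro prob_spaceI) simp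
  have "distr (density M (\<lambda>\<omega>. ennreal (w \<omega>))) borel X = distr M borel X"
  proof (rule Levy_uniqueness)
    show "real_distribution (distr (density M (\<lambda>\<omega>. ennreal (w \<omega>))) borel X)"
      by (rule Q.real_distribution_distr) measurable
    show "real_distribution (distr M borel X)" by (rule real_distribution_distr) measurable
    show "char (distr (density M (\<lambda>\<omega>. ennreal (w \<omega>))) borel X) = char (distr M borel X)"
    proof
      fix v
      have "char (distr (density M (\<lambda>\<omega>. ennreal (w \<omega>))) borel X) v = (\<integral>\<omega>. w \<omega> *\<^sub>R iexp (v * X \<omega>) \<partial>M)"
        unfolding char_def by (subst integral_distr, simp, simp) (subst integral_density, auto simp: w0)
      also have "\<dots> = (\<integral>\<omega>. iexp (v * X \<omega>) + of_real (1 / c) * (of_real (V \<omega>) * iexp (v * X \<omega>)) \<partial>M)"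
        by (intro Bochner_Integration.integral_cong) (simp_all add: w_def scaleR_conv_of_real algebra_simps)
      also have "\<dots> = (\<integral>\<omega>. iexp (v * X \<omega>) \<partial>M)"
        using Vii[of v] 0[of v] integrable_iexp[of "\<lambda>\<omega>. v * X \<omega>"] by (subst Bochner_Integration.integral_add) auto
      also have "\<dots> = char (distr M borel X) v" unfolding char_def by (subst integral_distr) auto
      finally show "char (distr (density M (\<lambda>\<omega>. ennreal (w \<omega>))) borel X) v = char (distr M borel X) v" .
    qed
  qed
  then have "(\<integral>x. indicator D x \<partial>distr (density M (\<lambda>\<omega>. ennreal (w \<omega>))) borel X) = (\<integral>x. indicator D x \<partial>distr M borel X :: real)"
    by simp
  moreover have "(\<integral>x. indicator D x \<partial>distr (density M (\<lambda>\<omega>. ennreal (w \<omega>))) borel X) = (\<integral>\<omega>. w \<omega> *\<^sub>R (indicator D (X \<omega>) :: real) \<partial>M)"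
    by (subst integral_distr, simp, simp) (subst integral_density, auto simp: w0)
  moreover have "(\<integral>x. indicator D x \<partial>distr M borel X) = (\<integral>\<omega>. (indicator D (X \<omega>) :: real) \<partial>M)"
    by (rule integral_distr) measurable
  ultimately have "(\<integral>\<omega>. w \<omega> * indicator D (X \<omega>) \<partial>M) = (\<integral>\<omega>. indicator D (X \<omega>) \<partial>M)"
    by simp
  moreover have i1: "integrable M (\<lambda>\<omega>. indicator D (X \<omega>) :: real)"
    by (rule integrable_const_bound[of _ 1]) (auto simp: indicator_def)
  have i2: "integrable M (\<lambda>\<omega>. V \<omega> * indicator D (X \<omega>))"
    by (rule integrable_const_bound[of _ C]) (use b order_trans[OF abs_ge_zero b] in \<open>auto simp: indicator_def\<close>)
  have "(\<integral>\<omega>. w \<omega> * indicator D (X \<omega>) \<partial>M) = (\<integral>\<omega>. indicator D (X \<omega>) + (1 / c) * (V \<omega> * indicator D (X \<omega>)) \<partial>M)"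
    by (intro Bochner_Integration.integral_cong) (simp_all add: w_def algebra_simps)
  then have "(\<integral>\<omega>. w \<omega> * indicator D (X \<omega>) \<partial>M) = (\<integral>\<omega>. indicator D (X \<omega>) \<partial>M) + (1 / c) * (\<integral>\<omega>. V \<omega> * indicator D (X \<omega>) \<partial>M)"
    using i1 i2 by (simp only: Bochner_Integration.integral_add integrable_mult_right integral_mult_right_zero)
  ultimately show ?thesis using c by simp
qed

text \<open>Conjugation turns the hypothesis at \<open>- v\<close> into the same statement for
  \<open>cnj V\<close> at \<open>v\<close>. Real and imaginary part of \<open>V\<close>, being
  combinations of \<open>V\<close> and \<open>cnj V\<close>, thus satisfy the real version.\<close>

lemma (in prob_space) fourier_null:
  fixes V :: "'a \<Rightarrow> complex" and X :: "'a \<Rightarrow> real"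
  assumes V[measurable]: "V \<in> borel_measurable M" and X[measurable]: "X \<in> borel_measurable M" and b: "\<And>\<omega>. cmod (V \<omega>) \<le> C"
    and 0: "\<And>v. (\<integral>\<omega>. V \<omega> * iexp (v * X \<omega>) \<partial>M) = 0" and D[measurable]: "D \<in> sets borel"
  shows "(\<integral>\<omega>. V \<omega> * indicator D (X \<omega>) \<partial>M) = 0"
proof -
  have [measurable]: "(\<lambda>\<omega>. cnj (V \<omega>)) \<in> borel_measurable M"
    by (intro measurable_compose[OF V borel_measurable_continuous_onI] continuous_intros)
  have i: "integrable M (\<lambda>\<omega>. V \<omega> * iexp (v * X \<omega>))" "integrable M (\<lambda>\<omega>. cnj (V \<omega>) * iexp (v * X \<omega>))" for v
    by (rule integrable_const_bound[of _ C]; use b in \<open>auto simp: norm_mult\<close>)+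
  have c0: "(\<integral>\<omega>. cnj (V \<omega>) * iexp (v * X \<omega>) \<partial>M) = 0" for v
  proof -
    have "(\<integral>\<omega>. cnj (V \<omega>) * iexp (v * X \<omega>) \<partial>M) = (\<integral>\<omega>. cnj (V \<omega> * iexp ((- v) * X \<omega>)) \<partial>M)"
      by (simp add: exp_cnj)
    also have "\<dots> = cnj (\<integral>\<omega>. V \<omega> * iexp ((- v) * X \<omega>) \<partial>M)" by (intro integral_bounded_linear bounded_linear_cnj i)
    finally show ?thesis using 0[of "- v"] by simp
  qed
  have "(\<integral>\<omega>. of_real (Re (V \<omega>)) * iexp (v * X \<omega>) \<partial>M) = 0" for v
  proof -
    have "(\<integral>\<omega>. of_real (Re (V \<omega>)) * iexp (v * X \<omega>) \<partial>M) = (\<integral>\<omega>. (1/2) * (V \<omega> * iexp (v * X \<omega>) + cnj (V \<omega>) * iexp (v * X \<omega>)) \<partial>M)"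
      by (intro Bochner_Integration.integral_cong refl) (simp add: complex_add_cnj flip: distrib_right)
    also have "\<dots> = 0" using i[of v] 0[of v] c0[of v] by simp
    finally show ?thesis .
  qed
  then have re: "(\<integral>\<omega>. Re (V \<omega>) * indicator D (X \<omega>) \<partial>M) = 0"
    by (intro fourier_null_real[where C=C]) (auto intro: order_trans[OF abs_Re_le_cmod b])
  have "(\<integral>\<omega>. of_real (Im (V \<omega>)) * iexp (v * X \<omega>) \<partial>M) = 0" for v
  proof -
    have "(\<integral>\<omega>. of_real (Im (V \<omega>)) * iexp (v * X \<omega>) \<partial>M) = (\<integral>\<omega>. (- \<i>/2) * (V \<omega> * iexp (v * X \<omega>) - cnj (V \<omega>) * iexp (v * X \<omega>)) \<partial>M)"
    proof (intro Bochner_Integration.integral_cong refl)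
      fix \<omega>
      have "complex_of_real (Im (V \<omega>)) = (- \<i>/2) * (V \<omega> - cnj (V \<omega>))" by (simp add: complex_eq_iff)
      then show "of_real (Im (V \<omega>)) * iexp (v * X \<omega>) = (- \<i>/2) * (V \<omega> * iexp (v * X \<omega>) - cnj (V \<omega>) * iexp (v * X \<omega>))"
        by (simp only: left_diff_distrib mult.assoc)
    qed
    also have "\<dots> = 0" using i[of v] 0[of v] c0[of v] by simp
    finally show ?thesis .
  qed
  then have im: "(\<integral>\<omega>. Im (V \<omega>) * indicator D (X \<omega>) \<partial>M) = 0"
    by (intro fourier_null_real[where C=C]) (auto intro: order_trans[OF abs_Im_le_cmod b])
  have iV: "integrable M (\<lambda>\<omega>. V \<omega> * indicator D (X \<omega>))"
    by (rule integrable_const_bound[of _ C]) (use b order_trans[OF norm_ge_zero b] in \<open>auto simp: indicator_def norm_mult\<close>)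
  have r: "Re (V \<omega> * indicator D (X \<omega>)) = Re (V \<omega>) * indicator D (X \<omega>)" "Im (V \<omega> * indicator D (X \<omega>)) = Im (V \<omega>) * indicator D (X \<omega>)" for \<omega>
    by (auto simp: indicator_def)
  show ?thesis
    by (rule complex_eqI) (simp_all only: integral_Re[OF iV, symmetric] integral_Im[OF iV, symmetric] r re im zero_complex.sel)
qed

lemma (in prob_space) fourier_null_finite:
  fixes X :: "'i \<Rightarrow> 'a \<Rightarrow> real"
  assumes "finite S" and X: "\<And>s. s \<in> S \<Longrightarrow> X s \<in> borel_measurable M"
    and V: "V \<in> borel_measurable M" and b: "\<And>\<omega>. cmod (V \<omega>) \<le> C"
    and 0: "\<And>v. (\<integral>\<omega>. V \<omega> * iexp (\<Sum>s\<in>S. v s * X s \<omega>) \<partial>M) = 0" and D: "\<And>s. s \<in> S \<Longrightarrow> D s \<in> sets borel"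
  shows "(\<integral>\<omega>. V \<omega> * (\<Prod>s\<in>S. indicator (D s) (X s \<omega>)) \<partial>M) = 0"
  using assms
proof (induction S arbitrary: V rule: finite_induct)
  case empty
  then show ?case by simp
next
  case (insert s S)
  have [measurable]: "X s \<in> borel_measurable M" "V \<in> borel_measurable M" "D s \<in> sets borel" using insert.prems by auto
  have "(\<lambda>\<omega>. indicator (D r) (X r \<omega>) :: complex) \<in> borel_measurable M" if "r \<in> S" for r
    using insert.prems(1)[of r] insert.prems(5)[of r] that by (auto intro: measurable_compose[of "X r"])
  then have p[measurable]: "(\<lambda>\<omega>. \<Prod>s\<in>S. indicator (D s) (X s \<omega>) :: complex) \<in> borel_measurable M"
    by (intro borel_measurable_prod) auto
  have p1: "cmod (\<Prod>s\<in>S. indicator (D s) (X s \<omega>)) \<le> 1" for \<omega>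
    unfolding prod_norm[symmetric] by (intro prod_le_1) (auto simp: indicator_def)
  have "(\<integral>\<omega>. (V \<omega> * (\<Prod>s\<in>S. indicator (D s) (X s \<omega>))) * iexp (v * X s \<omega>) \<partial>M) = 0" for v
  proof -
    \<comment> \<open>The frequency of the coordinate \<open>s\<close> is frozen and moved into the
      weight, which keeps the bound \<open>C\<close>; the update \<open>v'(s := v)\<close> recovers
      the hypothesis for all coordinates.\<close>
    have "(\<integral>\<omega>. (V \<omega> * iexp (v * X s \<omega>)) * (\<Prod>s\<in>S. indicator (D s) (X s \<omega>)) \<partial>M) = 0"
    proof (rule insert.IH)
      fix v'
      have "(\<integral>\<omega>. V \<omega> * iexp (\<Sum>r\<in>insert s S. (v'(s := v)) r * X r \<omega>) \<partial>M) = 0" by (rule insert.prems(4))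
      also have "(\<lambda>\<omega>. V \<omega> * iexp (\<Sum>r\<in>insert s S. (v'(s := v)) r * X r \<omega>)) = (\<lambda>\<omega>. V \<omega> * iexp (v * X s \<omega>) * iexp (\<Sum>r\<in>S. v' r * X r \<omega>))"
      proof
        fix \<omega>
        have "(\<Sum>r\<in>S. (v'(s := v)) r * X r \<omega>) = (\<Sum>r\<in>S. v' r * X r \<omega>)"
          using insert.hyps by (intro sum.cong) auto
        then show "V \<omega> * iexp (\<Sum>r\<in>insert s S. (v'(s := v)) r * X r \<omega>) = V \<omega> * iexp (v * X s \<omega>) * iexp (\<Sum>r\<in>S. v' r * X r \<omega>)"
          using insert.hyps by (simp add: mult.assoc exp_add[symmetric] distrib_left del: of_real_sum)
      qed
      finally show "(\<integral>\<omega>. V \<omega> * iexp (v * X s \<omega>) * iexp (\<Sum>r\<in>S. v' r * X r \<omega>) \<partial>M) = 0" .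
    qed (use insert.prems in \<open>auto simp: norm_mult\<close>)
    then show ?thesis by (simp add: mult_ac)
  qed
  then have "(\<integral>\<omega>. (V \<omega> * (\<Prod>s\<in>S. indicator (D s) (X s \<omega>))) * indicator (D s) (X s \<omega>) \<partial>M) = 0"
  proof (rule fourier_null[rotated 3])
    show "cmod (V \<omega> * (\<Prod>s\<in>S. indicator (D s) (X s \<omega>))) \<le> C" for \<omega>
      unfolding norm_mult using mult_mono[OF insert.prems(3)[of \<omega>] p1[of \<omega>]] order_trans[OF norm_ge_zero insert.prems(3)] by simp
  qed measurable
  then show ?case using insert.hyps by (simp add: mult_ac)
qed

context correlated_brownian_motions
begin

text \<open>Both exponents are rewritten over one grid containing \<open>g\<close>, \<open>S\<close>
  and 0, with \<open>Z s\<close> read as an increment from time 0, where \<open>Z\<close> vanishes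
  almost surely. On that grid the exponent of the joint characteristic function is a sum of a part
  in \<open>u'\<close> and a part in \<open>v'\<close>, so the function factors.\<close>

lemma joint_char_factor:
  assumes g: "\<And>i. i < m \<Longrightarrow> g i < g (Suc i)" "0 \<le> g 0" "g m \<le> T"
    and S: "finite S" "S \<subseteq> {0..T}"
  shows "(\<integral>\<omega>. iexp (\<Sum>i<m. u i * (incr Bp g i \<omega>)) * iexp (\<Sum>s\<in>S. v s * Z s \<omega>) \<partial>M)
    = of_real (exp (- (\<Sum>i<m. (1 - \<rho>\<^sup>2) * (u i)\<^sup>2 / 2 * (gap g i)))) * (\<integral>\<omega>. iexp (\<Sum>s\<in>S. v s * Z s \<omega>) \<partial>M)"
proof -
  note gT = strict_grid_range[of m g T, OF g]
  define P where "P = insert 0 (S \<union> g ` {..m})"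
  have P: "finite P" "P \<noteq> {}" "P \<subseteq> {0..T}" using S gT T by (auto simp: P_def)
  obtain \<gamma> N where \<gamma>: "\<And>i. i < N \<Longrightarrow> \<gamma> i < \<gamma> (Suc i)" and im: "\<gamma> ` {..N::nat} = P"
    using finite_strict_enumeration[OF P(1,2)] by blast
  define idx where "idx p = (SOME i. i \<le> N \<and> \<gamma> i = p)" for p
  have idx: "idx p \<le> N" "\<gamma> (idx p) = p" if "p \<in> P" for p
  proof -
    have "\<exists>i. i \<le> N \<and> \<gamma> i = p" using that im by force
    from someI_ex[OF this] show "idx p \<le> N" "\<gamma> (idx p) = p" unfolding idx_def by auto
  qed
  have idx_less: "idx p < idx q" if "p \<in> P" "q \<in> P" "p < q" for p q
  proof (rule ccontr)
    assume "\<not> idx p < idx q"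
    then have "\<gamma> (idx q) \<le> \<gamma> (idx p)" using strict_grid_le[of N \<gamma> "idx q" "idx p"] \<gamma> idx(1)[OF that(1)] by auto
    then show False using idx that by auto
  qed
  have \<gamma>0: "\<gamma> 0 = 0"
  proof -
    have "\<gamma> 0 \<in> P" using im by auto
    moreover have "\<gamma> 0 \<le> \<gamma> (idx 0)" using strict_grid_le[of N \<gamma> 0 "idx 0"] \<gamma> idx(1)[of 0] by (auto simp: P_def)
    ultimately show ?thesis using idx(2)[of 0] P by (force simp: P_def)
  qed
  have \<gamma>N: "\<gamma> N \<le> T" using im P by auto
  define a where "a i = idx (g i)" for i
  define u' where "u' j = (\<Sum>i<m. u i * (if a i \<le> j \<and> j < a (Suc i) then 1 else 0))" for j
  define v' where "v' j = (\<Sum>s\<in>S. v s * (if j < idx s then 1 else 0))" for j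
  have U: "(\<Sum>i<m. u i * (f (g (Suc i)) - f (g i))) = (\<Sum>j<N. u' j * (f (\<gamma> (Suc j)) - f (\<gamma> j)))" for f :: "real \<Rightarrow> real"
  proof -
    have "(\<Sum>i<m. u i * (f (g (Suc i)) - f (g i))) =
      (\<Sum>i<m. u i * (\<Sum>j<N. (if a i \<le> j \<and> j < a (Suc i) then 1 else 0) * (f (\<gamma> (Suc j)) - f (\<gamma> j))))"
    proof (rule sum.cong[OF refl])
      fix i assume i: "i \<in> {..<m}"
      then have gi: "g i \<in> P" "g (Suc i) \<in> P" by (auto simp: P_def)
      have "a i \<le> a (Suc i)" "a (Suc i) \<le> N"
        unfolding a_def using idx_less[OF gi] idx(1) gi g(1)[of i] i by (auto intro: less_imp_le)
      from sum_indicator_increments[OF this, of "\<lambda>j. f (\<gamma> j)"]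
      show "u i * (f (g (Suc i)) - f (g i)) = u i * (\<Sum>j<N. (if a i \<le> j \<and> j < a (Suc i) then 1 else 0) * (f (\<gamma> (Suc j)) - f (\<gamma> j)))"
        using idx(2) gi by (simp add: a_def)
    qed
    also have "\<dots> = (\<Sum>j<N. u' j * (f (\<gamma> (Suc j)) - f (\<gamma> j)))"
      unfolding u'_def sum_distrib_left sum_distrib_right by (subst sum.swap) (simp add: mult.assoc)
    finally show ?thesis .
  qed
  have Vs: "(\<Sum>s\<in>S. v s * (f s - f 0)) = (\<Sum>j<N. v' j * (f (\<gamma> (Suc j)) - f (\<gamma> j)))" for f :: "real \<Rightarrow> real"
  proof -
    have "(\<Sum>s\<in>S. v s * (f s - f 0)) = (\<Sum>s\<in>S. v s * (\<Sum>j<N. (if j < idx s then 1 else 0) * (f (\<gamma> (Suc j)) - f (\<gamma> j))))"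
    proof (rule sum.cong[OF refl])
      fix s assume "s \<in> S"
      then have s: "s \<in> P" by (simp add: P_def)
      show "v s * (f s - f 0) = v s * (\<Sum>j<N. (if j < idx s then 1 else 0) * (f (\<gamma> (Suc j)) - f (\<gamma> j)))"
        using sum_indicator_increments[of 0 "idx s" N "\<lambda>j. f (\<gamma> j)"] idx[OF s] \<gamma>0 by simp
    qed
    also have "\<dots> = (\<Sum>j<N. v' j * (f (\<gamma> (Suc j)) - f (\<gamma> j)))"
      unfolding v'_def sum_distrib_left sum_distrib_right by (subst sum.swap) (simp add: mult.assoc)
    finally show ?thesis .
  qed
  define A where "A \<omega> = (\<Sum>i<m. u i * (incr Bp g i \<omega>))" for \<omega>
  define B where "B \<omega> = (\<Sum>s\<in>S. v s * Z s \<omega>)" for \<omega>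
  define B' where "B' \<omega> = (\<Sum>s\<in>S. v s * (Z s \<omega> - Z 0 \<omega>))" for \<omega>
  have [measurable]: "Z s \<in> borel_measurable M" "Bp s \<in> borel_measurable M" if "s \<in> {0..T}" for s
    using that by (auto intro: Z_measurable Bp_measurable)
  have mA[measurable]: "A \<in> borel_measurable M" unfolding A_def[abs_def]
    using gT by (intro borel_measurable_sum borel_measurable_times borel_measurable_diff Bp_measurable) auto
  have mB[measurable]: "B \<in> borel_measurable M" "B' \<in> borel_measurable M" unfolding B_def[abs_def] B'_def[abs_def]
    using S T by (auto intro!: borel_measurable_sum borel_measurable_times borel_measurable_diff Z_measurable)
  have AE0: "AE \<omega> in M. B \<omega> = B' \<omega>"
  proof -
    have "AE \<omega> in M. Z 0 \<omega> = 0" using Z by (simp add: brownian_motion_def)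
    then show ?thesis by (auto simp: B_def B'_def elim!: eventually_mono)
  qed
  \<comment> \<open>The scalars \<open>x\<close> and \<open>y\<close> are set to 0 or 1, so that the
    joint and both marginal characteristic functions come from one formula.\<close>
  have comb: "(\<integral>\<omega>. iexp (x * A \<omega> + y * B' \<omega>) \<partial>M) =
      of_real (exp (- (\<Sum>j<N. ((1 - \<rho>\<^sup>2) * (x * u' j)\<^sup>2 + (y * v' j)\<^sup>2) / 2 * (gap \<gamma> j))))" for x y
  proof -
    have "x * A \<omega> + y * B' \<omega> = (\<Sum>j<N. (x * u' j) * (incr Bp \<gamma> j \<omega>) + (y * v' j) * (incr Z \<gamma> j \<omega>))" for \<omega>
      unfolding A_def B'_def U[of "\<lambda>t. Bp t \<omega>"] Vs[of "\<lambda>t. Z t \<omega>"]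
      by (simp add: sum.distrib sum_distrib_left mult.assoc)
    then show ?thesis
      using joint_char_grid[of N \<gamma> "\<lambda>j. x * u' j" "\<lambda>j. y * v' j"] \<gamma> \<gamma>0 \<gamma>N by simp
  qed
  have "(\<integral>\<omega>. iexp (A \<omega>) * iexp (B \<omega>) \<partial>M) = (\<integral>\<omega>. iexp (1 * A \<omega> + 1 * B' \<omega>) \<partial>M)"
    using AE0 by (intro integral_cong_AE) (auto elim!: eventually_mono simp: exp_add distrib_left)
  also have "\<dots> = of_real (exp (- (\<Sum>j<N. ((1 - \<rho>\<^sup>2) * (1 * u' j)\<^sup>2 + (0 * v' j)\<^sup>2) / 2 * (gap \<gamma> j))))
     * of_real (exp (- (\<Sum>j<N. ((1 - \<rho>\<^sup>2) * (0 * u' j)\<^sup>2 + (1 * v' j)\<^sup>2) / 2 * (gap \<gamma> j))))"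
  proof -
    have "((1 - \<rho>\<^sup>2) * (1 * u' j)\<^sup>2 + (0 * v' j)\<^sup>2) / 2 * d + ((1 - \<rho>\<^sup>2) * (0 * u' j)\<^sup>2 + (1 * v' j)\<^sup>2) / 2 * d =
      ((1 - \<rho>\<^sup>2) * (1 * u' j)\<^sup>2 + (1 * v' j)\<^sup>2) / 2 * d" for j and d :: real
      by (simp add: add_divide_distrib distrib_right)
    then show ?thesis
      unfolding comb of_real_mult[symmetric] exp_add[symmetric] minus_add_distrib[symmetric] sum.distrib[symmetric]
      by (simp only:)
  qed
  also have "\<dots> = (\<integral>\<omega>. iexp (A \<omega>) \<partial>M) * (\<integral>\<omega>. iexp (B' \<omega>) \<partial>M)"
    unfolding comb[symmetric] by simp
  also have "(\<integral>\<omega>. iexp (B' \<omega>) \<partial>M) = (\<integral>\<omega>. iexp (B \<omega>) \<partial>M)"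
    using AE0 by (intro integral_cong_AE) (auto elim!: eventually_mono)
  also have "(\<integral>\<omega>. iexp (A \<omega>) \<partial>M) = of_real (exp (- (\<Sum>i<m. (1 - \<rho>\<^sup>2) * (u i)\<^sup>2 / 2 * (gap g i))))"
    using joint_char_grid[of m g u "\<lambda>_. 0"] g by (simp add: A_def)
  finally show ?thesis by (simp only: A_def B_def)
qed

end

section \<open>From finitely many values of \<open>Z\<close> to the whole of
  \<open>FZ\<close>\<close>

lemma borel_measurable_iexp:
  "f \<in> borel_measurable N \<Longrightarrow> (\<lambda>\<omega>. iexp (f \<omega>)) \<in> borel_measurable N"
  by measurable

lemma borel_measurable_of_real_exp:
  "f \<in> borel_measurable N \<Longrightarrow> (\<lambda>\<omega>. complex_of_real (exp (- f \<omega>))) \<in> borel_measurable N"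
  by measurable

context correlated_brownian_motions
begin

abbreviation FZ :: "'a measure" where "FZ \<equiv> augmented_natural_filtration M Z T"

lemma space_FZ: "space FZ = space M"
  by (simp add: augmented_natural_filtration_def space_measure_of_conv)

lemma sets_FZ: "sets FZ = sigma_sets (space M) ({Z s -` A \<inter> space M | s A. s \<in> {0..T} \<and> A \<in> sets borel} \<union> null_sets M)"
  unfolding augmented_natural_filtration_def
  by (rule sets_measure_of) (auto simp: null_sets_def dest: sets.sets_into_space)

lemma sets_FZ_subset: "sets FZ \<subseteq> sets M"
  unfolding sets_FZ
proof (rule sets.sigma_sets_subset, safe)
  fix s :: real and A :: "real set" assume "s \<in> {0..T}" "A \<in> sets borel"
  then show "Z s -` A \<inter> space M \<in> sets M" by (intro measurable_sets[OF Z_measurable]) auto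
qed auto

lemma subalgebra_FZ: "subalgebra M FZ"
  using sets_FZ_subset by (simp add: subalgebra_def space_FZ)

definition cylinder :: "real set \<Rightarrow> (real \<Rightarrow> real set) \<Rightarrow> 'a set" where
  "cylinder S D = {\<omega>\<in>space M. \<forall>s\<in>S. Z s \<omega> \<in> D s}"

definition cylinders :: "'a set set" where
  "cylinders = {cylinder S D | S D. finite S \<and> S \<subseteq> {0..T} \<and> (\<forall>s. D s \<in> sets borel)}"

lemma cylinders_sets: "cylinders \<subseteq> sets M"
proof
  fix A assume "A \<in> cylinders"
  then obtain S D where A: "A = cylinder S D" and S: "finite S" "S \<subseteq> {0..T}" "\<And>s. D s \<in> sets borel"
    by (auto simp: cylinders_def)
  have "{\<omega>\<in>space M. Z s \<omega> \<in> D s} \<in> sets M" if "s \<in> S" for s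
    using measurable_sets[OF Z_measurable S(3), of s s] that S by (auto simp: vimage_def Int_def conj_commute)
  then show "A \<in> sets M" unfolding A cylinder_def using S(1) by (intro sets.sets_Collect_finite_All) auto
qed

text \<open>Two cylinders over different finite sets of times are brought to the union of these sets
  by imposing \<open>UNIV\<close> where a constraint is missing. Null sets absorb
  intersections.\<close>

lemma Int_stable_cylinders: "Int_stable (cylinders \<union> null_sets M)"
proof (rule Int_stableI)
  fix A B assume AB: "A \<in> cylinders \<union> null_sets M" "B \<in> cylinders \<union> null_sets M"
  show "A \<inter> B \<in> cylinders \<union> null_sets M"
  proof (cases "A \<in> null_sets M \<or> B \<in> null_sets M")
    case True
    then show ?thesis using AB cylinders_sets by (auto intro: null_set_Int1 null_set_Int2)
  next
    case False
    then obtain S D S' D' where A: "A = cylinder S D" "finite S" "S \<subseteq> {0..T}" "\<And>s. D s \<in> sets borel"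
      and B: "B = cylinder S' D'" "finite S'" "S' \<subseteq> {0..T}" "\<And>s. D' s \<in> sets borel"
      using AB by (auto simp: cylinders_def)
    have eq: "A \<inter> B = cylinder (S \<union> S') (\<lambda>s. (if s \<in> S then D s else UNIV) \<inter> (if s \<in> S' then D' s else UNIV))"
      unfolding A B cylinder_def by auto
    have "A \<inter> B \<in> cylinders"
      unfolding cylinders_def by (rule CollectI, intro exI conjI, rule eq) (use A B in auto)
    then show ?thesis by simp
  qed
qed

lemma sets_FZ_cylinders: "sets FZ \<subseteq> sigma_sets (space M) (cylinders \<union> null_sets M)"
  unfolding sets_FZ
proof (rule sigma_sets_mono', safe)
  fix s :: real and A :: "real set" assume s: "s \<in> {0..T}" and A: "A \<in> sets borel" and n: "Z s -` A \<inter> space M \<notin> null_sets M"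
  have "Z s -` A \<inter> space M = cylinder {s} (\<lambda>_. A)" by (auto simp: cylinder_def)
  then show "Z s -` A \<inter> space M \<in> cylinders" using s A unfolding cylinders_def by blast
qed

text \<open>Conditionally on \<open>FZ\<close> the increments of \<open>Bp\<close> keep their
  characteristic function. The integral vanishes on cylinders by the Fourier argument and on null
  sets trivially; the sets on which it vanishes form a Dynkin system, and cylinders with null sets
  are an intersection-stable generator.\<close>

lemma joint_char_event:
  assumes g: "\<And>i. i < m \<Longrightarrow> g i < g (Suc i)" "0 \<le> g 0" "g m \<le> T" and E: "E \<in> sets FZ"
  shows "(LINT \<omega>:E|M. iexp (\<Sum>i<m. u i * (incr Bp g i \<omega>))
    - of_real (exp (- (\<Sum>i<m. (1 - \<rho>\<^sup>2) * (u i)\<^sup>2 / 2 * (gap g i))))) = 0"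
proof -
  define c where "c = exp (- (\<Sum>i<m. (1 - \<rho>\<^sup>2) * (u i)\<^sup>2 / 2 * (gap g i)))"
  define A where "A \<omega> = (\<Sum>i<m. u i * (incr Bp g i \<omega>))" for \<omega>
  define V where "V \<omega> = iexp (A \<omega>) - of_real c" for \<omega>
  note gT = strict_grid_range[of m g T, OF g]
  have [measurable]: "A \<in> borel_measurable M" unfolding A_def[abs_def]
    using gT by (intro borel_measurable_sum borel_measurable_times borel_measurable_diff Bp_measurable) auto
  have V[measurable]: "V \<in> borel_measurable M" unfolding V_def by measurable
  have V2: "cmod (V \<omega>) \<le> 1 + c" for \<omega>
    using norm_triangle_ineq4[of "iexp (A \<omega>)" "of_real c"] by (simp add: V_def c_def)
  have Vi: "integrable M V" by (rule integrable_const_bound[of _ "1 + c"]) (use V2 in auto)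
  have char0: "(\<integral>\<omega>. V \<omega> * iexp (\<Sum>s\<in>S. v s * Z s \<omega>) \<partial>M) = 0" if S: "finite S" "S \<subseteq> {0..T}" for S v
  proof -
    define B where "B \<omega> = (\<Sum>s\<in>S. v s * Z s \<omega>)" for \<omega>
    have [measurable]: "B \<in> borel_measurable M" unfolding B_def[abs_def]
      using S by (intro borel_measurable_sum borel_measurable_times Z_measurable) auto
    have "(\<integral>\<omega>. V \<omega> * iexp (B \<omega>) \<partial>M) = (\<integral>\<omega>. iexp (A \<omega>) * iexp (B \<omega>) - of_real c * iexp (B \<omega>) \<partial>M)"
      by (simp add: V_def algebra_simps)
    also have "\<dots> = (\<integral>\<omega>. iexp (A \<omega>) * iexp (B \<omega>) \<partial>M) - of_real c * (\<integral>\<omega>. iexp (B \<omega>) \<partial>M)"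
    proof -
      have "integrable M (\<lambda>\<omega>. iexp (A \<omega>) * iexp (B \<omega>))"
        by (rule integrable_const_bound[of _ 1]) (auto simp: norm_mult)
      moreover have "integrable M (\<lambda>\<omega>. iexp (B \<omega>))" by (rule integrable_const_bound[of _ 1]) auto
      ultimately show ?thesis by (subst Bochner_Integration.integral_diff) auto
    qed
    also have "\<dots> = 0"
      using joint_char_factor[of m g S u v] g S by (simp only: A_def B_def c_def diff_self simp_thms)
    finally show ?thesis by (simp only: B_def)
  qed
  have "E \<in> sigma_sets (space M) (cylinders \<union> null_sets M)" using E sets_FZ_cylinders by auto
  moreover have "cylinders \<union> null_sets M \<subseteq> Pow (space M)"
    using cylinders_sets by (auto dest: sets.sets_into_space)
  ultimately have "Int_stable (cylinders \<union> null_sets M)" "cylinders \<union> null_sets M \<subseteq> Pow (space M)"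
    "E \<in> sigma_sets (space M) (cylinders \<union> null_sets M)"
    using Int_stable_cylinders by blast+
  then have "E \<in> sets M \<and> (LINT \<omega>:E|M. V \<omega>) = 0"
  proof (induction rule: sigma_sets_induct_disjoint[consumes 3])
    case (basic A)
    show ?case
    proof (cases "A \<in> null_sets M")
      case True
      then have "AE \<omega> in M. \<omega> \<notin> A" by (rule AE_not_in)
      then have "(LINT \<omega>:A|M. V \<omega>) = (\<integral>\<omega>. 0 \<partial>M)"
        unfolding set_lebesgue_integral_def using True by (intro integral_cong_AE) (auto elim!: eventually_mono)
      then show ?thesis using True by auto
    next
      case False
      then have Ac: "A \<in> cylinders" using basic by auto
      then obtain S D where A: "A = cylinder S D" "finite S" "S \<subseteq> {0..T}" "\<And>s. D s \<in> sets borel"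
        by (auto simp: cylinders_def)
      have "(\<integral>\<omega>. V \<omega> * (\<Prod>s\<in>S. indicator (D s) (Z s \<omega>)) \<partial>M) = 0"
        using A(2-4) by (intro fourier_null_finite[OF _ _ V V2 char0] Z_measurable) auto
      moreover have "indicator A \<omega> *\<^sub>R V \<omega> = V \<omega> * (\<Prod>s\<in>S. indicator (D s) (Z s \<omega>))" if "\<omega> \<in> space M" for \<omega>
        using A(2) that by (auto simp: A(1) cylinder_def indicator_def intro!: prod.neutral)
      ultimately have "(LINT \<omega>:A|M. V \<omega>) = 0" unfolding set_lebesgue_integral_def
        by (subst Bochner_Integration.integral_cong[OF refl]) auto
      then show ?thesis using Ac cylinders_sets by auto
    qed
  next
    case empty
    then show ?case by (simp add: set_lebesgue_integral_def)
  next
    case (compl A)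
    then have A: "A \<in> sets M" by simp
    have "(LINT \<omega>:space M|M. V \<omega>) = (LINT \<omega>:A \<union> (space M - A)|M. V \<omega>)"
      using sets.sets_into_space[OF A] by (intro arg_cong[where f="\<lambda>A. set_lebesgue_integral M A V"]) auto
    also have "\<dots> = (LINT \<omega>:A|M. V \<omega>) + (LINT \<omega>:space M - A|M. V \<omega>)"
      using A Vi by (intro set_integral_Un) (auto simp: set_integrable_def intro: integrable_mult_indicator)
    finally have "(LINT \<omega>:space M|M. V \<omega>) = (LINT \<omega>:A|M. V \<omega>) + (LINT \<omega>:space M - A|M. V \<omega>)" .
    \<comment> \<open>The empty set of times gives the total integral, which is what closure under
      complements requires.\<close>
    moreover have "(LINT \<omega>:space M|M. V \<omega>) = 0"
      using char0[of "{}"] by (simp add: set_integral_space[OF Vi])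
    ultimately show ?case using compl sets.compl_sets[OF A] by simp
  next
    case (union A)
    then have A: "A i \<in> sets M" "(LINT \<omega>:A i|M. V \<omega>) = 0" for i by auto
    have "(LINT \<omega>:\<Union>(range A)|M. V \<omega>) = (\<Sum>i. LINT \<omega>:A i|M. V \<omega>)"
      using A union(1) Vi
      by (intro lebesgue_integral_countable_add) (auto simp: set_integrable_def disjoint_family_on_def intro!: integrable_mult_indicator)
    then show ?case using A by auto
  qed
  then show ?thesis by (simp add: V_def A_def c_def)
qed

text \<open>The component \<open>x m\<close> is not a coefficient of an increment: it is the phase of a further \<open>FZ\<close>-measurable factor.\<close>

lemma joint_char_random_simple:
  fixes x :: "'a \<Rightarrow> nat \<Rightarrow> real"
  assumes g: "\<And>i. i < m \<Longrightarrow> g i < g (Suc i)" "0 \<le> g 0" "g m \<le> T"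
    and fin: "finite (x ` space M)" and x: "\<And>y. {\<omega>\<in>space M. x \<omega> = y} \<in> sets FZ"
  shows "(\<integral>\<omega>. iexp ((\<Sum>i<m. x \<omega> i * (incr Bp g i \<omega>)) + x \<omega> m) \<partial>M)
    = (\<integral>\<omega>. of_real (exp (- (\<Sum>i<m. (1 - \<rho>\<^sup>2) * (x \<omega> i)\<^sup>2 / 2 * (gap g i)))) * iexp (x \<omega> m) \<partial>M)"
proof -
  note gT = strict_grid_range[of m g T, OF g]
  define c where "c y = exp (- (\<Sum>i<m. (1 - \<rho>\<^sup>2) * (y i)\<^sup>2 / 2 * (gap g i)))" for y :: "nat \<Rightarrow> real"
  define A where "A y \<omega> = (\<Sum>i<m. y i * (incr Bp g i \<omega>))" for \<omega> and y :: "nat \<Rightarrow> real"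
  define R where "R = x ` space M"
  define E where "E y = {\<omega>\<in>space M. x \<omega> = y}" for y
  have EM[measurable]: "E y \<in> sets M" for y using x sets_FZ_subset by (auto simp: E_def)
  have Am[measurable]: "A y \<in> borel_measurable M" for y unfolding A_def[abs_def]
    using gT by (intro borel_measurable_sum borel_measurable_times borel_measurable_diff Bp_measurable) auto
  have iA: "integrable M (\<lambda>\<omega>. indicator (E y) \<omega> *\<^sub>R iexp (A y \<omega> + y m))" for y
    by (rule integrable_const_bound[of _ 1]) (auto simp: indicator_def)
  have ic: "integrable M (\<lambda>\<omega>. indicator (E y) \<omega> *\<^sub>R (of_real (c y) * iexp (y m)))" for y
    by (rule integrable_const_bound[of _ "c y"]) (auto simp: indicator_def norm_mult c_def)
  \<comment> \<open>On the event \<open>E y\<close>, which lies in \<open>FZ\<close>, the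
    coefficients equal the constants \<open>y\<close>, so the previous lemma applies event by
    event.\<close>
  have eq: "(\<integral>\<omega>. indicator (E y) \<omega> *\<^sub>R iexp (A y \<omega> + y m) \<partial>M) = (\<integral>\<omega>. indicator (E y) \<omega> *\<^sub>R (of_real (c y) * iexp (y m)) \<partial>M)" for y
  proof -
    have "(\<integral>\<omega>. indicator (E y) \<omega> *\<^sub>R iexp (A y \<omega> + y m) \<partial>M) - (\<integral>\<omega>. indicator (E y) \<omega> *\<^sub>R (of_real (c y) * iexp (y m)) \<partial>M)
      = (\<integral>\<omega>. indicator (E y) \<omega> *\<^sub>R iexp (A y \<omega> + y m) - indicator (E y) \<omega> *\<^sub>R (of_real (c y) * iexp (y m)) \<partial>M)"
      by (rule Bochner_Integration.integral_diff[OF iA ic, symmetric])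
    also have "\<dots> = (\<integral>\<omega>. iexp (y m) * (indicator (E y) \<omega> *\<^sub>R (iexp (A y \<omega>) - of_real (c y))) \<partial>M)"
      by (intro Bochner_Integration.integral_cong refl) (simp add: exp_add distrib_left right_diff_distrib scaleR_conv_of_real mult_ac)
    also have "\<dots> = iexp (y m) * (LINT \<omega>:E y|M. iexp (A y \<omega>) - of_real (c y))"
      by (simp only: set_lebesgue_integral_def integral_mult_right_zero)
    also have "\<dots> = 0"
      using joint_char_event[of m g "E y" y] g x by (simp add: E_def A_def c_def)
    finally show ?thesis by simp
  qed
  have split: "f (x \<omega>) \<omega> = (\<Sum>y\<in>R. indicator (E y) \<omega> *\<^sub>R f y \<omega>)" if "\<omega> \<in> space M" for \<omega> and f :: "(nat \<Rightarrow> real) \<Rightarrow> 'a \<Rightarrow> complex"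
  proof -
    have "(\<Sum>y\<in>R. indicator (E y) \<omega> *\<^sub>R f y \<omega>) = (\<Sum>y\<in>{x \<omega>}. f y \<omega>)"
      using fin that by (intro sum.mono_neutral_cong_right) (auto simp: R_def E_def indicator_def)
    then show ?thesis by simp
  qed
  have "(\<integral>\<omega>. iexp (A (x \<omega>) \<omega> + x \<omega> m) \<partial>M) = (\<integral>\<omega>. (\<Sum>y\<in>R. indicator (E y) \<omega> *\<^sub>R iexp (A y \<omega> + y m)) \<partial>M)"
    by (intro Bochner_Integration.integral_cong refl split)
  also have "\<dots> = (\<Sum>y\<in>R. \<integral>\<omega>. indicator (E y) \<omega> *\<^sub>R iexp (A y \<omega> + y m) \<partial>M)"
    by (rule Bochner_Integration.integral_sum) (rule iA)
  also have "\<dots> = (\<Sum>y\<in>R. \<integral>\<omega>. indicator (E y) \<omega> *\<^sub>R (of_real (c y) * iexp (y m)) \<partial>M)" by (simp only: eq)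
  also have "\<dots> = (\<integral>\<omega>. (\<Sum>y\<in>R. indicator (E y) \<omega> *\<^sub>R (of_real (c y) * iexp (y m))) \<partial>M)"
    by (rule Bochner_Integration.integral_sum[symmetric]) (rule ic)
  also have "\<dots> = (\<integral>\<omega>. of_real (c (x \<omega>)) * iexp (x \<omega> m) \<partial>M)"
    by (intro Bochner_Integration.integral_cong refl split[symmetric])
  finally show ?thesis by (simp only: A_def c_def)
qed

text \<open>Coefficients measurable with respect to \<open>FZ\<close> are pointwise limits of simple
  functions. Both integrands have modulus at most 1, the right one because
  \<open>\<rho>^2 \<le> 1\<close>, so dominated convergence carries the identity over.\<close>

lemma joint_char_random:
  assumes g: "\<And>i. i < m \<Longrightarrow> g i < g (Suc i)" "0 \<le> g 0" "g m \<le> T"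
    and a: "\<And>i. i \<le> m \<Longrightarrow> a i \<in> borel_measurable FZ"
  shows "(\<integral>\<omega>. iexp ((\<Sum>i<m. a i \<omega> * (incr Bp g i \<omega>)) + a m \<omega>) \<partial>M)
    = (\<integral>\<omega>. of_real (exp (- (\<Sum>i<m. (1 - \<rho>\<^sup>2) * (a i \<omega>)\<^sup>2 / 2 * (gap g i)))) * iexp (a m \<omega>) \<partial>M)"
proof -
  note gT = strict_grid_range[of m g T, OF g]
  have \<rho>2: "\<rho>\<^sup>2 \<le> 1" using \<rho> by (simp add: abs_square_le_1)
  have aM: "a i \<in> borel_measurable M" if "i \<le> m" for i
    by (rule measurable_from_subalg[OF subalgebra_FZ a[OF that]])
  have BM: "(\<lambda>\<omega>. incr Bp g i \<omega>) \<in> borel_measurable M" if "i < m" for i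
    using gT that by (intro borel_measurable_diff Bp_measurable) auto
  have "\<exists>s. (\<forall>k. simple_function FZ (s k)) \<and> (\<forall>\<omega>\<in>space M. (\<lambda>k. s k \<omega>) \<longlonglongrightarrow> a i \<omega>)" if "i \<le> m" for i
    using borel_measurable_implies_sequence_metric[OF a[OF that], of 0] by (auto simp: space_FZ)
  then obtain s where s: "\<And>i k. i \<le> m \<Longrightarrow> simple_function FZ (s i k)"
    and lim: "\<And>i \<omega>. i \<le> m \<Longrightarrow> \<omega> \<in> space M \<Longrightarrow> (\<lambda>k. s i k \<omega>) \<longlonglongrightarrow> a i \<omega>"
    by metis
  have sM: "s i k \<in> borel_measurable M" if "i \<le> m" for i k
    by (rule measurable_from_subalg[OF subalgebra_FZ borel_measurable_simple_function[OF s[OF that]]])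
  \<comment> \<open>The value 0 beyond \<open>m\<close> makes \<open>x k\<close> a function with
    finitely many values among all sequences.\<close>
  define x where "x k \<omega> i = (if i \<le> m then s i k \<omega> else 0)" for k \<omega> i
  define \<Phi> where "\<Phi> y \<omega> = iexp ((\<Sum>i<m. y i * (incr Bp g i \<omega>)) + y m)" for y :: "nat \<Rightarrow> real" and \<omega>
  define \<Psi> where "\<Psi> y = complex_of_real (exp (- (\<Sum>i<m. (1 - \<rho>\<^sup>2) * (y i)\<^sup>2 / 2 * (gap g i)))) * iexp (y m)" for y :: "nat \<Rightarrow> real"
  have \<Phi>1: "cmod (\<Phi> y \<omega>) \<le> 1" for y \<omega> by (simp add: \<Phi>_def)
  have \<Psi>1: "cmod (\<Psi> y) \<le> 1" for y
  proof -
    have "0 \<le> (\<Sum>i<m. (1 - \<rho>\<^sup>2) * (y i)\<^sup>2 / 2 * (gap g i))"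
      using g \<rho>2 by (intro sum_nonneg mult_nonneg_nonneg divide_nonneg_nonneg) (auto intro: less_imp_le)
    then show ?thesis by (simp add: \<Psi>_def norm_mult del: of_real_exp of_real_minus of_real_sum)
  qed
  have step: "(\<integral>\<omega>. \<Phi> (x k \<omega>) \<omega> \<partial>M) = (\<integral>\<omega>. \<Psi> (x k \<omega>) \<partial>M)" for k
    unfolding \<Phi>_def \<Psi>_def
  proof (rule joint_char_random_simple[OF g])
    have "x k ` space M \<subseteq> (\<lambda>f i. if i \<le> m then f i else 0) ` (Pi\<^sub>E {..m} (\<lambda>i. s i k ` space M))"
    proof safe
      fix \<omega> assume "\<omega> \<in> space M"
      then show "x k \<omega> \<in> (\<lambda>f i. if i \<le> m then f i else 0) ` (Pi\<^sub>E {..m} (\<lambda>i. s i k ` space M))"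
        by (intro image_eqI[of _ _ "\<lambda>i\<in>{..m}. s i k \<omega>"]) (auto simp: x_def fun_eq_iff)
    qed
    moreover have "finite (Pi\<^sub>E {..m} (\<lambda>i. s i k ` space M))"
      using s by (intro finite_PiE) (auto simp: simple_function_def space_FZ)
    ultimately show "finite (x k ` space M)" using finite_subset by blast
    fix y
    have "{\<omega>\<in>space FZ. s i k \<omega> = y i} \<in> sets FZ" if "i \<in> {..m}" for i
    proof -
      have [measurable]: "s i k \<in> borel_measurable FZ" using s[of i k] that by (auto intro: borel_measurable_simple_function)
      show ?thesis by measurable
    qed
    then have "{\<omega>\<in>space FZ. \<forall>i\<in>{..m}. s i k \<omega> = y i} \<in> sets FZ" by (intro sets.sets_Collect_finite_All) auto
    moreover have "{\<omega>\<in>space M. x k \<omega> = y} = (if \<forall>i>m. y i = 0 then {\<omega>\<in>space FZ. \<forall>i\<in>{..m}. s i k \<omega> = y i} else {})"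
    proof (cases "\<forall>i>m. y i = 0")
      case False
      then obtain i where i: "m < i" "y i \<noteq> 0" by auto
      then have "x k \<omega> \<noteq> y" for \<omega> by (auto simp: x_def dest: fun_cong[of _ _ i])
      then show ?thesis using i by auto
    qed (auto simp: x_def fun_eq_iff space_FZ not_le)
    ultimately show "{\<omega>\<in>space M. x k \<omega> = y} \<in> sets FZ" by auto
  qed auto
  have "(\<lambda>k. \<integral>\<omega>. \<Phi> (x k \<omega>) \<omega> \<partial>M) \<longlonglongrightarrow> (\<integral>\<omega>. \<Phi> (\<lambda>i. a i \<omega>) \<omega> \<partial>M)"
  proof (rule integral_dominated_convergence[where w="\<lambda>_. 1"])
    show "(\<lambda>\<omega>. \<Phi> (\<lambda>i. a i \<omega>) \<omega>) \<in> borel_measurable M" unfolding \<Phi>_def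
      by (intro borel_measurable_iexp borel_measurable_times borel_measurable_const borel_measurable_of_real
          borel_measurable_add borel_measurable_sum BM aM) auto
    show "(\<lambda>\<omega>. \<Phi> (x k \<omega>) \<omega>) \<in> borel_measurable M" for k unfolding \<Phi>_def
      by (intro borel_measurable_iexp borel_measurable_times borel_measurable_const borel_measurable_of_real
          borel_measurable_add borel_measurable_sum BM) (auto simp: x_def sM)
    show "AE \<omega> in M. (\<lambda>k. \<Phi> (x k \<omega>) \<omega>) \<longlonglongrightarrow> \<Phi> (\<lambda>i. a i \<omega>) \<omega>"
      by (rule AE_I2) (auto simp: \<Phi>_def x_def intro!: tendsto_intros lim)
  qed (use \<Phi>1 in auto)
  moreover have "(\<lambda>k. \<integral>\<omega>. \<Psi> (x k \<omega>) \<partial>M) \<longlonglongrightarrow> (\<integral>\<omega>. \<Psi> (\<lambda>i. a i \<omega>) \<partial>M)"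
  proof (rule integral_dominated_convergence[where w="\<lambda>_. 1"])
    show "(\<lambda>\<omega>. \<Psi> (\<lambda>i. a i \<omega>)) \<in> borel_measurable M" unfolding \<Psi>_def
      by (intro borel_measurable_iexp borel_measurable_of_real_exp borel_measurable_times borel_measurable_const borel_measurable_of_real
          borel_measurable_sum borel_measurable_uminus borel_measurable_divide borel_measurable_power aM) auto
    show "(\<lambda>\<omega>. \<Psi> (x k \<omega>)) \<in> borel_measurable M" for k unfolding \<Psi>_def
      by (intro borel_measurable_iexp borel_measurable_of_real_exp borel_measurable_times borel_measurable_const borel_measurable_of_real
          borel_measurable_sum borel_measurable_uminus borel_measurable_divide borel_measurable_power) (auto simp: x_def sM)
    show "AE \<omega> in M. (\<lambda>k. \<Psi> (x k \<omega>)) \<longlonglongrightarrow> \<Psi> (\<lambda>i. a i \<omega>)"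
      by (rule AE_I2) (auto simp: \<Psi>_def x_def intro!: tendsto_intros lim)
  qed (use \<Psi>1 in auto)
  ultimately have "(\<integral>\<omega>. \<Phi> (\<lambda>i. a i \<omega>) \<omega> \<partial>M) = (\<integral>\<omega>. \<Psi> (\<lambda>i. a i \<omega>) \<partial>M)"
    unfolding step by (rule LIMSEQ_unique)
  then show ?thesis by (simp only: \<Phi>_def \<Psi>_def)
qed

end

section \<open>The law of the limit\<close>

lemma (in prob_space) AE_tendsto_0_imp_prob:
  fixes D :: "nat \<Rightarrow> 'a \<Rightarrow> real"
  assumes [measurable]: "\<And>k. D k \<in> borel_measurable M" and lim: "AE \<omega> in M. (\<lambda>k. D k \<omega>) \<longlonglongrightarrow> 0" and e: "0 < e"
  shows "(\<lambda>k. prob {\<omega>\<in>space M. e < D k \<omega>}) \<longlonglongrightarrow> 0"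
proof -
  have "(\<lambda>k. \<integral>\<omega>. indicator {\<omega>\<in>space M. e < D k \<omega>} \<omega> \<partial>M) \<longlonglongrightarrow> (\<integral>\<omega>. 0 \<partial>M :: real)"
  proof (rule integral_dominated_convergence[where w="\<lambda>_. 1"])
    show "AE \<omega> in M. (\<lambda>k. indicator {\<omega>\<in>space M. e < D k \<omega>} \<omega> :: real) \<longlonglongrightarrow> 0"
      using lim
    proof eventually_elim
      case (elim \<omega>)
      have "\<forall>\<^sub>F k in sequentially. D k \<omega> < e" using order_tendstoD(2)[OF elim e] .
      then have "\<forall>\<^sub>F k in sequentially. indicator {\<omega>\<in>space M. e < D k \<omega>} \<omega> = (0::real)"
        by eventually_elim auto
      then show ?case by (rule tendsto_eventually)
    qed
  qed (auto simp: indicator_def)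
  then show ?thesis by simp
qed

text \<open>The bound 2 is used where \<open>D k\<close> exceeds a threshold and the Lipschitz bound
  elsewhere, so convergence of \<open>D k\<close> in probability suffices.\<close>

lemma (in prob_space) expectation_tendsto_0:
  fixes f :: "nat \<Rightarrow> 'a \<Rightarrow> complex" and D :: "nat \<Rightarrow> 'a \<Rightarrow> real"
  assumes [measurable]: "\<And>k. f k \<in> borel_measurable M" "\<And>k. D k \<in> borel_measurable M"
    and f2: "\<And>k \<omega>. cmod (f k \<omega>) \<le> 2" and fD: "\<And>k \<omega>. cmod (f k \<omega>) \<le> c * \<bar>D k \<omega>\<bar>" and c: "0 \<le> c"
    and D: "\<And>e. 0 < e \<Longrightarrow> (\<lambda>k. prob {\<omega>\<in>space M. e < \<bar>D k \<omega>\<bar>}) \<longlonglongrightarrow> 0"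
  shows "(\<lambda>k. \<integral>\<omega>. f k \<omega> \<partial>M) \<longlonglongrightarrow> 0"
proof (rule LIMSEQ_I)
  fix r :: real assume r: "0 < r"
  \<comment> \<open>The summand 1 in the denominator gives \<open>c * e < r / 2\<close> and covers
    \<open>c = 0\<close> as well.\<close>
  define e where "e = r / (2 * (c + 1))"
  have e: "0 < e" "c * e < r / 2" using r c by (auto simp: e_def field_simps)
  have bound: "cmod (\<integral>\<omega>. f k \<omega> \<partial>M) \<le> 2 * prob {\<omega>\<in>space M. e < \<bar>D k \<omega>\<bar>} + c * e" for k
  proof -
    have fi: "integrable M (f k)" by (rule integrable_const_bound[of _ 2]) (use f2 in auto)
    have "cmod (\<integral>\<omega>. f k \<omega> \<partial>M) \<le> (\<integral>\<omega>. cmod (f k \<omega>) \<partial>M)" by (rule integral_norm_bound)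
    also have "\<dots> \<le> (\<integral>\<omega>. 2 * indicator {\<omega>\<in>space M. e < \<bar>D k \<omega>\<bar>} \<omega> + c * e \<partial>M)"
    proof (rule integral_mono)
      show "integrable M (\<lambda>\<omega>. 2 * indicator {\<omega>\<in>space M. e < \<bar>D k \<omega>\<bar>} \<omega> + c * e)"
        by (rule integrable_const_bound[of _ "2 + c * e"]) (use c e in \<open>auto simp: indicator_def\<close>)
      fix \<omega> assume \<omega>: "\<omega> \<in> space M"
      show "cmod (f k \<omega>) \<le> 2 * indicator {\<omega>\<in>space M. e < \<bar>D k \<omega>\<bar>} \<omega> + c * e"
      proof (cases "e < \<bar>D k \<omega>\<bar>")
        case True then show ?thesis using f2[of k \<omega>] c e \<omega> by (simp add: add_increasing2)
      next
        case False
        then have "c * \<bar>D k \<omega>\<bar> \<le> c * e" using c by (intro mult_left_mono) auto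
        then show ?thesis using fD[of k \<omega>] False by simp
      qed
    qed (use fi in simp)
    also have "\<dots> = 2 * prob {\<omega>\<in>space M. e < \<bar>D k \<omega>\<bar>} + c * e"
    proof -
      have "integrable M (indicator {\<omega>\<in>space M. e < \<bar>D k \<omega>\<bar>} :: 'a \<Rightarrow> real)"
        by (rule integrable_const_bound[of _ 1]) (auto simp: indicator_def)
      then show ?thesis by (subst Bochner_Integration.integral_add) (auto simp: prob_space)
    qed
    finally show ?thesis .
  qed
  have "\<forall>\<^sub>F k in sequentially. prob {\<omega>\<in>space M. e < \<bar>D k \<omega>\<bar>} < r / 4"
    using order_tendstoD(2)[OF D[OF e(1)], of "r/4"] r by simp
  then have "\<forall>\<^sub>F k in sequentially. norm ((\<integral>\<omega>. f k \<omega> \<partial>M) - 0) < r"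
  proof eventually_elim
    case (elim k)
    then show ?case using bound[of k] e by simp
  qed
  then show "\<exists>no. \<forall>n\<ge>no. norm ((\<integral>\<omega>. f n \<omega> \<partial>M) - 0) < r"
    by (simp add: eventually_sequentially)
qed

lemma cmod_iexp_diff_le: "cmod (iexp a - iexp b) \<le> \<bar>a - b\<bar>"
proof -
  have "iexp a - iexp b = iexp b * (iexp (a - b) - 1)"
    by (simp add: right_diff_distrib exp_add[symmetric])
  then have "cmod (iexp a - iexp b) = cmod (iexp (a - b) - 1)" by (simp add: norm_mult)
  also have "\<dots> \<le> \<bar>a - b\<bar>" using iexp_approx1[of "a - b" 0] by simp
  finally show ?thesis .
qed

lemma cmod_iexp_diff_le_2: "cmod (iexp a - iexp b) \<le> 2"
  using norm_triangle_ineq4[of "iexp a" "iexp b"] by simp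

section \<open>Approximation along a sequence of grids\<close>

locale bm_grids = correlated_brownian_motions +
  fixes \<gamma> :: "nat \<Rightarrow> nat \<Rightarrow> real" and m :: "nat \<Rightarrow> nat" and \<eta> :: "nat \<Rightarrow> real"
  assumes grid: "i < m k \<Longrightarrow> \<gamma> k i < \<gamma> k (Suc i)" "\<gamma> k 0 = 0" "\<gamma> k (m k) \<le> T"
    and mesh: "i < m k \<Longrightarrow> gap (\<gamma> k) i \<le> \<eta> k" "0 \<le> \<eta> k" "\<eta> \<longlonglongrightarrow> 0"
begin

lemma grid_range: "i \<le> m k \<Longrightarrow> 0 \<le> \<gamma> k i \<and> \<gamma> k i \<le> T"
  using strict_grid_le[of "m k" "\<gamma> k" 0 i] strict_grid_le[of "m k" "\<gamma> k" i "m k"] grid(1)[of _ k] grid(2,3)[of k] by auto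

lemma grid_increments:
  assumes B: "brownian_motion M T F B"
  shows "normal_increments M (\<lambda>i. F (\<gamma> k i)) (\<lambda>i. gap (\<gamma> k) i) (\<lambda>i \<omega>. incr B (\<gamma> k) i \<omega>) (m k)"
proof (unfold_locales)
  fix i assume i: "i < m k"
  have r: "0 \<le> \<gamma> k i" "\<gamma> k i < \<gamma> k (Suc i)" "\<gamma> k (Suc i) \<le> T"
    using grid_range[of i k] grid_range[of "Suc i" k] grid(1)[OF i] i by auto
  show "indep_normal M (F (\<gamma> k i)) (gap (\<gamma> k) i) (\<lambda>\<omega>. incr B (\<gamma> k) i \<omega>)"
    by (rule incr_indep_normal[OF r B])
  show "subalgebra (F (\<gamma> k (Suc i))) (F (\<gamma> k i))" using r by (intro filtration_mono) auto
  have "B (\<gamma> k (Suc i)) \<in> borel_measurable (F (\<gamma> k (Suc i)))" "B (\<gamma> k i) \<in> borel_measurable (F (\<gamma> k i))"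
    using B r by (auto simp: brownian_motion_def adapted_def)
  then show "(\<lambda>\<omega>. incr B (\<gamma> k) i \<omega>) \<in> borel_measurable (F (\<gamma> k (Suc i)))"
    using r measurable_F_mono[of "\<gamma> k i" "\<gamma> k (Suc i)"] by (intro borel_measurable_diff) auto
qed (use grid_range in \<open>auto intro: sub\<close>)

text \<open>The order of choices is essential, as the Gronwall factor grows exponentially in
  \<open>K^2\<close>: first \<open>K\<close>, uniformly in \<open>k\<close>, then
  \<open>\<delta>\<close> depending on \<open>K\<close>, and only then is \<open>k\<close> sent to
  infinity.\<close>

lemma comparison_limit:
  fixes y \<xi> :: "nat \<Rightarrow> nat \<Rightarrow> 'a \<Rightarrow> real" and x0 :: real and B :: "real \<Rightarrow> 'a \<Rightarrow> real"
  assumes B: "brownian_motion M T F B"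
    and y: "\<And>k i. i < m k \<Longrightarrow> y k i \<in> borel_measurable (F (\<gamma> k i))"
    and \<xi>: "\<And>k i. i < m k \<Longrightarrow> \<xi> k i \<in> borel_measurable (F (\<gamma> k i))"
    and S: "\<And>k i \<omega>. S k i \<omega> = x0 + (\<Sum>j<i. \<xi> k j \<omega> * (incr B (\<gamma> k) j \<omega>))"
    and bdd: "AE \<omega> in M. \<exists>K. \<forall>k. \<forall>i<m k. \<bar>y k i \<omega>\<bar> \<le> K"
    and H: "AE \<omega> in M. (\<lambda>k. \<Sum>i<m k. (\<xi> k i \<omega> - y k i \<omega> * S k i \<omega>)\<^sup>2 * (gap (\<gamma> k) i)) \<longlonglongrightarrow> 0"
    and e: "0 < e"
  shows "(\<lambda>k. prob {\<omega>\<in>space M. e < \<bar>S k (m k) \<omega> - x0 * exp (\<Sum>j<m k. y k j \<omega> * (incr B (\<gamma> k) j \<omega>)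
     - (y k j \<omega>)\<^sup>2 * (gap (\<gamma> k) j) / 2)\<bar>}) \<longlonglongrightarrow> 0" (is "(\<lambda>k. prob (?D k)) \<longlonglongrightarrow> 0")
proof (rule LIMSEQ_I)
  fix r :: real assume r: "0 < r"
  have yM: "y k i \<in> borel_measurable M" and \<xi>M: "\<xi> k i \<in> borel_measurable M" if "i < m k" for k i
    using grid_range[of i k] that by (auto intro!: measurable_from_subalg[OF sub] y \<xi>)
  have BM: "B (\<gamma> k i) \<in> borel_measurable M" if "i \<le> m k" for k i
    using grid_range[of i k] that by (auto intro: bm_measurable[OF B])
  have SM: "S k i \<in> borel_measurable M" if "i \<le> m k" for k i
    unfolding S[abs_def] using that
    by (intro borel_measurable_add borel_measurable_const borel_measurable_sum borel_measurable_times borel_measurable_diff \<xi>M BM) auto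
  define h where "h k \<omega> = (\<Sum>i<m k. (\<xi> k i \<omega> - y k i \<omega> * S k i \<omega>)\<^sup>2 * (gap (\<gamma> k) i))" for k \<omega>
  have hM: "h k \<in> borel_measurable M" for k
    unfolding h_def[abs_def]
    by (intro borel_measurable_sum borel_measurable_times borel_measurable_power borel_measurable_diff borel_measurable_const \<xi>M yM SM) auto
  \<comment> \<open>The union over all \<open>k\<close> gives a cut-off level common to all grids;
    these sets decrease to a null set because almost every path is bounded.\<close>
  define A where "A K = (\<Union>k. \<Union>i\<in>{..<m k}. {\<omega>\<in>space M. real K < \<bar>y k i \<omega>\<bar>})" for K :: nat
  have AM: "A K \<in> events" for K
  proof -
    have "{\<omega>\<in>space M. real K < \<bar>y k i \<omega>\<bar>} \<in> events" if "i < m k" for k i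
      using yM[OF that] by measurable
    then show ?thesis unfolding A_def by (intro sets.countable_UN sets.finite_UN) auto
  qed
  have "(\<lambda>K. prob (A K)) \<longlonglongrightarrow> prob (\<Inter>K. A K)"
  proof (rule finite_Lim_measure_decseq)
    show "range A \<subseteq> events" using AM by auto
    show "decseq A" by (intro decseq_SucI) (force simp: A_def)
  qed
  moreover have "prob (\<Inter>K. A K) = 0"
  proof -
    have "AE \<omega> in M. \<omega> \<notin> (\<Inter>K. A K)"
      using bdd
    proof eventually_elim
      case (elim \<omega>)
      then obtain K where K: "\<And>k i. i < m k \<Longrightarrow> \<bar>y k i \<omega>\<bar> \<le> K" by auto
      obtain n :: nat where "K \<le> real n" using real_arch_simple by blast
      then have "\<omega> \<notin> A n" using K by (fastforce simp: A_def)
      then show ?case by auto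
    qed
    then show ?thesis using AM by (subst prob_eq_0) auto
  qed
  ultimately have "(\<lambda>K. prob (A K)) \<longlonglongrightarrow> 0" by simp
  from order_tendstoD(2)[OF this, of "r/4"] r obtain K where K: "prob (A K) < r / 4"
    by (auto simp: eventually_sequentially)
  define E where "E = exp (2 * (real K)\<^sup>2 * T)"
  define C where "C = (real K)^4 * exp ((real K)\<^sup>2 * T) * (x0\<^sup>2 * exp ((real K)\<^sup>2 * T))"
  \<comment> \<open>Chosen so that the contribution \<open>E * (2 * \<delta>) / e^2\<close> of the
    defect equals \<open>r / 8\<close>; with three further terms below \<open>r / 4\<close> the
    total stays below \<open>r\<close>.\<close>
  define \<delta> where "\<delta> = r * e\<^sup>2 / (16 * E)"
  have \<delta>: "0 < \<delta>" using r e by (simp add: \<delta>_def E_def)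
  have "(\<lambda>k. prob {\<omega>\<in>space M. \<delta> < h k \<omega>}) \<longlonglongrightarrow> 0"
    using AE_tendsto_0_imp_prob[of h, OF hM _ \<delta>] H unfolding h_def by simp
  then have ev1: "\<forall>\<^sub>F k in sequentially. prob {\<omega>\<in>space M. \<delta> < h k \<omega>} < r / 4"
    using r by (intro order_tendstoD(2)) auto
  have "(\<lambda>k. E * (C * \<eta> k * T) / e\<^sup>2) \<longlonglongrightarrow> E * (C * 0 * T) / e\<^sup>2"
    using e by (intro tendsto_intros mesh) auto
  then have ev2: "\<forall>\<^sub>F k in sequentially. E * (C * \<eta> k * T) / e\<^sup>2 < r / 4"
    using r by (intro order_tendstoD(2)) auto
  have bound: "prob (?D k) \<le> prob (A K) + prob {\<omega>\<in>space M. \<delta> < h k \<omega>} + (E * (C * \<eta> k * T) / e\<^sup>2 + r / 8)" for k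
  proof -
    interpret G: normal_increments M "\<lambda>i. F (\<gamma> k i)" "\<lambda>i. gap (\<gamma> k) i" "\<lambda>i \<omega>. incr B (\<gamma> k) i \<omega>" "m k"
      by (rule grid_increments[OF B])
    have "prob {\<omega>\<in>space M. e < \<bar>S k (m k) \<omega> - G.wexp x0 (y k) (m k) \<omega>\<bar>} \<le>
       prob {\<omega>\<in>space M. \<exists>i<m k. real K < \<bar>y k i \<omega>\<bar>}
       + prob {\<omega>\<in>space M. \<delta> < (\<Sum>i<m k. (\<xi> k i \<omega> - y k i \<omega> * S k i \<omega>)\<^sup>2 * (gap (\<gamma> k) i))}
       + err_bound x0 (real K) T (\<eta> k) \<delta> / e\<^sup>2"
    proof (rule G.wexp_comparison)
      have "(\<Sum>i<m k. gap (\<gamma> k) i) = \<gamma> k (m k) - \<gamma> k 0" by (rule sum_lessThan_telescope)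
      then show "(\<Sum>i<m k. gap (\<gamma> k) i) \<le> T" using grid(2,3)[of k] by simp
    qed (use y \<xi> mesh T e \<delta> in \<open>auto simp: S\<close>)
    moreover have "prob {\<omega>\<in>space M. \<exists>i<m k. real K < \<bar>y k i \<omega>\<bar>} \<le> prob (A K)"
      using AM by (intro finite_measure_mono) (auto simp: A_def)
    moreover have "err_bound x0 (real K) T (\<eta> k) \<delta> / e\<^sup>2 = E * (C * \<eta> k * T) / e\<^sup>2 + r / 8"
    proof -
      have "E \<noteq> 0" by (simp add: E_def)
      then have "E * (2 * \<delta>) / e\<^sup>2 = r / 8" using e by (simp add: \<delta>_def field_simps)
      moreover have "err_bound x0 (real K) T (\<eta> k) \<delta> = E * (2 * \<delta> + C * \<eta> k * T)"
        by (simp only: err_bound_def E_def C_def)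
      ultimately show ?thesis by (simp add: distrib_left add_divide_distrib)
    qed
    ultimately show ?thesis unfolding G.wexp_def h_def by simp
  qed
  have "\<forall>\<^sub>F k in sequentially. norm (prob (?D k) - 0) < r"
    using ev1 ev2
  proof eventually_elim
    case (elim k)
    have "0 \<le> prob (?D k)" by simp
    then show ?case using bound[of k] elim K r unfolding diff_zero real_norm_def by linarith
  qed
  then show "\<exists>no. \<forall>k\<ge>no. norm (prob (?D k) - 0) < r" by (simp only: eventually_sequentially)
qed

end

text \<open>
  \<open>\<xi>\<close> and \<open>\<zeta>\<close> are the simple integrands approximating \<open>Y X\<close> and \<open>Y\<close>; \<open>X\<close>, \<open>I\<close>, \<open>A\<close> stand for \<open>X\<^sub>t\<close>, \<open>\<integral>\<^sub>0\<^sup>t Y dZ\<close>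
  and \<open>\<integral>\<^sub>0\<^sup>t Y\<^sup>2 du\<close>.
\<close>

locale sv_limit = bm_grids +
  fixes x0 :: real and X I A :: "'a \<Rightarrow> real" and Y :: "real \<Rightarrow> 'a \<Rightarrow> real"
    and \<xi> \<zeta> :: "nat \<Rightarrow> nat \<Rightarrow> 'a \<Rightarrow> real"
  assumes X_meas[measurable]: "X \<in> borel_measurable M" and I_meas[measurable]: "I \<in> borel_measurable M"
    and A_meas[measurable]: "A \<in> borel_measurable M" and A_nonneg: "0 \<le> A \<omega>"
    and Y_F: "0 \<le> s \<Longrightarrow> s \<le> T \<Longrightarrow> Y s \<in> borel_measurable (F s)"
    and Y_FZ: "0 \<le> s \<Longrightarrow> s \<le> T \<Longrightarrow> Y s \<in> borel_measurable FZ"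
    and Y_bdd: "AE \<omega> in M. \<exists>K. \<forall>s\<in>{0..T}. \<bar>Y s \<omega>\<bar> \<le> K"
    and \<xi>_meas: "i < m k \<Longrightarrow> \<xi> k i \<in> borel_measurable (F (\<gamma> k i))"
    and \<zeta>_meas: "i < m k \<Longrightarrow> \<zeta> k i \<in> borel_measurable (F (\<gamma> k i))"
    and X_lim: "AE \<omega> in M. (\<lambda>k. x0 + (\<Sum>j<m k. \<xi> k j \<omega> * (incr W (\<gamma> k) j \<omega>))) \<longlonglongrightarrow> X \<omega>"
    and X_err: "AE \<omega> in M. (\<lambda>k. \<Sum>i<m k. (\<xi> k i \<omega> - Y (\<gamma> k i) \<omega> * (x0 + (\<Sum>j<i. \<xi> k j \<omega> * (incr W (\<gamma> k) j \<omega>))))\<^sup>2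
         * (gap (\<gamma> k) i)) \<longlonglongrightarrow> 0"
    and I_lim: "AE \<omega> in M. (\<lambda>k. \<Sum>j<m k. \<zeta> k j \<omega> * (incr Z (\<gamma> k) j \<omega>)) \<longlonglongrightarrow> I \<omega>"
    and I_err: "AE \<omega> in M. (\<lambda>k. \<Sum>i<m k. (\<zeta> k i \<omega> - Y (\<gamma> k i) \<omega>)\<^sup>2 * (gap (\<gamma> k) i)) \<longlonglongrightarrow> 0"
    and A_lim: "AE \<omega> in M. (\<lambda>k. \<Sum>i<m k. (Y (\<gamma> k i) \<omega>)\<^sup>2 * (gap (\<gamma> k) i)) \<longlonglongrightarrow> A \<omega>"
begin

definition S :: "nat \<Rightarrow> nat \<Rightarrow> 'a \<Rightarrow> real" where
  "S k i \<omega> = x0 + (\<Sum>j<i. \<xi> k j \<omega> * (incr W (\<gamma> k) j \<omega>))"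

definition L :: "nat \<Rightarrow> 'a \<Rightarrow> real" where
  "L k \<omega> = (\<Sum>j<m k. Y (\<gamma> k j) \<omega> * (incr W (\<gamma> k) j \<omega>)
     - (Y (\<gamma> k j) \<omega>)\<^sup>2 * (gap (\<gamma> k) j) / 2)"

definition V :: "nat \<Rightarrow> 'a \<Rightarrow> real" where
  "V k \<omega> = (\<Sum>j<m k. (Y (\<gamma> k j) \<omega>)\<^sup>2 * (gap (\<gamma> k) j))"

text \<open>Two approximations of the integral of \<open>Y\<close> against \<open>Z\<close>.
  \<open>R\<close> has the integrand \<open>Y\<close> and is measurable with respect to
  \<open>FZ\<close>, as conditioning requires; \<open>Q\<close> below has the simple integrands and
  converges almost surely by the definition of the integral.\<close>

definition R :: "nat \<Rightarrow> 'a \<Rightarrow> real" where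
  "R k \<omega> = (\<Sum>j<m k. Y (\<gamma> k j) \<omega> * (incr Z (\<gamma> k) j \<omega>))"

definition Q :: "nat \<Rightarrow> 'a \<Rightarrow> real" where
  "Q k \<omega> = (\<Sum>j<m k. \<zeta> k j \<omega> * (incr Z (\<gamma> k) j \<omega>))"

lemma grid_measurable:
  assumes "i \<le> m k"
  shows "Y (\<gamma> k i) \<in> borel_measurable M" "W (\<gamma> k i) \<in> borel_measurable M" "Z (\<gamma> k i) \<in> borel_measurable M"
    "Y (\<gamma> k i) \<in> borel_measurable FZ" "Z (\<gamma> k i) \<in> borel_measurable FZ"
proof -
  have r: "0 \<le> \<gamma> k i" "\<gamma> k i \<le> T" using grid_range[OF assms] by auto
  show "Y (\<gamma> k i) \<in> borel_measurable M" by (rule measurable_from_subalg[OF sub[OF r] Y_F[OF r]])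
  show "W (\<gamma> k i) \<in> borel_measurable M" "Z (\<gamma> k i) \<in> borel_measurable M"
    using r by (auto intro: W_measurable Z_measurable)
  show "Y (\<gamma> k i) \<in> borel_measurable FZ" by (rule Y_FZ[OF r])
  show "Z (\<gamma> k i) \<in> borel_measurable FZ"
  proof (rule measurableI)
    fix D :: "real set" assume "D \<in> sets borel"
    then show "Z (\<gamma> k i) -` D \<inter> space FZ \<in> sets FZ"
      unfolding space_FZ sets_FZ using r by (intro sigma_sets.Basic UnI1) auto
  qed simp
qed

lemma coeff_measurable: "i < m k \<Longrightarrow> \<xi> k i \<in> borel_measurable M" "i < m k \<Longrightarrow> \<zeta> k i \<in> borel_measurable M"
  using grid_range[of i k] by (auto intro!: measurable_from_subalg[OF sub] \<xi>_meas \<zeta>_meas)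

lemma S_meas[measurable]: "S k (m k) \<in> borel_measurable M" and L_meas[measurable]: "L k \<in> borel_measurable M"
  and V_meas[measurable]: "V k \<in> borel_measurable M" and R_meas[measurable]: "R k \<in> borel_measurable M"
  and Q_meas[measurable]: "Q k \<in> borel_measurable M"
  unfolding S_def[abs_def] L_def[abs_def] V_def[abs_def] R_def[abs_def] Q_def[abs_def]
  by (auto intro!: borel_measurable_add borel_measurable_sum borel_measurable_times borel_measurable_diff
      borel_measurable_power borel_measurable_divide borel_measurable_const grid_measurable coeff_measurable)

text \<open>\<open>S\<close> converges to \<open>X\<close> by the definition of the Ito integral,
  and its coefficients are close to \<open>Y * S\<close>. It thus nearly solves the linear equation
  whose discrete solution is \<open>x0 * exp L\<close>, and the difference tends to 0 in
  probability.\<close>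

lemma char_X: "(\<lambda>k. \<integral>\<omega>. iexp (\<theta> * (x0 * exp (L k \<omega>))) \<partial>M) \<longlonglongrightarrow> (\<integral>\<omega>. iexp (\<theta> * X \<omega>) \<partial>M)"
proof -
  have "(\<lambda>k. \<integral>\<omega>. iexp (\<theta> * S k (m k) \<omega>) \<partial>M) \<longlonglongrightarrow> (\<integral>\<omega>. iexp (\<theta> * X \<omega>) \<partial>M)"
  proof (rule integral_dominated_convergence[where w="\<lambda>_. 1"])
    show "AE \<omega> in M. (\<lambda>k. iexp (\<theta> * S k (m k) \<omega>)) \<longlonglongrightarrow> iexp (\<theta> * X \<omega>)"
      using X_lim[folded S_def] by eventually_elim (auto intro!: tendsto_intros)
  qed auto
  moreover have "(\<lambda>k. \<integral>\<omega>. iexp (\<theta> * (x0 * exp (L k \<omega>))) - iexp (\<theta> * S k (m k) \<omega>) \<partial>M) \<longlonglongrightarrow> 0"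
  proof (rule expectation_tendsto_0[where c="\<bar>\<theta>\<bar>" and D="\<lambda>k \<omega>. S k (m k) \<omega> - x0 * exp (L k \<omega>)"])
    show "cmod (iexp (\<theta> * (x0 * exp (L k \<omega>))) - iexp (\<theta> * S k (m k) \<omega>)) \<le> \<bar>\<theta>\<bar> * \<bar>S k (m k) \<omega> - x0 * exp (L k \<omega>)\<bar>" for k \<omega>
      using cmod_iexp_diff_le[of "\<theta> * (x0 * exp (L k \<omega>))" "\<theta> * S k (m k) \<omega>"]
      by (simp only: abs_mult[symmetric] right_diff_distrib abs_minus_commute)
    show "(\<lambda>k. prob {\<omega>\<in>space M. e < \<bar>S k (m k) \<omega> - x0 * exp (L k \<omega>)\<bar>}) \<longlonglongrightarrow> 0" if e: "0 < e" for e
      unfolding L_def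
    proof (rule comparison_limit[OF W _ \<xi>_meas S_def _ _ e])
      show "Y (\<gamma> k i) \<in> borel_measurable (F (\<gamma> k i))" if "i < m k" for k i
        using grid_range[of i k] that by (auto intro: Y_F)
      show "AE \<omega> in M. \<exists>K. \<forall>k. \<forall>i<m k. \<bar>Y (\<gamma> k i) \<omega>\<bar> \<le> K"
        using Y_bdd
      proof eventually_elim
        case (elim \<omega>)
        then obtain K where "\<forall>s\<in>{0..T}. \<bar>Y s \<omega>\<bar> \<le> K" by auto
        then show ?case using grid_range by (intro exI[of _ K]) auto
      qed
    qed (use X_err in \<open>simp_all add: S_def\<close>)
    show "cmod (iexp (\<theta> * (x0 * exp (L k \<omega>))) - iexp (\<theta> * S k (m k) \<omega>)) \<le> 2" for k \<omega>
      by (rule cmod_iexp_diff_le_2)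
  qed auto
  moreover have "(\<integral>\<omega>. iexp (\<theta> * (x0 * exp (L k \<omega>))) \<partial>M) = (\<integral>\<omega>. iexp (\<theta> * S k (m k) \<omega>) \<partial>M)
     + (\<integral>\<omega>. iexp (\<theta> * (x0 * exp (L k \<omega>))) - iexp (\<theta> * S k (m k) \<omega>) \<partial>M)" for k
    by (subst Bochner_Integration.integral_diff) (auto intro!: integrable_iexp)
  ultimately show ?thesis using tendsto_add by fastforce
qed

text \<open>Split each increment of \<open>W\<close> into one of \<open>Bp\<close> plus
  \<open>\<rho>\<close> times one of \<open>Z\<close>. Given \<open>FZ\<close>, the
  \<open>Bp\<close> part is Gaussian with variance \<open>(1 - \<rho>^2) * V\<close>; the rest,
  \<open>\<rho> * R - V / 2\<close>, is the phase in the component \<open>m k\<close>.\<close>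

lemma char_L_eq: "(\<integral>\<omega>. iexp (\<theta> * L k \<omega>) \<partial>M) =
   (\<integral>\<omega>. of_real (exp (- ((1 - \<rho>\<^sup>2) * \<theta>\<^sup>2 / 2 * V k \<omega>))) * iexp (\<theta> * (\<rho> * R k \<omega> - V k \<omega> / 2)) \<partial>M)"
proof -
  define a where "a i \<omega> = (if i < m k then \<theta> * Y (\<gamma> k i) \<omega> else \<theta> * (\<rho> * R k \<omega> - V k \<omega> / 2))" for i \<omega>
  have RV: "R k \<in> borel_measurable FZ" "V k \<in> borel_measurable FZ"
    unfolding R_def[abs_def] V_def[abs_def]
    by (auto intro!: borel_measurable_sum borel_measurable_times borel_measurable_diff
      borel_measurable_power borel_measurable_const grid_measurable)
  have e1: "(\<integral>\<omega>. iexp ((\<Sum>i<m k. a i \<omega> * (incr Bp (\<gamma> k) i \<omega>)) + a (m k) \<omega>) \<partial>M)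
    = (\<integral>\<omega>. of_real (exp (- (\<Sum>i<m k. (1 - \<rho>\<^sup>2) * (a i \<omega>)\<^sup>2 / 2 * (gap (\<gamma> k) i)))) * iexp (a (m k) \<omega>) \<partial>M)"
  proof (rule joint_char_random)
    show "a i \<in> borel_measurable FZ" if "i \<le> m k" for i
      using that RV by (cases "i < m k") (auto simp: a_def[abs_def] intro!: borel_measurable_times borel_measurable_diff borel_measurable_const grid_measurable)
  qed (use grid in auto)
  have e2: "(\<Sum>i<m k. a i \<omega> * (incr Bp (\<gamma> k) i \<omega>)) + a (m k) \<omega> = \<theta> * L k \<omega>" for \<omega>
  proof -
    have "\<theta> * L k \<omega> - \<theta> * (\<rho> * R k \<omega> - V k \<omega> / 2) = (\<Sum>i<m k. \<theta> * Y (\<gamma> k i) \<omega> * (incr Bp (\<gamma> k) i \<omega>))"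
      unfolding L_def R_def V_def sum_distrib_left sum_divide_distrib sum_subtractf[symmetric]
      by (intro sum.cong refl) (simp add: Bp_def algebra_simps)
    then show ?thesis by (simp add: a_def)
  qed
  have e3: "(\<Sum>i<m k. (1 - \<rho>\<^sup>2) * (a i \<omega>)\<^sup>2 / 2 * (gap (\<gamma> k) i)) = (1 - \<rho>\<^sup>2) * \<theta>\<^sup>2 / 2 * V k \<omega>" for \<omega>
    unfolding V_def sum_distrib_left by (intro sum.cong refl) (simp add: a_def power_mult_distrib)
  have am: "a (m k) \<omega> = \<theta> * (\<rho> * R k \<omega> - V k \<omega> / 2)" for \<omega> by (simp add: a_def)
  show ?thesis by (rule e1[unfolded e2 e3, unfolded am])
qed

text \<open>Almost sure convergence is at hand for \<open>Q\<close>, not for \<open>R\<close>, so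
  \<open>R\<close> is exchanged for \<open>Q\<close>. The prefactor \<open>c\<close> is bounded by
  1, and it remains that \<open>Q - R\<close> tends to 0 in probability.\<close>

lemma char_L_lim: "(\<lambda>k. \<integral>\<omega>. iexp (\<theta> * L k \<omega>) \<partial>M) \<longlonglongrightarrow>
   (\<integral>\<omega>. of_real (exp (- ((1 - \<rho>\<^sup>2) * \<theta>\<^sup>2 / 2 * A \<omega>))) * iexp (\<theta> * (\<rho> * I \<omega> - A \<omega> / 2)) \<partial>M)"
proof -
  have \<rho>2: "\<rho>\<^sup>2 \<le> 1" using \<rho> by (simp add: abs_square_le_1)
  have V0: "0 \<le> V k \<omega>" for k \<omega>
    unfolding V_def using grid(1) by (intro sum_nonneg mult_nonneg_nonneg) (auto intro: less_imp_le)
  define c where "c k \<omega> = exp (- ((1 - \<rho>\<^sup>2) * \<theta>\<^sup>2 / 2 * V k \<omega>))" for k \<omega>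
  have c1: "\<bar>c k \<omega>\<bar> \<le> 1" for k \<omega>
    using V0[of k \<omega>] \<rho>2 by (simp add: c_def)
  have [measurable]: "c k \<in> borel_measurable M" for k unfolding c_def[abs_def] by measurable
  have "(\<lambda>k. \<integral>\<omega>. of_real (c k \<omega>) * iexp (\<theta> * (\<rho> * Q k \<omega> - V k \<omega> / 2)) \<partial>M) \<longlonglongrightarrow>
     (\<integral>\<omega>. of_real (exp (- ((1 - \<rho>\<^sup>2) * \<theta>\<^sup>2 / 2 * A \<omega>))) * iexp (\<theta> * (\<rho> * I \<omega> - A \<omega> / 2)) \<partial>M)"
  proof (rule integral_dominated_convergence[where w="\<lambda>_. 1"])
    show "AE \<omega> in M. (\<lambda>k. of_real (c k \<omega>) * iexp (\<theta> * (\<rho> * Q k \<omega> - V k \<omega> / 2))) \<longlonglongrightarrow>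
      of_real (exp (- ((1 - \<rho>\<^sup>2) * \<theta>\<^sup>2 / 2 * A \<omega>))) * iexp (\<theta> * (\<rho> * I \<omega> - A \<omega> / 2))"
      using I_lim[folded Q_def] A_lim[folded V_def] by eventually_elim (auto simp: c_def intro!: tendsto_intros)
    show "AE \<omega> in M. norm (of_real (c k \<omega>) * iexp (\<theta> * (\<rho> * Q k \<omega> - V k \<omega> / 2))) \<le> 1" for k
      using c1 by (auto simp: norm_mult)
  qed auto
  moreover have "(\<lambda>k. \<integral>\<omega>. of_real (c k \<omega>) * iexp (\<theta> * (\<rho> * R k \<omega> - V k \<omega> / 2)) - of_real (c k \<omega>) * iexp (\<theta> * (\<rho> * Q k \<omega> - V k \<omega> / 2)) \<partial>M) \<longlonglongrightarrow> 0"
  proof (rule expectation_tendsto_0[where c="\<bar>\<theta> * \<rho>\<bar>" and D="\<lambda>k \<omega>. Q k \<omega> - R k \<omega>"])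
    have *: "cmod (of_real (c k \<omega>) * iexp a - of_real (c k \<omega>) * iexp b) \<le> cmod (iexp a - iexp b)" for k \<omega> a b
    proof -
      have "cmod (of_real (c k \<omega>) * iexp a - of_real (c k \<omega>) * iexp b) = \<bar>c k \<omega>\<bar> * cmod (iexp a - iexp b)"
        unfolding right_diff_distrib[symmetric] norm_mult by simp
      also have "\<dots> \<le> 1 * cmod (iexp a - iexp b)" using c1 by (intro mult_right_mono) auto
      finally show ?thesis by simp
    qed
    show "cmod (of_real (c k \<omega>) * iexp (\<theta> * (\<rho> * R k \<omega> - V k \<omega> / 2)) - of_real (c k \<omega>) * iexp (\<theta> * (\<rho> * Q k \<omega> - V k \<omega> / 2))) \<le> 2" for k \<omega>
      by (rule order_trans[OF * cmod_iexp_diff_le_2])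
    show "cmod (of_real (c k \<omega>) * iexp (\<theta> * (\<rho> * R k \<omega> - V k \<omega> / 2)) - of_real (c k \<omega>) * iexp (\<theta> * (\<rho> * Q k \<omega> - V k \<omega> / 2)))
       \<le> \<bar>\<theta> * \<rho>\<bar> * \<bar>Q k \<omega> - R k \<omega>\<bar>" for k \<omega>
    proof (rule order_trans[OF * order_trans[OF cmod_iexp_diff_le]])
      have "\<theta> * (\<rho> * R k \<omega> - V k \<omega> / 2) - \<theta> * (\<rho> * Q k \<omega> - V k \<omega> / 2) = - ((\<theta> * \<rho>) * (Q k \<omega> - R k \<omega>))"
        by (simp add: algebra_simps)
      then show "\<bar>\<theta> * (\<rho> * R k \<omega> - V k \<omega> / 2) - \<theta> * (\<rho> * Q k \<omega> - V k \<omega> / 2)\<bar> \<le> \<bar>\<theta> * \<rho>\<bar> * \<bar>Q k \<omega> - R k \<omega>\<bar>"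
        by (simp only: abs_minus_cancel abs_mult order_refl)
    qed
    show "(\<lambda>k. prob {\<omega>\<in>space M. e < \<bar>Q k \<omega> - R k \<omega>\<bar>}) \<longlonglongrightarrow> 0" if e: "0 < e" for e
    proof -
      \<comment> \<open>\<open>Q - R\<close> is a martingale transform with small integrand. The
        comparison lemma with \<open>y = 0\<close> and start 0 makes the exponential vanish, and
        what is left is exactly the statement that such a transform is small.\<close>
      define S' where "S' k i \<omega> = 0 + (\<Sum>j<i. (\<zeta> k j \<omega> - Y (\<gamma> k j) \<omega>) * (incr Z (\<gamma> k) j \<omega>))" for k i \<omega>
      have "(\<lambda>k. prob {\<omega>\<in>space M. e < \<bar>S' k (m k) \<omega> - 0 * exp (\<Sum>j<m k. 0 * (incr Z (\<gamma> k) j \<omega>)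
         - 0\<^sup>2 * (gap (\<gamma> k) j) / 2)\<bar>}) \<longlonglongrightarrow> 0"
      proof (rule comparison_limit[OF Z _ _ S'_def _ _ e, where y="\<lambda>_ _ _. 0"])
        show "(\<lambda>\<omega>. \<zeta> k i \<omega> - Y (\<gamma> k i) \<omega>) \<in> borel_measurable (F (\<gamma> k i))" if "i < m k" for k i
          using grid_range[of i k] that by (intro borel_measurable_diff \<zeta>_meas Y_F) auto
      qed (use I_err in auto)
      moreover have "S' k (m k) \<omega> - 0 * exp (\<Sum>j<m k. 0 * (incr Z (\<gamma> k) j \<omega>) - 0\<^sup>2 * (gap (\<gamma> k) j) / 2) = Q k \<omega> - R k \<omega>" for k \<omega>
        by (simp add: S'_def Q_def R_def left_diff_distrib sum_subtractf)
      ultimately show ?thesis by simp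
    qed
  qed auto
  moreover have "(\<integral>\<omega>. iexp (\<theta> * L k \<omega>) \<partial>M) = (\<integral>\<omega>. of_real (c k \<omega>) * iexp (\<theta> * (\<rho> * Q k \<omega> - V k \<omega> / 2)) \<partial>M)
     + (\<integral>\<omega>. of_real (c k \<omega>) * iexp (\<theta> * (\<rho> * R k \<omega> - V k \<omega> / 2)) - of_real (c k \<omega>) * iexp (\<theta> * (\<rho> * Q k \<omega> - V k \<omega> / 2)) \<partial>M)" for k
  proof -
    have "integrable M (\<lambda>\<omega>. of_real (c k \<omega>) * iexp (\<theta> * (\<rho> * U \<omega> - V k \<omega> / 2)))" if [measurable]: "U \<in> borel_measurable M" for U
      by (rule integrable_const_bound[of _ 1]) (use c1 in \<open>auto simp: norm_mult\<close>)
    then show ?thesis unfolding char_L_eq c_def[symmetric] by (subst Bochner_Integration.integral_diff) auto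
  qed
  ultimately show ?thesis using tendsto_add by fastforce
qed

text \<open>The independent standard normal variable lives on a second factor, since the given
  probability space may be too small to carry one.\<close>

definition log_law :: "real measure" where
  "log_law = distr (M \<Otimes>\<^sub>M std_normal_distribution) borel
     (\<lambda>(\<omega>, x). \<rho> * I \<omega> - A \<omega> / 2 + sqrt ((1 - \<rho>\<^sup>2) * A \<omega>) * x)"

lemma log_law_measurable[measurable]:
  "(\<lambda>(\<omega>, x). \<rho> * I \<omega> - A \<omega> / 2 + sqrt ((1 - \<rho>\<^sup>2) * A \<omega>) * x) \<in> borel_measurable (M \<Otimes>\<^sub>M std_normal_distribution)"
  by measurable

lemma real_distribution_log_law: "real_distribution log_law"
proof -
  interpret N: prob_space std_normal_distribution by (rule prob_space_normal_density) simp
  interpret P: pair_prob_space M std_normal_distribution ..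
  show ?thesis unfolding log_law_def by (rule P.real_distribution_distr) measurable
qed

lemma char_log_law: "char log_law \<theta> =
   (\<integral>\<omega>. of_real (exp (- ((1 - \<rho>\<^sup>2) * \<theta>\<^sup>2 / 2 * A \<omega>))) * iexp (\<theta> * (\<rho> * I \<omega> - A \<omega> / 2)) \<partial>M)"
proof -
  interpret N: prob_space std_normal_distribution by (rule prob_space_normal_density) simp
  interpret P: pair_prob_space M std_normal_distribution ..
  have \<rho>2: "\<rho>\<^sup>2 \<le> 1" using \<rho> by (simp add: abs_square_le_1)
  have "char log_law \<theta> = (\<integral>z. iexp (\<theta> * (\<lambda>(\<omega>, x). \<rho> * I \<omega> - A \<omega> / 2 + sqrt ((1 - \<rho>\<^sup>2) * A \<omega>) * x) z) \<partial>(M \<Otimes>\<^sub>M std_normal_distribution))"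
    unfolding char_def log_law_def by (subst integral_distr) auto
  also have "\<dots> = (\<integral>\<omega>. (\<integral>x. iexp (\<theta> * (\<rho> * I \<omega> - A \<omega> / 2 + sqrt ((1 - \<rho>\<^sup>2) * A \<omega>) * x)) \<partial>std_normal_distribution) \<partial>M)"
    by (subst P.integral_fst'[symmetric]) (auto intro!: P.integrable_iexp)
  also have "\<dots> = (\<integral>\<omega>. of_real (exp (- ((1 - \<rho>\<^sup>2) * \<theta>\<^sup>2 / 2 * A \<omega>))) * iexp (\<theta> * (\<rho> * I \<omega> - A \<omega> / 2)) \<partial>M)"
  proof (intro Bochner_Integration.integral_cong refl)
    fix \<omega>
    define s where "s = sqrt ((1 - \<rho>\<^sup>2) * A \<omega>)"
    have s2: "s\<^sup>2 = (1 - \<rho>\<^sup>2) * A \<omega>" using A_nonneg[of \<omega>] \<rho>2 by (simp add: s_def)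
    have "(\<integral>x. iexp (\<theta> * (\<rho> * I \<omega> - A \<omega> / 2 + s * x)) \<partial>std_normal_distribution)
      = (\<integral>x. iexp (\<theta> * (\<rho> * I \<omega> - A \<omega> / 2)) * iexp ((\<theta> * s) * x) \<partial>std_normal_distribution)"
      by (intro Bochner_Integration.integral_cong refl) (simp add: exp_add[symmetric] distrib_left mult.assoc)
    also have "\<dots> = iexp (\<theta> * (\<rho> * I \<omega> - A \<omega> / 2)) * char std_normal_distribution (\<theta> * s)"
      unfolding char_def by (rule integral_mult_right_zero)
    also have "char std_normal_distribution (\<theta> * s) = of_real (exp (- ((\<theta> * s)\<^sup>2 / 2)))"
      by (simp add: char_std_normal_distribution)
    also have "(\<theta> * s)\<^sup>2 / 2 = (1 - \<rho>\<^sup>2) * \<theta>\<^sup>2 / 2 * A \<omega>" by (simp add: power_mult_distrib s2)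
    finally show "(\<integral>x. iexp (\<theta> * (\<rho> * I \<omega> - A \<omega> / 2 + sqrt ((1 - \<rho>\<^sup>2) * A \<omega>) * x)) \<partial>std_normal_distribution)
      = of_real (exp (- ((1 - \<rho>\<^sup>2) * \<theta>\<^sup>2 / 2 * A \<omega>))) * iexp (\<theta> * (\<rho> * I \<omega> - A \<omega> / 2))"
      by (simp add: s_def mult.commute)
  qed
  finally show ?thesis .
qed

text \<open>By Levy's continuity theorem \<open>L k\<close> tends to \<open>log_law\<close> weakly.
  The function \<open>x0 * exp x\<close> is unbounded, but its composition with \<open>iexp\<close>
  is bounded and continuous, so it may be tested against this convergence; the same expectations
  tend to the characteristic function of \<open>X\<close>.\<close>

theorem law_X: "distr M borel X = distr log_law borel (\<lambda>x. x0 * exp x)"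
proof (rule Levy_uniqueness)
  interpret N: real_distribution log_law by (rule real_distribution_log_law)
  have [measurable]: "(\<lambda>x. x0 * exp x) \<in> borel_measurable log_law" by simp
  show "real_distribution (distr M borel X)" by (rule real_distribution_distr) measurable
  show "real_distribution (distr log_law borel (\<lambda>x. x0 * exp x))" by (rule N.real_distribution_distr) measurable
  have rL: "real_distribution (distr M borel (L k))" for k by (rule real_distribution_distr) measurable
  have "weak_conv_m (\<lambda>k. distr M borel (L k)) log_law"
  proof (rule levy_continuity[OF rL real_distribution_log_law])
    fix \<theta>
    have "char (distr M borel (L k)) \<theta> = (\<integral>\<omega>. iexp (\<theta> * L k \<omega>) \<partial>M)" for k
      unfolding char_def by (subst integral_distr) auto
    then show "(\<lambda>k. char (distr M borel (L k)) \<theta>) \<longlonglongrightarrow> char log_law \<theta>"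
      using char_L_lim[of \<theta>] by (simp add: char_log_law)
  qed
  then have wc: "(\<lambda>k. \<integral>x. iexp (\<theta> * (x0 * exp x)) \<partial>distr M borel (L k)) \<longlonglongrightarrow> (\<integral>x. iexp (\<theta> * (x0 * exp x)) \<partial>log_law)" for \<theta>
    by (intro weak_conv_imp_integral_bdd_continuous_conv[where B=1] rL real_distribution_log_law) auto
  show "char (distr M borel X) = char (distr log_law borel (\<lambda>x. x0 * exp x))"
  proof
    fix \<theta>
    have "(\<integral>x. iexp (\<theta> * (x0 * exp x)) \<partial>distr M borel (L k)) = (\<integral>\<omega>. iexp (\<theta> * (x0 * exp (L k \<omega>))) \<partial>M)" for k
      by (subst integral_distr) auto
    then have "(\<integral>\<omega>. iexp (\<theta> * X \<omega>) \<partial>M) = (\<integral>x. iexp (\<theta> * (x0 * exp x)) \<partial>log_law)"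
      using wc[of \<theta>] char_X[of \<theta>] by (auto intro: LIMSEQ_unique)
    moreover have "char (distr M borel X) \<theta> = (\<integral>\<omega>. iexp (\<theta> * X \<omega>) \<partial>M)"
      unfolding char_def by (subst integral_distr) auto
    moreover have "char (distr log_law borel (\<lambda>x. x0 * exp x)) \<theta> = (\<integral>x. iexp (\<theta> * (x0 * exp x)) \<partial>log_law)"
      unfolding char_def by (subst integral_distr) auto
    ultimately show "char (distr M borel X) \<theta> = char (distr log_law borel (\<lambda>x. x0 * exp x)) \<theta>" by simp
  qed
qed

end

section \<open>Common refinement of the grids\<close>

text \<open>The pieces are half-open, as are the intervals on which a simple process is constant;
  the induction starts with the remaining point \<open>\<gamma> 0\<close>.\<close>

lemma grid_set_integral:
  fixes f :: "real \<Rightarrow> real"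
  assumes g: "\<And>i. i < N \<Longrightarrow> \<gamma> i < \<gamma> (Suc i)"
    and f: "\<And>i. i < N \<Longrightarrow> set_integrable lborel {\<gamma> i<..\<gamma> (Suc i)} f" and k: "k \<le> N"
  shows "set_integrable lborel {\<gamma> 0..\<gamma> k} f \<and>
    (LINT s:{\<gamma> 0..\<gamma> k}|lborel. f s) = (\<Sum>i<k. LINT s:{\<gamma> i<..\<gamma> (Suc i)}|lborel. f s)"
  using k
proof (induction k)
  case 0
  have "(\<lambda>s. indicator {\<gamma> 0..\<gamma> 0} s *\<^sub>R f s) = (\<lambda>s. f (\<gamma> 0) * indicator {\<gamma> 0} s)"
    by (auto simp: indicator_def)
  then show ?case by (simp add: set_integrable_def set_lebesgue_integral_def)
next
  case (Suc k)
  have "\<gamma> 0 \<le> \<gamma> k" using strict_grid_le[of N \<gamma> 0 k] g Suc.prems by auto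
  then have eq: "{\<gamma> 0..\<gamma> (Suc k)} = {\<gamma> 0..\<gamma> k} \<union> {\<gamma> k<..\<gamma> (Suc k)}"
    using g[of k] Suc.prems by auto
  have i: "set_integrable lborel {\<gamma> 0..\<gamma> k} f" "set_integrable lborel {\<gamma> k<..\<gamma> (Suc k)} f"
    using Suc f[of k] by auto
  have "(LINT s:{\<gamma> 0..\<gamma> k} \<union> {\<gamma> k<..\<gamma> (Suc k)}|lborel. f s) = (LINT s:{\<gamma> 0..\<gamma> k}|lborel. f s) + (LINT s:{\<gamma> k<..\<gamma> (Suc k)}|lborel. f s)"
    by (rule set_integral_Un[OF _ i]) auto
  then show ?case
    unfolding eq using Suc set_integrable_Un[OF i] by simp
qed

lemma set_integrable_continuous_piece:
  fixes f :: "real \<Rightarrow> real"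
  assumes "continuous_on {0..T} f" "0 \<le> a" "b \<le> T"
  shows "set_integrable lborel {a<..b} f"
proof (rule set_integrable_subset)
  show "set_integrable lborel {a..b} f"
    using assms by (intro borel_integrable_atLeastAtMost') (auto elim: continuous_on_subset)
qed auto

lemma set_lebesgue_integral_const_Ioc:
  fixes c a b :: real
  assumes "a \<le> b"
  shows "set_integrable lborel {a<..b} (\<lambda>_. c)" "(LINT s:{a<..b}|lborel. c) = c * (b - a)"
  using assms by (auto simp: set_integrable_def set_lebesgue_integral_def)

text \<open>Integrate \<open>(x - c)^2 \<le> 2 * (\<psi> - \<phi>)^2 + 2 * (\<phi> - c)^2\<close>
  over each gap. The reference values \<open>c j\<close> are kept apart from
  \<open>\<phi> (\<gamma> j)\<close>: for \<open>X\<close> they contain the approximating sum in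
  place of its limit.\<close>

lemma grid_L2_error:
  fixes \<phi> \<psi> :: "real \<Rightarrow> real"
  assumes g: "\<And>i. i < N \<Longrightarrow> \<gamma> i < \<gamma> (Suc i)" "\<gamma> 0 = 0" "\<gamma> N = T" and \<phi>: "continuous_on {0..T} \<phi>"
    and \<psi>: "\<And>j s. j < N \<Longrightarrow> \<gamma> j < s \<Longrightarrow> s \<le> \<gamma> (Suc j) \<Longrightarrow> \<psi> s = x j"
    and c: "\<And>j s. j < N \<Longrightarrow> \<gamma> j \<le> s \<Longrightarrow> s \<le> \<gamma> (Suc j) \<Longrightarrow> \<bar>\<phi> s - c j\<bar> \<le> e" and k: "k \<le> N"
  shows "(\<Sum>j<k. (x j - c j)\<^sup>2 * (gap \<gamma> j)) \<le> 2 * (LINT s:{0..T}|lborel. (\<psi> s - \<phi> s)\<^sup>2) + 2 * e\<^sup>2 * T"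
proof -
  have gT: "0 \<le> \<gamma> i" "\<gamma> i \<le> T" if "i \<le> N" for i
    using strict_grid_range[of N \<gamma> T i] g that by auto
  have int: "set_integrable lborel {\<gamma> j<..\<gamma> (Suc j)} (\<lambda>s. (\<psi> s - \<phi> s)\<^sup>2)" if j: "j < N" for j
  proof -
    have "set_integrable lborel {\<gamma> j<..\<gamma> (Suc j)} (\<lambda>s. (x j - \<phi> s)\<^sup>2)"
      using gT[of j] gT[of "Suc j"] j by (intro set_integrable_continuous_piece[of T] continuous_intros \<phi>) auto
    then show ?thesis unfolding set_integrable_def
      by (rule Bochner_Integration.integrable_cong[OF refl, THEN iffD1, rotated]) (auto simp: indicator_def \<psi>[OF j])
  qed
  have le: "(x j - c j)\<^sup>2 * (gap \<gamma> j) \<le> 2 * (LINT s:{\<gamma> j<..\<gamma> (Suc j)}|lborel. (\<psi> s - \<phi> s)\<^sup>2) + 2 * e\<^sup>2 * (gap \<gamma> j)"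
    if j: "j < N" for j
  proof -
    have gj: "\<gamma> j \<le> \<gamma> (Suc j)" using g(1)[OF j] by simp
    note const = set_lebesgue_integral_const_Ioc[OF gj]
    have i2: "set_integrable lborel {\<gamma> j<..\<gamma> (Suc j)} (\<lambda>s. 2 * (\<psi> s - \<phi> s)\<^sup>2)"
      using int[OF j] by (rule set_integrable_mult_right)
    have "(x j - c j)\<^sup>2 * (gap \<gamma> j) = (LINT s:{\<gamma> j<..\<gamma> (Suc j)}|lborel. (x j - c j)\<^sup>2)"
      by (simp add: const)
    also have "\<dots> \<le> (LINT s:{\<gamma> j<..\<gamma> (Suc j)}|lborel. 2 * (\<psi> s - \<phi> s)\<^sup>2 + 2 * e\<^sup>2)"
    proof (rule set_integral_mono)
      show "set_integrable lborel {\<gamma> j<..\<gamma> (Suc j)} (\<lambda>s. (x j - c j)\<^sup>2)" by (rule const)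
      show "set_integrable lborel {\<gamma> j<..\<gamma> (Suc j)} (\<lambda>s. 2 * (\<psi> s - \<phi> s)\<^sup>2 + 2 * e\<^sup>2)"
        by (intro set_integral_add i2 const)
      fix s assume s: "s \<in> {\<gamma> j<..\<gamma> (Suc j)}"
      have "(x j - c j)\<^sup>2 \<le> 2 * (x j - \<phi> s)\<^sup>2 + 2 * (\<phi> s - c j)\<^sup>2"
        using zero_le_power2[of "(x j - \<phi> s) - (\<phi> s - c j)"] by (simp add: power2_eq_square algebra_simps)
      moreover have "(\<phi> s - c j)\<^sup>2 \<le> e\<^sup>2"
        using c[OF j, of s] s power_mono[of "\<bar>\<phi> s - c j\<bar>" e 2] by simp
      ultimately show "(x j - c j)\<^sup>2 \<le> 2 * (\<psi> s - \<phi> s)\<^sup>2 + 2 * e\<^sup>2"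
        using \<psi>[OF j, of s] s by simp
    qed
    also have "\<dots> = 2 * (LINT s:{\<gamma> j<..\<gamma> (Suc j)}|lborel. (\<psi> s - \<phi> s)\<^sup>2) + 2 * e\<^sup>2 * (gap \<gamma> j)"
      by (subst set_integral_add[OF i2 const(1)]) (simp add: const)
    finally show ?thesis .
  qed
  have "(\<Sum>j<k. (x j - c j)\<^sup>2 * (gap \<gamma> j)) \<le> (\<Sum>j<N. (x j - c j)\<^sup>2 * (gap \<gamma> j))"
    using k g by (intro sum_mono2 mult_nonneg_nonneg) (auto intro: less_imp_le)
  also have "\<dots> \<le> (\<Sum>j<N. 2 * (LINT s:{\<gamma> j<..\<gamma> (Suc j)}|lborel. (\<psi> s - \<phi> s)\<^sup>2) + 2 * e\<^sup>2 * (gap \<gamma> j))"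
    by (intro sum_mono le) auto
  also have "\<dots> = 2 * (\<Sum>j<N. LINT s:{\<gamma> j<..\<gamma> (Suc j)}|lborel. (\<psi> s - \<phi> s)\<^sup>2) + 2 * e\<^sup>2 * (\<Sum>j<N. gap \<gamma> j)"
    by (simp only: sum.distrib sum_distrib_left)
  also have "(\<Sum>j<N. gap \<gamma> j) = T" using g(2,3) by (simp add: sum_lessThan_telescope)
  also have "(\<Sum>j<N. LINT s:{\<gamma> j<..\<gamma> (Suc j)}|lborel. (\<psi> s - \<phi> s)\<^sup>2) = (LINT s:{0..T}|lborel. (\<psi> s - \<phi> s)\<^sup>2)"
    using grid_set_integral[of N \<gamma> "\<lambda>s. (\<psi> s - \<phi> s)\<^sup>2" N] g int by simp
  finally show ?thesis .
qed

lemma grid_riemann_error: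
  fixes \<phi> :: "real \<Rightarrow> real"
  assumes g: "\<And>i. i < N \<Longrightarrow> \<gamma> i < \<gamma> (Suc i)" "\<gamma> 0 = 0" "\<gamma> N = T" and \<phi>: "continuous_on {0..T} \<phi>"
    and e: "\<And>j s. j < N \<Longrightarrow> \<gamma> j \<le> s \<Longrightarrow> s \<le> \<gamma> (Suc j) \<Longrightarrow> \<bar>\<phi> s - \<phi> (\<gamma> j)\<bar> \<le> e" and k: "k \<le> N"
  shows "\<bar>(\<Sum>j<k. \<phi> (\<gamma> j) * (gap \<gamma> j)) - (LINT s:{0..\<gamma> k}|lborel. \<phi> s)\<bar> \<le> e * \<gamma> k"
proof -
  have gT: "0 \<le> \<gamma> i" "\<gamma> i \<le> T" if "i \<le> N" for i
    using strict_grid_range[of N \<gamma> T i] g that by auto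
  have int: "set_integrable lborel {\<gamma> j<..\<gamma> (Suc j)} \<phi>" if j: "j < N" for j
    using gT[of j] gT[of "Suc j"] j by (intro set_integrable_continuous_piece[of T] \<phi>) auto
  have le: "\<bar>\<phi> (\<gamma> j) * (gap \<gamma> j) - (LINT s:{\<gamma> j<..\<gamma> (Suc j)}|lborel. \<phi> s)\<bar> \<le> e * (gap \<gamma> j)" if j: "j < N" for j
  proof -
    have gj: "\<gamma> j \<le> \<gamma> (Suc j)" using g(1)[OF j] by simp
    note const = set_lebesgue_integral_const_Ioc[OF gj]
    have es: "\<phi> s \<le> \<phi> (\<gamma> j) + e" "\<phi> (\<gamma> j) - e \<le> \<phi> s" if "s \<in> {\<gamma> j<..\<gamma> (Suc j)}" for s
      using e[OF j, of s] that by auto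
    have "(LINT s:{\<gamma> j<..\<gamma> (Suc j)}|lborel. \<phi> s) \<le> (LINT s:{\<gamma> j<..\<gamma> (Suc j)}|lborel. \<phi> (\<gamma> j) + e)"
      by (intro set_integral_mono int j const es)
    moreover have "(LINT s:{\<gamma> j<..\<gamma> (Suc j)}|lborel. \<phi> (\<gamma> j) - e) \<le> (LINT s:{\<gamma> j<..\<gamma> (Suc j)}|lborel. \<phi> s)"
      by (intro set_integral_mono int j const es)
    ultimately show ?thesis by (simp add: const algebra_simps abs_le_iff)
  qed
  have "\<bar>(\<Sum>j<k. \<phi> (\<gamma> j) * (gap \<gamma> j)) - (LINT s:{0..\<gamma> k}|lborel. \<phi> s)\<bar>
    = \<bar>\<Sum>j<k. \<phi> (\<gamma> j) * (gap \<gamma> j) - (LINT s:{\<gamma> j<..\<gamma> (Suc j)}|lborel. \<phi> s)\<bar>"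
    using grid_set_integral[of N \<gamma> \<phi> k] g int k by (simp add: sum_subtractf)
  also have "\<dots> \<le> (\<Sum>j<k. e * (gap \<gamma> j))"
    using le k by (intro order_trans[OF sum_abs] sum_mono) auto
  also have "\<dots> = e * \<gamma> k" using g(2) by (simp add: sum_distrib_left[symmetric] sum_lessThan_telescope)
  finally show ?thesis .
qed

context correlated_brownian_motions
begin

text \<open>A coefficient of the coarse grid is repeated on all fine gaps inside its interval; it
  stays measurable because the fine time is not earlier. Integrals at all fine grid points and the
  values of the process are unchanged.\<close>

lemma simple_integrand_refine:
  assumes simple: "simple_integrand M T F n \<tau> \<xi>"
    and g: "\<And>i. i < N \<Longrightarrow> \<gamma> i < \<gamma> (Suc i)" "\<gamma> 0 = 0" "\<gamma> N = T" and im: "\<tau> ` {..n} \<subseteq> \<gamma> ` {..N}"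
  shows "\<exists>\<xi>'. (\<forall>j<N. \<xi>' j \<in> borel_measurable (F (\<gamma> j))) \<and>
    (\<forall>B \<omega>. \<forall>k\<le>N. simple_integral n \<tau> \<xi> B (\<gamma> k) \<omega> = (\<Sum>j<k. \<xi>' j \<omega> * (incr B \<gamma> j \<omega>))) \<and>
    (\<forall>j<N. \<forall>s \<omega>. \<gamma> j < s \<longrightarrow> s \<le> \<gamma> (Suc j) \<longrightarrow> simple_process n \<tau> \<xi> s \<omega> = \<xi>' j \<omega>)"
proof -
  note mono = strict_grid_le[of N \<gamma>, OF g(1)] and less = strict_grid_less[of N \<gamma>, OF g(1)]
  have gT: "0 \<le> \<gamma> i" "\<gamma> i \<le> T" if "i \<le> N" for i
    using strict_grid_range[of N \<gamma> T i] g that by auto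
  have "\<forall>i\<in>{..n}. \<exists>a. a \<le> N \<and> \<gamma> a = \<tau> i" using im by (force simp: image_subset_iff)
  then obtain a where a: "\<And>i. i \<le> n \<Longrightarrow> a i \<le> N" "\<And>i. i \<le> n \<Longrightarrow> \<gamma> (a i) = \<tau> i"
    unfolding bchoice_iff by auto
  have a_less: "a i < a (Suc i)" if i: "i < n" for i
  proof (rule ccontr)
    assume "\<not> a i < a (Suc i)"
    then have "\<gamma> (a (Suc i)) \<le> \<gamma> (a i)" using a(1)[of i] i by (intro mono) auto
    then show False using a(2)[of i] a(2)[of "Suc i"] i simple by (auto simp: simple_integrand_def)
  qed
  \<comment> \<open>At most one summand is active for each \<open>j\<close>, the one whose coarse
    interval contains the fine gap.\<close>
  define \<xi>' where "\<xi>' j \<omega> = (\<Sum>i<n. \<xi> i \<omega> * (if a i \<le> j \<and> j < a (Suc i) then 1 else 0))" for j \<omega>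
  show ?thesis
  proof (intro exI[of _ \<xi>'] conjI allI impI)
    fix j assume j: "j < N"
    have "(\<lambda>\<omega>. \<xi> i \<omega> * (if a i \<le> j \<and> j < a (Suc i) then 1 else 0)) \<in> borel_measurable (F (\<gamma> j))" if i: "i < n" for i
    proof (cases "a i \<le> j")
      case True
      have "\<xi> i \<in> borel_measurable (F (\<tau> i))" using simple i by (simp add: simple_integrand_def)
      moreover have "0 \<le> \<tau> i" "\<tau> i \<le> \<gamma> j" "\<gamma> j \<le> T"
        using a[of i] i gT[of "a i"] gT[of j] mono[of "a i" j] True j by auto
      ultimately have "\<xi> i \<in> borel_measurable (F (\<gamma> j))" by (rule measurable_F_mono[rotated 3])
      then show ?thesis by measurable
    qed simp
    then show "\<xi>' j \<in> borel_measurable (F (\<gamma> j))"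
      unfolding \<xi>'_def[abs_def] by (intro borel_measurable_sum) auto
    fix s \<omega> assume s: "\<gamma> j < s" "s \<le> \<gamma> (Suc j)"
    have "indicator {\<tau> i<..\<tau> (Suc i)} s = (if a i \<le> j \<and> j < a (Suc i) then 1 else 0::real)" if i: "i < n" for i
    proof -
      have "\<tau> i < s \<longleftrightarrow> a i \<le> j"
      proof
        assume "a i \<le> j"
        then show "\<tau> i < s" using mono[of "a i" j] a[of i] i j s by auto
      next
        assume "\<tau> i < s"
        show "a i \<le> j"
        proof (rule ccontr)
          assume "\<not> a i \<le> j"
          then have "\<gamma> (Suc j) \<le> \<gamma> (a i)" using a[of i] i by (intro mono) auto
          then show False using \<open>\<tau> i < s\<close> s a[of i] i by auto
        qed
      qed
      moreover have "s \<le> \<tau> (Suc i) \<longleftrightarrow> j < a (Suc i)"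
      proof
        assume "j < a (Suc i)"
        then have "\<gamma> (Suc j) \<le> \<gamma> (a (Suc i))" using a[of "Suc i"] i by (intro mono) auto
        then show "s \<le> \<tau> (Suc i)" using s a[of "Suc i"] i by auto
      next
        assume *: "s \<le> \<tau> (Suc i)"
        show "j < a (Suc i)"
        proof (rule ccontr)
          assume "\<not> j < a (Suc i)"
          then have "\<gamma> (a (Suc i)) \<le> \<gamma> j" using j by (intro mono) auto
          then show False using * s a[of "Suc i"] i by auto
        qed
      qed
      ultimately show ?thesis by (simp add: indicator_def)
    qed
    then show "simple_process n \<tau> \<xi> s \<omega> = \<xi>' j \<omega>"
      unfolding simple_process_def \<xi>'_def by (intro sum.cong) auto
  next
    fix B :: "real \<Rightarrow> 'a \<Rightarrow> real" and \<omega> k assume k: "k \<le> N"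
    have min_eq: "min (\<tau> i) (\<gamma> k) = \<gamma> (min (a i) k)" if "i \<le> n" for i
      using mono[of "a i" k] mono[of k "a i"] a[OF that] k by (cases "a i \<le> k") (auto simp: min_def)
    have "simple_integral n \<tau> \<xi> B (\<gamma> k) \<omega> = (\<Sum>i<n. \<xi> i \<omega> * (B (\<gamma> (min (a (Suc i)) k)) \<omega> - B (\<gamma> (min (a i) k)) \<omega>))"
      unfolding simple_integral_def by (intro sum.cong refl) (simp add: min_eq)
    also have "\<dots> = (\<Sum>i<n. \<xi> i \<omega> * (\<Sum>j<k. (if a i \<le> j \<and> j < a (Suc i) then 1 else 0) * (incr B \<gamma> j \<omega>)))"
    proof (rule sum.cong[OF refl])
      fix i assume i: "i \<in> {..<n}"
      have "B (\<gamma> (min (a (Suc i)) k)) \<omega> - B (\<gamma> (min (a i) k)) \<omega> =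
        (\<Sum>j<k. (if min (a i) k \<le> j \<and> j < min (a (Suc i)) k then 1 else 0) * (incr B \<gamma> j \<omega>))"
        using a_less[of i] i by (intro sum_indicator_increments[of _ _ _ "\<lambda>j. B (\<gamma> j) \<omega>"]) auto
      also have "\<dots> = (\<Sum>j<k. (if a i \<le> j \<and> j < a (Suc i) then 1 else 0) * (incr B \<gamma> j \<omega>))"
        by (intro sum.cong refl) auto
      finally show "\<xi> i \<omega> * (B (\<gamma> (min (a (Suc i)) k)) \<omega> - B (\<gamma> (min (a i) k)) \<omega>) =
        \<xi> i \<omega> * (\<Sum>j<k. (if a i \<le> j \<and> j < a (Suc i) then 1 else 0) * (incr B \<gamma> j \<omega>))" by simp
    qed
    also have "\<dots> = (\<Sum>j<k. \<xi>' j \<omega> * (incr B \<gamma> j \<omega>))"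
      unfolding \<xi>'_def sum_distrib_left sum_distrib_right by (subst sum.swap) (simp add: mult.assoc)
    finally show "simple_integral n \<tau> \<xi> B (\<gamma> k) \<omega> = (\<Sum>j<k. \<xi>' j \<omega> * (incr B \<gamma> j \<omega>))" .
  qed
qed

lemma simple_integrand_range:
  assumes "simple_integrand M T F n \<tau> \<xi>"
  shows "\<tau> ` {..n} \<subseteq> {0..T}"
proof -
  have "\<tau> i < \<tau> (Suc i)" if "i < n" for i using assms that by (simp add: simple_integrand_def)
  then have "\<tau> 0 \<le> \<tau> i \<and> \<tau> i \<le> \<tau> n" if "i \<le> n" for i
    using strict_grid_le[of n \<tau> 0 i] strict_grid_le[of n \<tau> i n] that by auto
  then show ?thesis using assms by (auto simp: simple_integrand_def)
qed

text \<open>The multiples of \<open>T / (k + 1)\<close> are added to \<open>P\<close> and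
  \<open>t\<close>. A gap longer than this step would have such a multiple in its interior, but all
  of them are grid points.\<close>

lemma ex_fine_grid:
  assumes P: "finite P" "P \<subseteq> {0..T}" and t: "0 < t" "t \<le> T"
  shows "\<exists>\<gamma> (N::nat) m. (\<forall>i<N. \<gamma> i < \<gamma> (Suc i)) \<and> \<gamma> 0 = 0 \<and> \<gamma> N = T \<and> m \<le> N \<and> \<gamma> m = t \<and> P \<subseteq> \<gamma> ` {..N} \<and>
    (\<forall>i<N. gap \<gamma> i \<le> T / real (Suc k))"
proof -
  define U where "U = (\<lambda>j. T * real j / real (Suc k)) ` {..Suc k}"
  have UT: "U \<subseteq> {0..T}"
  proof -
    have "T * real j / real (Suc k) \<le> T" if "j \<le> Suc k" for j
    proof -
      have "T * real j \<le> T * real (Suc k)" using that T by (intro mult_left_mono) auto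
      then show ?thesis by (simp add: divide_le_eq)
    qed
    then show ?thesis using T by (auto simp: U_def)
  qed
  define Q where "Q = insert t (P \<union> U)"
  have Q: "finite Q" "Q \<noteq> {}" "Q \<subseteq> {0..T}" using P t UT by (auto simp: Q_def U_def)
  have "0 \<in> U" unfolding U_def by (rule image_eqI[of _ _ 0]) auto
  moreover have "T \<in> U" unfolding U_def by (rule image_eqI[of _ _ "Suc k"]) (auto simp del: of_nat_Suc)
  ultimately have 0: "0 \<in> Q" "T \<in> Q" "t \<in> Q" by (auto simp: Q_def)
  obtain \<gamma> N where \<gamma>: "\<And>i. i < N \<Longrightarrow> \<gamma> i < \<gamma> (Suc i)" and im: "\<gamma> ` {..N::nat} = Q"
    using finite_strict_enumeration[OF Q(1,2)] by blast
  note mono = strict_grid_le[of N \<gamma>, OF \<gamma>] and less = strict_grid_less[of N \<gamma>, OF \<gamma>]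
  have "\<gamma> 0 = 0"
  proof -
    obtain i where "i \<le> N" "\<gamma> i = 0" using 0 im by (metis atMost_iff image_iff)
    then show ?thesis using mono[of 0 i] im Q by force
  qed
  moreover have "\<gamma> N = T"
  proof -
    obtain i where "i \<le> N" "\<gamma> i = T" using 0 im by (metis atMost_iff image_iff)
    then show ?thesis using mono[of i N] im Q by force
  qed
  moreover obtain m where "m \<le> N" "\<gamma> m = t" using 0 im by (metis atMost_iff image_iff)
  moreover have "gap \<gamma> i \<le> T / real (Suc k)" if i: "i < N" for i
  proof (rule ccontr)
    assume *: "\<not> ?thesis"
    define h where "h = T / real (Suc k)"
    have h: "0 < h" using T by (simp add: h_def)
    have "\<gamma> i \<in> Q" "\<gamma> (Suc i) \<in> Q" unfolding im[symmetric] using i by auto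
    then have gi: "0 \<le> \<gamma> i" "\<gamma> (Suc i) \<le> T" using Q(3) by auto
    \<comment> \<open>\<open>j * h\<close> is the first multiple of \<open>h\<close> strictly beyond
      \<open>\<gamma> i\<close>, hence at most \<open>\<gamma> i + h\<close>; the floor plus one
      guarantees strictness even if \<open>\<gamma> i\<close> is itself a multiple.\<close>
    define j where "j = Suc (nat \<lfloor>\<gamma> i / h\<rfloor>)"
    have j: "real j = of_int \<lfloor>\<gamma> i / h\<rfloor> + 1" using gi h by (simp add: j_def)
    have "\<gamma> i / h < real j" "real j \<le> \<gamma> i / h + 1" unfolding j by linarith+
    then have jh: "\<gamma> i < real j * h" "real j * h \<le> \<gamma> i + h" using h by (auto simp: field_simps)
    then have lt: "real j * h < \<gamma> (Suc i)" using * by (simp add: h_def)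
    then have "real j * h \<le> T" using gi by simp
    then have "T * real j \<le> T * real (Suc k)" by (simp add: h_def field_simps)
    then have "j \<le> Suc k" using T by simp
    then have "real j * h \<in> U" unfolding U_def h_def by (intro image_eqI[of _ _ j]) auto
    then obtain l where l: "l \<le> N" "\<gamma> l = real j * h" using im by (force simp: Q_def)
    have "\<not> l \<le> i" using mono[of l i] i jh l by auto
    moreover have "\<not> Suc i \<le> l" using mono[of "Suc i" l] l lt by auto
    ultimately show False by auto
  qed
  ultimately show ?thesis using \<gamma> im unfolding Q_def by blast
qed

end

section \<open>Lognormal mixtures\<close>

text \<open>Change of variables \<open>x = (ln (r / x0) - \<mu>) / s\<close>. The substitution is
  made on the compact intervals from \<open>1 / (n + 2)\<close> to \<open>n + 2\<close>, which
  exhaust the positive half-line, and monotone convergence is used on both sides.\<close>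

lemma std_normal_lognormal:
  fixes \<mu> s x0 :: real
  assumes s: "0 < s" and x0: "0 < x0" and A[measurable]: "A \<in> sets borel"
  shows "(\<integral>\<^sup>+x. indicator A (x0 * exp (\<mu> + s * x)) \<partial>std_normal_distribution) =
    (\<integral>\<^sup>+r. indicator A r * (if 0 < r then ennreal (1 / (r * s) * std_normal_density ((ln (r / x0) - \<mu>) / s)) else 0) \<partial>lborel)"
proof -
  define g where "g r = (ln (r / x0) - \<mu>) / s" for r
  define f where "f x = std_normal_density x * indicator A (x0 * exp (\<mu> + s * x))" for x
  define a where "a n = 1 / (real n + 2)" for n
  define b where "b n = real n + 2" for n
  have ab: "0 < a n" "a n \<le> b n" "0 < b n" for n
  proof -
    have "a n \<le> 1" by (simp add: a_def)
    then show "a n \<le> b n" by (simp add: b_def)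
  qed (simp_all add: a_def b_def)
  have fm[measurable]: "f \<in> borel_measurable borel" unfolding f_def by measurable
  have f0: "0 \<le> f x" for x by (simp add: f_def)
  have fg: "f (g r) = std_normal_density (g r) * indicator A r" if "0 < r" for r
  proof -
    have "x0 * exp (\<mu> + s * g r) = r" using that x0 s by (simp add: g_def)
    then show ?thesis by (simp add: f_def)
  qed
  have sub: "(\<integral>\<^sup>+x. ennreal (f x * indicator {g (a n)..g (b n)} x) \<partial>lborel) =
    (\<integral>\<^sup>+r. ennreal (f (g r) * (1 / (r * s)) * indicator {a n..b n} r) \<partial>lborel)" for n
  proof (rule nn_integral_substitution)
    show "set_borel_measurable borel {g (a n)..g (b n)} f" unfolding set_borel_measurable_def by measurable
    fix r assume "r \<in> {a n..b n}"
    then have r: "0 < r" using ab(1)[of n] by simp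
    show "(g has_real_derivative 1 / (r * s)) (at r)"
      unfolding g_def using r x0 s by (auto intro!: derivative_eq_intros simp: field_simps)
    show "0 \<le> 1 / (r * s)" using r s by simp
  next
    show "continuous_on {a n..b n} (\<lambda>r. 1 / (r * s))"
      using ab(1)[of n] s by (intro continuous_intros) auto
  qed (rule ab)
  have ev: "\<forall>\<^sub>F n in sequentially. r \<in> {a n..b n}" if r: "0 < r" for r
  proof -
    obtain k :: nat where k: "max r (1 / r) \<le> real k" using real_arch_simple by blast
    show ?thesis
      using eventually_ge_at_top[of k]
    proof eventually_elim
      case (elim n)
      then have "r \<le> real n + 2" "1 / r \<le> real n + 2" using k by auto
      then show ?case using r by (auto simp: a_def b_def field_simps)
    qed
  qed
  have g_le: "r \<in> {a n..b n} \<longleftrightarrow> g r \<in> {g (a n)..g (b n)}" if "0 < r" for r n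
    using that ab[of n] x0 s by (simp add: g_def divide_le_cancel divide_right_mono)
  have a_mono: "a (Suc n) \<le> a n" and b_mono: "b n \<le> b (Suc n)" for n
    by (simp_all add: a_def b_def field_simps)
  have ga: "g (a (Suc n)) \<le> g (a n)" and gb: "g (b n) \<le> g (b (Suc n))" for n
    using a_mono[of n] b_mono[of n] ab[of n] ab[of "Suc n"] x0 s
    by (simp_all add: g_def divide_right_mono divide_le_cancel)
  have "(\<lambda>n. \<integral>\<^sup>+x. ennreal (f x * indicator {g (a n)..g (b n)} x) \<partial>lborel) \<longlonglongrightarrow> (\<integral>\<^sup>+x. ennreal (f x) \<partial>lborel)"
  proof (rule nn_integral_LIMSEQ)
    show "incseq (\<lambda>n x. ennreal (f x * indicator {g (a n)..g (b n)} x))"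
    proof (intro incseq_SucI le_funI ennreal_leI mult_left_mono f0)
      fix n x
      show "indicator {g (a n)..g (b n)} x \<le> (indicator {g (a (Suc n))..g (b (Suc n))} x :: real)"
        using ga[of n] gb[of n] by (auto simp: indicator_def)
    qed
    fix x
    have "0 < x0 * exp (\<mu> + s * x)" using x0 by simp
    moreover have "g (x0 * exp (\<mu> + s * x)) = x" using x0 s by (simp add: g_def)
    ultimately have "\<forall>\<^sub>F n in sequentially. x \<in> {g (a n)..g (b n)}"
      using ev[of "x0 * exp (\<mu> + s * x)"] g_le[of "x0 * exp (\<mu> + s * x)"] by simp
    then have "\<forall>\<^sub>F n in sequentially. ennreal (f x * indicator {g (a n)..g (b n)} x) = ennreal (f x)"
      by eventually_elim simp
    then show "(\<lambda>n. ennreal (f x * indicator {g (a n)..g (b n)} x)) \<longlonglongrightarrow> ennreal (f x)"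
      by (rule tendsto_eventually)
  qed measurable
  moreover have "(\<lambda>n. \<integral>\<^sup>+r. ennreal (f (g r) * (1 / (r * s)) * indicator {a n..b n} r) \<partial>lborel) \<longlonglongrightarrow>
    (\<integral>\<^sup>+r. indicator A r * (if 0 < r then ennreal (1 / (r * s) * std_normal_density (g r)) else 0) \<partial>lborel)"
  proof (rule nn_integral_LIMSEQ)
    show "incseq (\<lambda>n r. ennreal (f (g r) * (1 / (r * s)) * indicator {a n..b n} r))"
    proof (intro incseq_SucI le_funI ennreal_leI)
      fix n r
      show "f (g r) * (1 / (r * s)) * indicator {a n..b n} r \<le> f (g r) * (1 / (r * s)) * indicator {a (Suc n)..b (Suc n)} r"
      proof (cases "0 < r")
        case True
        then have "0 \<le> f (g r) * (1 / (r * s))" using f0[of "g r"] s by simp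
        then show ?thesis using a_mono[of n] b_mono[of n]
          by (intro mult_left_mono) (auto simp: indicator_def)
      next
        case False
        then have "\<not> a n \<le> r" "\<not> a (Suc n) \<le> r" using ab(1)[of n] ab(1)[of "Suc n"] by auto
        then show ?thesis by simp
      qed
    qed
    show "(\<lambda>r. ennreal (f (g r) * (1 / (r * s)) * indicator {a n..b n} r)) \<in> borel_measurable lborel" for n
      unfolding g_def by measurable
    fix r
    show "(\<lambda>n. ennreal (f (g r) * (1 / (r * s)) * indicator {a n..b n} r)) \<longlonglongrightarrow>
      indicator A r * (if 0 < r then ennreal (1 / (r * s) * std_normal_density (g r)) else 0)"
    proof (cases "0 < r")
      case True
      have "\<forall>\<^sub>F n in sequentially. ennreal (f (g r) * (1 / (r * s)) * indicator {a n..b n} r) =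
        indicator A r * (if 0 < r then ennreal (1 / (r * s) * std_normal_density (g r)) else 0)"
        using ev[OF True] by eventually_elim (use True in \<open>auto simp: fg indicator_def mult.commute\<close>)
      then show ?thesis by (rule tendsto_eventually)
    next
      case False
      then have "\<not> a n \<le> r" for n using ab(1)[of n] by auto
      then show ?thesis using False by simp
    qed
  qed
  ultimately have "(\<integral>\<^sup>+x. ennreal (f x) \<partial>lborel) =
    (\<integral>\<^sup>+r. indicator A r * (if 0 < r then ennreal (1 / (r * s) * std_normal_density (g r)) else 0) \<partial>lborel)"
    unfolding sub by (rule LIMSEQ_unique)
  moreover have "(\<integral>\<^sup>+x. indicator A (x0 * exp (\<mu> + s * x)) \<partial>std_normal_distribution) = (\<integral>\<^sup>+x. ennreal (f x) \<partial>lborel)"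
    by (subst nn_integral_density) (auto simp: f_def ennreal_mult' ennreal_indicator intro!: nn_integral_cong)
  ultimately show ?thesis by (simp only: g_def)
qed

section \<open>Distribution function and density of the lognormal mixture\<close>

locale sv_limit_pos = sv_limit +
  assumes x0: "0 < x0" and A_pos: "AE \<omega> in M. 0 < A \<omega>"
begin

definition mean :: "'a \<Rightarrow> real" where "mean \<omega> = \<rho> * I \<omega> - A \<omega> / 2"
definition sdev :: "'a \<Rightarrow> real" where "sdev \<omega> = sqrt ((1 - \<rho>\<^sup>2) * A \<omega>)"
definition dens :: "real \<Rightarrow> 'a \<Rightarrow> ennreal" where
  "dens r \<omega> = ennreal (1 / (r * sdev \<omega>) * std_normal_density ((ln (r / x0) - mean \<omega>) / sdev \<omega>))"

lemma mean_meas[measurable]: "mean \<in> borel_measurable M" and sdev_meas[measurable]: "sdev \<in> borel_measurable M"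
  unfolding mean_def[abs_def] sdev_def[abs_def] by measurable

lemma \<rho>2: "0 < 1 - \<rho>\<^sup>2"
  using \<rho> by (simp add: abs_square_less_1)

lemma sdev_pos: "AE \<omega> in M. 0 < sdev \<omega>"
  using A_pos by eventually_elim (use \<rho>2 in \<open>simp add: sdev_def\<close>)

text \<open>Fubini on the product space of \<open>log_law\<close>: for fixed \<open>\<omega>\<close>
  the inner integral is a lognormal probability with parameters \<open>mean \<omega>\<close> and
  \<open>sdev \<omega>\<close>.\<close>

lemma emeasure_X:
  assumes D[measurable]: "D \<in> sets borel"
  shows "emeasure (distr M borel X) D = (\<integral>\<^sup>+\<omega>. (\<integral>\<^sup>+x. indicator D (x0 * exp (mean \<omega> + sdev \<omega> * x)) \<partial>std_normal_distribution) \<partial>M)"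
proof -
  interpret N: prob_space std_normal_distribution by (rule prob_space_normal_density) simp
  have [measurable]: "(\<lambda>(\<omega>, x). mean \<omega> + sdev \<omega> * x) \<in> borel_measurable (M \<Otimes>\<^sub>M std_normal_distribution)"
    by measurable
  have eq: "log_law = distr (M \<Otimes>\<^sub>M std_normal_distribution) borel (\<lambda>(\<omega>, x). mean \<omega> + sdev \<omega> * x)"
    by (simp add: log_law_def mean_def sdev_def)
  have "emeasure (distr M borel X) D = (\<integral>\<^sup>+y. indicator D y \<partial>distr log_law borel (\<lambda>x. x0 * exp x))"
    unfolding law_X[symmetric] by simp
  also have "\<dots> = (\<integral>\<^sup>+y. indicator D (x0 * exp y) \<partial>log_law)"
    by (rule nn_integral_distr) (simp_all add: log_law_def)
  also have "\<dots> = (\<integral>\<^sup>+z. indicator D (x0 * exp ((\<lambda>(\<omega>, x). mean \<omega> + sdev \<omega> * x) z)) \<partial>(M \<Otimes>\<^sub>M std_normal_distribution))"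
    unfolding eq by (rule nn_integral_distr) measurable
  also have "\<dots> = (\<integral>\<^sup>+\<omega>. (\<integral>\<^sup>+x. indicator D (x0 * exp (mean \<omega> + sdev \<omega> * x)) \<partial>std_normal_distribution) \<partial>M)"
    by (subst N.nn_integral_fst[symmetric]) auto
  finally show ?thesis .
qed

lemma prob_X_le:
  assumes r: "0 < r"
  shows "prob {\<omega>\<in>space M. X \<omega> \<le> r} = (\<integral>\<omega>. cdf std_normal_distribution ((ln (r / x0) - mean \<omega>) / sdev \<omega>) \<partial>M)"
proof -
  interpret N: real_distribution std_normal_distribution by (rule real_dist_normal_dist)
  have [measurable]: "cdf std_normal_distribution \<in> borel_measurable borel"
    by (rule borel_measurable_mono) (auto simp: mono_def intro: N.cdf_nondecreasing)
  have "emeasure M {\<omega>\<in>space M. X \<omega> \<le> r} = emeasure (distr M borel X) {..r}"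
    by (subst emeasure_distr) (auto intro!: arg_cong[where f="emeasure M"])
  also have "\<dots> = (\<integral>\<^sup>+\<omega>. (\<integral>\<^sup>+x. indicator {..r} (x0 * exp (mean \<omega> + sdev \<omega> * x)) \<partial>std_normal_distribution) \<partial>M)"
    by (rule emeasure_X) simp
  also have "\<dots> = (\<integral>\<^sup>+\<omega>. ennreal (cdf std_normal_distribution ((ln (r / x0) - mean \<omega>) / sdev \<omega>)) \<partial>M)"
  proof (rule nn_integral_cong_AE)
    show "AE \<omega> in M. (\<integral>\<^sup>+x. indicator {..r} (x0 * exp (mean \<omega> + sdev \<omega> * x)) \<partial>std_normal_distribution) =
      ennreal (cdf std_normal_distribution ((ln (r / x0) - mean \<omega>) / sdev \<omega>))"
      using sdev_pos
    proof eventually_elim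
      case (elim \<omega>)
      have "x0 * exp (mean \<omega> + sdev \<omega> * x) \<le> r \<longleftrightarrow> x \<le> (ln (r / x0) - mean \<omega>) / sdev \<omega>" for x
      proof -
        have "x0 * exp (mean \<omega> + sdev \<omega> * x) \<le> r \<longleftrightarrow> exp (mean \<omega> + sdev \<omega> * x) \<le> r / x0"
          using x0 by (simp add: field_simps)
        also have "\<dots> \<longleftrightarrow> mean \<omega> + sdev \<omega> * x \<le> ln (r / x0)"
          using r x0 by (subst ln_ge_iff) auto
        also have "\<dots> \<longleftrightarrow> x \<le> (ln (r / x0) - mean \<omega>) / sdev \<omega>"
          using elim by (simp add: field_simps)
        finally show ?thesis .
      qed
      then have "(\<lambda>x. indicator {..r} (x0 * exp (mean \<omega> + sdev \<omega> * x)) :: ennreal) = indicator {..(ln (r / x0) - mean \<omega>) / sdev \<omega>}"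
        by (auto simp: indicator_def fun_eq_iff)
      then show ?case by (simp add: cdf_def N.emeasure_eq_measure)
    qed
  qed
  also have "\<dots> = ennreal (\<integral>\<omega>. cdf std_normal_distribution ((ln (r / x0) - mean \<omega>) / sdev \<omega>) \<partial>M)"
    by (intro nn_integral_eq_integral integrable_const_bound[of _ 1])
      (auto simp: N.cdf_nonneg N.cdf_bounded_prob)
  finally show ?thesis by (simp add: emeasure_eq_measure N.cdf_nonneg)
qed

lemma dens_measurable[measurable]: "(\<lambda>(\<omega>, r). dens r \<omega>) \<in> borel_measurable (M \<Otimes>\<^sub>M lborel)"
  unfolding dens_def by measurable

lemma distributed_X: "distributed M lborel X (\<lambda>r. if 0 < r then (\<integral>\<^sup>+\<omega>. dens r \<omega> \<partial>M) else 0)"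
  unfolding distributed_def
proof (intro conjI)
  show m: "(\<lambda>r. if 0 < r then (\<integral>\<^sup>+\<omega>. dens r \<omega> \<partial>M) else 0) \<in> borel_measurable lborel" by measurable
  show "distr M lborel X = density lborel (\<lambda>r. if 0 < r then (\<integral>\<^sup>+\<omega>. dens r \<omega> \<partial>M) else 0)"
  proof (rule measure_eqI)
    interpret L: sigma_finite_measure lborel by (rule sigma_finite_lborel)
    interpret P: pair_sigma_finite M lborel ..
    fix D assume "D \<in> sets (distr M lborel X)"
    then have D[measurable]: "D \<in> sets borel" by simp
    have "emeasure (distr M lborel X) D = emeasure (distr M borel X) D"
      by (simp add: emeasure_distr)
    also have "\<dots> = (\<integral>\<^sup>+\<omega>. (\<integral>\<^sup>+x. indicator D (x0 * exp (mean \<omega> + sdev \<omega> * x)) \<partial>std_normal_distribution) \<partial>M)"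
      by (rule emeasure_X[OF D])
    also have "\<dots> = (\<integral>\<^sup>+\<omega>. (\<integral>\<^sup>+r. indicator D r * (if 0 < r then dens r \<omega> else 0) \<partial>lborel) \<partial>M)"
      unfolding dens_def using sdev_pos
      by (intro nn_integral_cong_AE) (auto elim!: eventually_mono intro!: std_normal_lognormal[OF _ x0 D])
    also have "\<dots> = (\<integral>\<^sup>+r. (\<integral>\<^sup>+\<omega>. indicator D r * (if 0 < r then dens r \<omega> else 0) \<partial>M) \<partial>lborel)"
      by (rule P.Fubini'[symmetric]) measurable
    also have "\<dots> = (\<integral>\<^sup>+r. (if 0 < r then (\<integral>\<^sup>+\<omega>. dens r \<omega> \<partial>M) else 0) * indicator D r \<partial>lborel)"
      by (intro nn_integral_cong) (auto simp: indicator_def)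
    also have "\<dots> = emeasure (density lborel (\<lambda>r. if 0 < r then (\<integral>\<^sup>+\<omega>. dens r \<omega> \<partial>M) else 0)) D"
      using m by (subst emeasure_density) auto
    finally show "emeasure (distr M lborel X) D = emeasure (density lborel (\<lambda>r. if 0 < r then (\<integral>\<^sup>+\<omega>. dens r \<omega> \<partial>M) else 0)) D" .
  qed simp
qed measurable

text \<open>The Gaussian density is at most 1 and \<open>1 / sdev\<close> is a constant times
  \<open>A powr (- 1 / 2)\<close>, so the negative moment is exactly what makes this bound
  integrable. It decreases in \<open>r\<close>, so the bound at \<open>s\<close> serves all of
  \<open>[s, \<infinity>)\<close>.\<close>

definition dens_bound :: "real \<Rightarrow> 'a \<Rightarrow> ennreal" where
  "dens_bound r \<omega> = ennreal (1 / (r * sqrt (1 - \<rho>\<^sup>2))) * ennreal (A \<omega> powr (- 1 / 2))"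

lemma dens_le:
  assumes "0 < s" "s \<le> r"
  shows "dens r \<omega> \<le> dens_bound s \<omega>"
proof -
  have "std_normal_density x \<le> 1" for x
  proof -
    have "1 / sqrt (2 * pi) \<le> 1" using pi_ge_two by (simp add: field_simps)
    moreover have "exp (- x\<^sup>2 / 2) \<le> 1" by simp
    ultimately have "1 / sqrt (2 * pi) * exp (- x\<^sup>2 / 2) \<le> 1 * 1" by (intro mult_mono) auto
    then show ?thesis by (simp add: normal_density_def)
  qed
  moreover have s0: "0 \<le> sdev \<omega>" using A_nonneg[of \<omega>] \<rho>2 by (simp add: sdev_def)
  ultimately have "1 / (r * sdev \<omega>) * std_normal_density ((ln (r / x0) - mean \<omega>) / sdev \<omega>) \<le> 1 / (r * sdev \<omega>) * 1"
    using assms by (intro mult_left_mono) auto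
  also have "\<dots> = 1 / r * (1 / sdev \<omega>)" by simp
  also have "\<dots> \<le> 1 / s * (1 / sdev \<omega>)"
    using assms s0 by (intro mult_right_mono) (auto simp: frac_le)
  also have "1 / sdev \<omega> = 1 / sqrt (1 - \<rho>\<^sup>2) * A \<omega> powr (- 1 / 2)"
  \<comment> \<open>At \<open>A \<omega> = 0\<close> both sides are 0, by the conventions
    \<open>1 / 0 = 0\<close> and \<open>0 powr p = 0\<close>; so the bound holds everywhere.\<close>
  proof (cases "A \<omega> = 0")
    case False
    then have "0 < A \<omega>" using A_nonneg[of \<omega>] by simp
    have "sdev \<omega> = sqrt (1 - \<rho>\<^sup>2) * sqrt (A \<omega>)" by (simp add: sdev_def real_sqrt_mult)
    moreover have "A \<omega> powr (- 1 / 2) = 1 / sqrt (A \<omega>)"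
      using powr_minus_divide[of "A \<omega>" "1 / 2"] powr_half_sqrt[of "A \<omega>"] \<open>0 < A \<omega>\<close> by simp
    ultimately show ?thesis by simp
  qed (simp add: sdev_def)
  finally show ?thesis
    using assms \<rho>2 unfolding dens_def dens_bound_def by (subst ennreal_mult[symmetric]) (auto intro!: ennreal_leI)
qed

lemma dens_bound_finite:
  assumes fin: "(\<integral>\<^sup>+\<omega>. ennreal (A \<omega> powr (- 1 / 2)) \<partial>M) < \<infinity>"
  shows "(\<integral>\<^sup>+\<omega>. dens_bound r \<omega> \<partial>M) < \<infinity>"
  unfolding dens_bound_def using fin by (subst nn_integral_cmult) (auto simp: ennreal_mult_less_top)

lemma density_finite:
  assumes "(\<integral>\<^sup>+\<omega>. ennreal (A \<omega> powr (- 1 / 2)) \<partial>M) < \<infinity>" "0 < r"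
  shows "(\<integral>\<^sup>+\<omega>. dens r \<omega> \<partial>M) < \<infinity>"
  using dens_bound_finite[OF assms(1), of r] nn_integral_mono[of M "dens r" "dens_bound r"] dens_le[of r r] assms(2)
  by (auto intro: le_less_trans)

text \<open>Dominated convergence along sequences, the integrand being continuous in
  \<open>r\<close> wherever \<open>sdev\<close> is positive.\<close>

lemma continuous_density:
  assumes fin: "(\<integral>\<^sup>+\<omega>. ennreal (A \<omega> powr (- 1 / 2)) \<partial>M) < \<infinity>"
  shows "continuous_on {0<..} (\<lambda>r. \<integral>\<^sup>+\<omega>. dens r \<omega> \<partial>M)"
  unfolding continuous_on_sequentially
proof (intro allI ballI impI, elim conjE)
  fix x :: "nat \<Rightarrow> real" and a assume a: "a \<in> {0<..}" and x: "\<forall>n. x n \<in> {0<..}" "x \<longlonglongrightarrow> a"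
  \<comment> \<open>Raising the sequence to \<open>a / 2\<close> makes a single dominating function
    valid for every \<open>n\<close>; eventually nothing is changed.\<close>
  define y where "y n = max (x n) (a / 2)" for n
  have y: "a / 2 \<le> y n" for n by (simp add: y_def)
  have "y \<longlonglongrightarrow> max a (a / 2)" unfolding y_def by (intro tendsto_max x tendsto_const)
  then have ya: "y \<longlonglongrightarrow> a" using a by simp
  have "(\<lambda>n. \<integral>\<^sup>+\<omega>. dens (y n) \<omega> \<partial>M) \<longlonglongrightarrow> (\<integral>\<^sup>+\<omega>. dens a \<omega> \<partial>M)"
  proof (rule nn_integral_dominated_convergence[where w="dens_bound (a / 2)"])
    show "dens (y n) \<in> borel_measurable M" for n unfolding dens_def[abs_def] by measurable
    show "dens a \<in> borel_measurable M" unfolding dens_def[abs_def] by measurable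
    show "dens_bound (a / 2) \<in> borel_measurable M" unfolding dens_bound_def[abs_def] by measurable
    show "AE \<omega> in M. dens (y n) \<omega> \<le> dens_bound (a / 2) \<omega>" for n
      using a y by (intro AE_I2 dens_le) auto
    show "(\<integral>\<^sup>+\<omega>. dens_bound (a / 2) \<omega> \<partial>M) < \<infinity>" by (rule dens_bound_finite[OF fin])
    show "AE \<omega> in M. (\<lambda>n. dens (y n) \<omega>) \<longlonglongrightarrow> dens a \<omega>"
      using sdev_pos
    proof eventually_elim
      case (elim \<omega>)
      show ?case unfolding dens_def normal_density_def
        using ya a elim x0 by (intro tendsto_ennrealI tendsto_intros) auto
    qed
  qed
  moreover have "\<forall>\<^sub>F n in sequentially. (\<integral>\<^sup>+\<omega>. dens (y n) \<omega> \<partial>M) = ((\<lambda>r. \<integral>\<^sup>+\<omega>. dens r \<omega> \<partial>M) \<circ> x) n"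
  proof -
    have "\<forall>\<^sub>F n in sequentially. a / 2 < x n" using order_tendstoD(1)[OF x(2), of "a / 2"] a by simp
    then show ?thesis by eventually_elim (simp add: y_def)
  qed
  ultimately show "((\<lambda>r. \<integral>\<^sup>+\<omega>. dens r \<omega> \<partial>M) \<circ> x) \<longlonglongrightarrow> (\<integral>\<^sup>+\<omega>. dens a \<omega> \<partial>M)"
    by (rule Lim_transform_eventually)
qed

end

section \<open>Pathwise limits\<close>

text \<open>Uniform continuity on the compact interval gives one bound for all gaps at once, as soon
  as the mesh is small.\<close>

lemma grid_oscillation:
  fixes \<phi> :: "real \<Rightarrow> real" and \<gamma> :: "nat \<Rightarrow> nat \<Rightarrow> real" and N :: "nat \<Rightarrow> nat"
  assumes g: "\<And>k i. i < N k \<Longrightarrow> \<gamma> k i < \<gamma> k (Suc i)" "\<And>k. \<gamma> k 0 = 0" "\<And>k. \<gamma> k (N k) = T"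
    and mesh: "\<And>k i. i < N k \<Longrightarrow> gap (\<gamma> k) i \<le> T / real (Suc k)"
    and \<phi>: "continuous_on {0..T} \<phi>" and e: "0 < e"
  shows "\<forall>\<^sub>F k in sequentially. \<forall>j<N k. \<forall>s. \<gamma> k j \<le> s \<longrightarrow> s \<le> \<gamma> k (Suc j) \<longrightarrow> \<bar>\<phi> s - \<phi> (\<gamma> k j)\<bar> \<le> e"
proof -
  have "uniformly_continuous_on {0..T} \<phi>" by (rule compact_uniformly_continuous[OF \<phi>]) simp
  then obtain d where d: "0 < d" "\<And>x y. x \<in> {0..T} \<Longrightarrow> y \<in> {0..T} \<Longrightarrow> dist y x < d \<Longrightarrow> dist (\<phi> y) (\<phi> x) < e"
    using e unfolding uniformly_continuous_on_def by metis
  have "(\<lambda>k. T / real (Suc k)) \<longlonglongrightarrow> 0" by (rule LIMSEQ_Suc[OF lim_const_over_n])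
  from order_tendstoD(2)[OF this d(1)] show ?thesis
  proof eventually_elim
    case (elim k)
    show ?case
    proof (intro allI impI)
      fix j s assume j: "j < N k" and s: "\<gamma> k j \<le> s" "s \<le> \<gamma> k (Suc j)"
      have "0 \<le> \<gamma> k j" "\<gamma> k (Suc j) \<le> T"
        using strict_grid_le[of "N k" "\<gamma> k" 0 j] strict_grid_le[of "N k" "\<gamma> k" "Suc j" "N k"] g(1)[of _ k] g(2,3)[of k] j by auto
      moreover have "dist s (\<gamma> k j) < d" using mesh[OF j] s elim by (simp add: dist_real_def)
      ultimately show "\<bar>\<phi> s - \<phi> (\<gamma> k j)\<bar> \<le> e"
        using d(2)[of "\<gamma> k j" s] s by (simp add: dist_real_def)
    qed
  qed
qed

lemma grid_L2_limit:
  fixes \<phi> :: "real \<Rightarrow> real" and \<gamma> :: "nat \<Rightarrow> nat \<Rightarrow> real" and N m :: "nat \<Rightarrow> nat"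
  assumes g: "\<And>k i. i < N k \<Longrightarrow> \<gamma> k i < \<gamma> k (Suc i)" "\<And>k. \<gamma> k 0 = 0" "\<And>k. \<gamma> k (N k) = T" "\<And>k. m k \<le> N k"
    and \<phi>: "continuous_on {0..T} \<phi>" and T: "0 < T"
    and \<psi>: "\<And>k j s. j < N k \<Longrightarrow> \<gamma> k j < s \<Longrightarrow> s \<le> \<gamma> k (Suc j) \<Longrightarrow> \<psi> k s = x k j"
    and c: "\<And>e. 0 < e \<Longrightarrow> \<forall>\<^sub>F k in sequentially. \<forall>j<N k. \<forall>s. \<gamma> k j \<le> s \<longrightarrow> s \<le> \<gamma> k (Suc j) \<longrightarrow> \<bar>\<phi> s - c k j\<bar> \<le> e"
    and L2: "(\<lambda>k. LINT s:{0..T}|lborel. (\<psi> k s - \<phi> s)\<^sup>2) \<longlonglongrightarrow> 0"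
  shows "(\<lambda>k. \<Sum>j<m k. (x k j - c k j)\<^sup>2 * (gap (\<gamma> k) j)) \<longlonglongrightarrow> 0"
proof (rule LIMSEQ_I)
  fix r :: real assume r: "0 < r"
  \<comment> \<open>Makes the oscillation term \<open>r / 4\<close>; twice an integral below
    \<open>r / 4\<close> leaves a total under \<open>r\<close>.\<close>
  define e where "e = sqrt (r / (8 * T))"
  have e: "0 < e" "2 * e\<^sup>2 * T = r / 4" using r T by (simp_all add: e_def)
  have "\<forall>\<^sub>F k in sequentially. (LINT s:{0..T}|lborel. (\<psi> k s - \<phi> s)\<^sup>2) < r / 4"
    using r by (intro order_tendstoD(2)[OF L2]) auto
  then have "\<forall>\<^sub>F k in sequentially. norm ((\<Sum>j<m k. (x k j - c k j)\<^sup>2 * (gap (\<gamma> k) j)) - 0) < r"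
    using c[OF e(1)]
  proof eventually_elim
    case (elim k)
    have "(\<Sum>j<m k. (x k j - c k j)\<^sup>2 * (gap (\<gamma> k) j)) \<le> 2 * (LINT s:{0..T}|lborel. (\<psi> k s - \<phi> s)\<^sup>2) + 2 * e\<^sup>2 * T"
      using g \<psi> elim by (intro grid_L2_error[of "N k"] \<phi>) auto
    moreover have "0 \<le> (\<Sum>j<m k. (x k j - c k j)\<^sup>2 * (gap (\<gamma> k) j))"
      using g(1)[of _ k] g(4)[of k] by (intro sum_nonneg mult_nonneg_nonneg) (auto simp: less_imp_le)
    ultimately show ?case using elim e r by simp
  qed
  then show "\<exists>no. \<forall>k\<ge>no. norm ((\<Sum>j<m k. (x k j - c k j)\<^sup>2 * (gap (\<gamma> k) j)) - 0) < r"
    by (simp only: eventually_sequentially)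
qed

lemma grid_riemann_limit:
  fixes \<phi> :: "real \<Rightarrow> real" and \<gamma> :: "nat \<Rightarrow> nat \<Rightarrow> real" and N m :: "nat \<Rightarrow> nat"
  assumes g: "\<And>k i. i < N k \<Longrightarrow> \<gamma> k i < \<gamma> k (Suc i)" "\<And>k. \<gamma> k 0 = 0" "\<And>k. \<gamma> k (N k) = T" "\<And>k. m k \<le> N k" "\<And>k. \<gamma> k (m k) = t"
    and mesh: "\<And>k i. i < N k \<Longrightarrow> gap (\<gamma> k) i \<le> T / real (Suc k)"
    and \<phi>: "continuous_on {0..T} \<phi>" and t: "0 < t"
  shows "(\<lambda>k. \<Sum>j<m k. \<phi> (\<gamma> k j) * (gap (\<gamma> k) j)) \<longlonglongrightarrow> (LINT s:{0..t}|lborel. \<phi> s)"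
proof (rule LIMSEQ_I)
  fix r :: real assume r: "0 < r"
  define e where "e = r / (2 * t)"
  have e: "0 < e" using r t by (simp add: e_def)
  have osc: "\<forall>\<^sub>F k in sequentially. \<forall>j<N k. \<forall>s. \<gamma> k j \<le> s \<longrightarrow> s \<le> \<gamma> k (Suc j) \<longrightarrow> \<bar>\<phi> s - \<phi> (\<gamma> k j)\<bar> \<le> e"
    by (rule grid_oscillation[OF _ _ _ _ \<phi> e]) (use g mesh in auto)
  have et: "e * t < r" using r t by (simp add: e_def)
  have "\<forall>\<^sub>F k in sequentially. norm ((\<Sum>j<m k. \<phi> (\<gamma> k j) * (gap (\<gamma> k) j)) - (LINT s:{0..t}|lborel. \<phi> s)) < r"
    using osc
  proof eventually_elim
    case (elim k)
    have "\<bar>(\<Sum>j<m k. \<phi> (\<gamma> k j) * (gap (\<gamma> k) j)) - (LINT s:{0..\<gamma> k (m k)}|lborel. \<phi> s)\<bar> \<le> e * \<gamma> k (m k)"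
      using g elim by (intro grid_riemann_error[of "N k" "\<gamma> k" T] \<phi>) auto
    then show ?case using et by (simp add: g(5))
  qed
  then show "\<exists>no. \<forall>k\<ge>no. norm ((\<Sum>j<m k. \<phi> (\<gamma> k j) * (gap (\<gamma> k) j)) - (LINT s:{0..t}|lborel. \<phi> s)) < r"
    by (simp only: eventually_sequentially)
qed

text \<open>Meant for the integrated variance, a path by path Lebesgue integral: its measurability
  in \<open>\<omega>\<close> comes from Riemann sums, which converge to it only almost surely, and
  completeness closes the difference.\<close>

lemma (in complete_measure) borel_measurable_AE_eq:
  fixes f g :: "'a \<Rightarrow> real"
  assumes f[measurable]: "f \<in> borel_measurable M" and eq: "AE x in M. f x = g x"
  shows "g \<in> borel_measurable M"
proof (rule measurableI)
  fix B :: "real set" assume B[measurable]: "B \<in> sets borel"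
  have "AE x in M. x \<in> f -` B \<inter> space M \<longleftrightarrow> x \<in> g -` B \<inter> space M"
    using eq by eventually_elim auto
  then show "g -` B \<inter> space M \<in> sets M" by (rule in_sets_AE) auto
qed simp

lemma measurable_augmented_natural_filtration_mono:
  assumes f: "f \<in> measurable (augmented_natural_filtration M B s) L" and s: "s \<le> t"
    and B: "\<And>r. r \<in> {0..t} \<Longrightarrow> B r \<in> borel_measurable M"
  shows "f \<in> measurable (augmented_natural_filtration M B t) L"
proof -
  define G where "G r = {B u -` A \<inter> space M | u A. u \<in> {0..r} \<and> A \<in> sets borel} \<union> null_sets M" for r
  have sp: "space (augmented_natural_filtration M B r) = space M" for r
    by (simp add: augmented_natural_filtration_def space_measure_of_conv)
  have G: "G r \<subseteq> Pow (space M)" for r by (auto simp: G_def dest: sets.sets_into_space)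
  have se: "sets (augmented_natural_filtration M B r) = sigma_sets (space M) (G r)" for r
    unfolding augmented_natural_filtration_def G_def[symmetric] by (rule sets_measure_of[OF G])
  have "{0..s} \<subseteq> {0..t}" using s by auto
  then have "G s \<subseteq> G t" unfolding G_def by blast
  then have "sets (augmented_natural_filtration M B s) \<subseteq> sets (augmented_natural_filtration M B t)"
    unfolding se by (rule sigma_sets_mono')
  then show ?thesis using f by (auto simp: measurable_def sp)
qed

text \<open>A positive continuous function attains a positive minimum on \<open>[0, t]\<close>; this
  keeps \<open>sigma_Z\<close> away from 0 almost surely.\<close>

lemma integral_square_pos:
  fixes f :: "real \<Rightarrow> real"
  assumes f: "continuous_on {0..T} f" and pos: "\<And>s. s \<in> {0..T} \<Longrightarrow> 0 < f s" and t: "0 < t" "t \<le> T"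
  shows "0 < (LINT s:{0..t}|lborel. (f s)\<^sup>2)"
proof -
  have ft: "continuous_on {0..t} f" using f t by (auto elim: continuous_on_subset)
  obtain u where u: "u \<in> {0..t}" "\<And>s. s \<in> {0..t} \<Longrightarrow> f u \<le> f s"
    using continuous_attains_inf[OF _ _ ft] t by auto
  have fu: "0 < f u" using pos u t by auto
  have "(LINT s:{0..t}|lborel. (f u)\<^sup>2) \<le> (LINT s:{0..t}|lborel. (f s)\<^sup>2)"
  proof (rule set_integral_mono)
    show "set_integrable lborel {0..t} (\<lambda>s. (f s)\<^sup>2)"
      by (intro borel_integrable_atLeastAtMost' continuous_intros ft)
    show "(f u)\<^sup>2 \<le> (f s)\<^sup>2" if "s \<in> {0..t}" for s
      using u(2)[OF that] fu by (intro power_mono) auto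
  qed (auto intro: borel_integrable_atLeastAtMost')
  moreover have "(LINT s:{0..t}|lborel. (f u)\<^sup>2) = (f u)\<^sup>2 * t"
    using t by (simp add: set_lebesgue_integral_def)
  moreover have "0 < (f u)\<^sup>2 * t" using fu t by simp
  ultimately show ?thesis by linarith
qed

section \<open>Assembly on a common refinement of both families of partitions\<close>

theorem theorem2p2:
  fixes M :: "'a measure" and F :: "real \<Rightarrow> 'a measure"
    and W Z X Y IZ :: "real \<Rightarrow> 'a \<Rightarrow> real"
    and \<mu> \<sigma> :: "real \<Rightarrow> real \<Rightarrow> real"
    and T \<rho> x0 y0 t :: real
  assumes model: "linear_sv_model M T F \<rho> W Z \<mu> \<sigma> x0 y0 X Y"
    and IZ: "has_ito_integral M T F Z Y IZ"
    and t: "t \<in> {0<..T}"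
  shows "(\<forall>r>0. measure M {\<omega> \<in> space M. X t \<omega> \<le> r} =
            (LINT \<omega>|M. cdf std_normal_distribution
               ((ln (r / x0) - mu_Z \<rho> IZ Y t \<omega>) / sigma_Z \<rho> Y t \<omega>))) \<and>
         distributed M lborel (X t) (\<lambda>r. if 0 < r then density_X M \<rho> x0 IZ Y t r else 0) \<and>
         ((\<integral>\<^sup>+ \<omega>. ennreal (integrated_variance Y t \<omega> powr (- 1 / 2)) \<partial>M) < \<infinity> \<longrightarrow>
            (\<forall>r>0. density_X M \<rho> x0 IZ Y t r < \<infinity>) \<and>
            continuous_on {0<..} (density_X M \<rho> x0 IZ Y t))"
proof -
  note m = model[unfolded linear_sv_model_def]
  interpret prob_space M using m by simp
  interpret complete_measure M using m by simp
  interpret C: correlated_brownian_motions M T F W Z \<rho> by unfold_locales (use m in auto)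
  have t': "0 < t" "t \<le> T" "0 \<le> t" using t by auto
  have x0: "0 < x0" using m by simp
  have Ypos: "AE \<omega> in M. \<forall>s\<in>{0..T}. 0 < Y s \<omega>" using m by simp
  have "strong_solution M T Z \<mu> \<sigma> y0 Y" using m by (simp add: unique_strong_solution_def)
  then have Yc: "AE \<omega> in M. continuous_on {0..T} (\<lambda>s. Y s \<omega>)"
    and Yad: "adapted T (augmented_natural_filtration M Z) Y"
    by (auto simp: strong_solution_def has_ito_differential_def continuous_paths_def)
  have Xd: "has_ito_differential M T F W x0 (\<lambda>t \<omega>. 0) (\<lambda>t \<omega>. Y t \<omega> * X t \<omega>) X" using m by simp
  then have Xc: "AE \<omega> in M. continuous_on {0..T} (\<lambda>s. X s \<omega>)" and Xad: "adapted T F X"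
    and XI: "has_ito_integral M T F W (\<lambda>t \<omega>. Y t \<omega> * X t \<omega>) (\<lambda>t \<omega>. X t \<omega> - x0)"
    by (auto simp: has_ito_differential_def continuous_paths_def set_lebesgue_integral_def)
  obtain nX \<tau>X \<xi>X where sX: "\<And>k. simple_integrand M T F (nX k) (\<tau>X k) (\<xi>X k)"
    and L2X: "AE \<omega> in M. (\<lambda>k. LINT s:{0..T}|lborel. (simple_process (nX k) (\<tau>X k) (\<xi>X k) s \<omega> - Y s \<omega> * X s \<omega>)\<^sup>2) \<longlonglongrightarrow> 0"
    and uX: "AE \<omega> in M. uniform_limit {0..T} (\<lambda>k t. simple_integral (nX k) (\<tau>X k) (\<xi>X k) W t \<omega>) (\<lambda>t. X t \<omega> - x0) sequentially"
    using XI unfolding has_ito_integral_def by blast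
  obtain nZ \<tau>Z \<xi>Z where sZ: "\<And>k. simple_integrand M T F (nZ k) (\<tau>Z k) (\<xi>Z k)"
    and L2Z: "AE \<omega> in M. (\<lambda>k. LINT s:{0..T}|lborel. (simple_process (nZ k) (\<tau>Z k) (\<xi>Z k) s \<omega> - Y s \<omega>)\<^sup>2) \<longlonglongrightarrow> 0"
    and uZ: "AE \<omega> in M. uniform_limit {0..T} (\<lambda>k t. simple_integral (nZ k) (\<tau>Z k) (\<xi>Z k) Z t \<omega>) (\<lambda>t. IZ t \<omega>) sequentially"
    and YF: "adapted T F Y" and IZad: "adapted T F IZ"
    using IZ unfolding has_ito_integral_def by blast
  \<comment> \<open>One grid refines the partitions of both integrals and contains \<open>t\<close>,
    so that \<open>X t\<close> and \<open>IZ t\<close> are approximated along the same points and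
    \<open>m k\<close> marks the time \<open>t\<close>.\<close>
  have "\<forall>k. \<exists>\<gamma> (N::nat) m. (\<forall>i<N. \<gamma> i < \<gamma> (Suc i)) \<and> \<gamma> 0 = 0 \<and> \<gamma> N = T \<and> m \<le> N \<and> \<gamma> m = t \<and>
      \<tau>X k ` {..nX k} \<union> \<tau>Z k ` {..nZ k} \<subseteq> \<gamma> ` {..N} \<and> (\<forall>i<N. gap \<gamma> i \<le> T / real (Suc k))"
    using C.simple_integrand_range[OF sX] C.simple_integrand_range[OF sZ] t'
    by (intro allI C.ex_fine_grid) auto
  then obtain \<gamma> N m where "\<forall>k. (\<forall>i<N k. \<gamma> k i < \<gamma> k (Suc i)) \<and> \<gamma> k 0 = 0 \<and> \<gamma> k (N k) = T \<and> m k \<le> N k \<and> \<gamma> k (m k) = t \<and>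
      \<tau>X k ` {..nX k} \<union> \<tau>Z k ` {..nZ k} \<subseteq> \<gamma> k ` {..N k} \<and> (\<forall>i<N k. gap (\<gamma> k) i \<le> T / real (Suc k))"
    unfolding choice_iff by blast
  then have g: "\<And>k i. i < N k \<Longrightarrow> \<gamma> k i < \<gamma> k (Suc i)" "\<And>k. \<gamma> k 0 = 0" "\<And>k. \<gamma> k (N k) = T" "\<And>k. m k \<le> N k" "\<And>k. \<gamma> k (m k) = t"
    and imX: "\<And>k. \<tau>X k ` {..nX k} \<subseteq> \<gamma> k ` {..N k}" and imZ: "\<And>k. \<tau>Z k ` {..nZ k} \<subseteq> \<gamma> k ` {..N k}"
    and mesh: "\<And>k i. i < N k \<Longrightarrow> gap (\<gamma> k) i \<le> T / real (Suc k)"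
    by auto
  have gT: "0 \<le> \<gamma> k j \<and> \<gamma> k j \<le> T" if "j \<le> N k" for k j
    using strict_grid_le[of "N k" "\<gamma> k" 0 j] strict_grid_le[of "N k" "\<gamma> k" j "N k"] g(1)[of _ k] g(2,3)[of k] that by auto
  have "\<forall>k. \<exists>\<xi>'. (\<forall>j<N k. \<xi>' j \<in> borel_measurable (F (\<gamma> k j))) \<and>
      (\<forall>B \<omega>. \<forall>i\<le>N k. simple_integral (nX k) (\<tau>X k) (\<xi>X k) B (\<gamma> k i) \<omega> = (\<Sum>j<i. \<xi>' j \<omega> * (incr B (\<gamma> k) j \<omega>))) \<and>
      (\<forall>j<N k. \<forall>s \<omega>. \<gamma> k j < s \<longrightarrow> s \<le> \<gamma> k (Suc j) \<longrightarrow> simple_process (nX k) (\<tau>X k) (\<xi>X k) s \<omega> = \<xi>' j \<omega>)"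
    by (intro allI C.simple_integrand_refine[OF sX]) (use g imX in auto)
  then obtain \<xi> where "\<forall>k. (\<forall>j<N k. \<xi> k j \<in> borel_measurable (F (\<gamma> k j))) \<and>
      (\<forall>B \<omega>. \<forall>i\<le>N k. simple_integral (nX k) (\<tau>X k) (\<xi>X k) B (\<gamma> k i) \<omega> = (\<Sum>j<i. \<xi> k j \<omega> * (incr B (\<gamma> k) j \<omega>))) \<and>
      (\<forall>j<N k. \<forall>s \<omega>. \<gamma> k j < s \<longrightarrow> s \<le> \<gamma> k (Suc j) \<longrightarrow> simple_process (nX k) (\<tau>X k) (\<xi>X k) s \<omega> = \<xi> k j \<omega>)"
    unfolding choice_iff by blast
  then have \<xi>: "\<And>k j. j < N k \<Longrightarrow> \<xi> k j \<in> borel_measurable (F (\<gamma> k j))"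
    and \<xi>_int: "\<And>k B \<omega> i. i \<le> N k \<Longrightarrow> simple_integral (nX k) (\<tau>X k) (\<xi>X k) B (\<gamma> k i) \<omega> = (\<Sum>j<i. \<xi> k j \<omega> * (incr B (\<gamma> k) j \<omega>))"
    and \<xi>_proc: "\<And>k j s \<omega>. j < N k \<Longrightarrow> \<gamma> k j < s \<Longrightarrow> s \<le> \<gamma> k (Suc j) \<Longrightarrow> simple_process (nX k) (\<tau>X k) (\<xi>X k) s \<omega> = \<xi> k j \<omega>"
    by blast+
  have "\<forall>k. \<exists>\<xi>'. (\<forall>j<N k. \<xi>' j \<in> borel_measurable (F (\<gamma> k j))) \<and>
      (\<forall>B \<omega>. \<forall>i\<le>N k. simple_integral (nZ k) (\<tau>Z k) (\<xi>Z k) B (\<gamma> k i) \<omega> = (\<Sum>j<i. \<xi>' j \<omega> * (incr B (\<gamma> k) j \<omega>))) \<and>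
      (\<forall>j<N k. \<forall>s \<omega>. \<gamma> k j < s \<longrightarrow> s \<le> \<gamma> k (Suc j) \<longrightarrow> simple_process (nZ k) (\<tau>Z k) (\<xi>Z k) s \<omega> = \<xi>' j \<omega>)"
    by (intro allI C.simple_integrand_refine[OF sZ]) (use g imZ in auto)
  then obtain \<zeta> where "\<forall>k. (\<forall>j<N k. \<zeta> k j \<in> borel_measurable (F (\<gamma> k j))) \<and>
      (\<forall>B \<omega>. \<forall>i\<le>N k. simple_integral (nZ k) (\<tau>Z k) (\<xi>Z k) B (\<gamma> k i) \<omega> = (\<Sum>j<i. \<zeta> k j \<omega> * (incr B (\<gamma> k) j \<omega>))) \<and>
      (\<forall>j<N k. \<forall>s \<omega>. \<gamma> k j < s \<longrightarrow> s \<le> \<gamma> k (Suc j) \<longrightarrow> simple_process (nZ k) (\<tau>Z k) (\<xi>Z k) s \<omega> = \<zeta> k j \<omega>)"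
    unfolding choice_iff by blast
  then have \<zeta>: "\<And>k j. j < N k \<Longrightarrow> \<zeta> k j \<in> borel_measurable (F (\<gamma> k j))"
    and \<zeta>_int: "\<And>k B \<omega> i. i \<le> N k \<Longrightarrow> simple_integral (nZ k) (\<tau>Z k) (\<xi>Z k) B (\<gamma> k i) \<omega> = (\<Sum>j<i. \<zeta> k j \<omega> * (incr B (\<gamma> k) j \<omega>))"
    and \<zeta>_proc: "\<And>k j s \<omega>. j < N k \<Longrightarrow> \<gamma> k j < s \<Longrightarrow> s \<le> \<gamma> k (Suc j) \<Longrightarrow> simple_process (nZ k) (\<tau>Z k) (\<xi>Z k) s \<omega> = \<zeta> k j \<omega>"
    by blast+
  \<comment> \<open>Adaptedness to \<open>F\<close> is read off from the integral \<open>IZ\<close>;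
    adaptedness to the filtration of \<open>Z\<close> alone came from the strong solution.\<close>
  have Y_F: "Y s \<in> borel_measurable (F s)" if "0 \<le> s" "s \<le> T" for s
    using YF that by (simp add: adapted_def)
  have YM: "Y s \<in> borel_measurable M" if "0 \<le> s" "s \<le> T" for s
    by (rule measurable_from_subalg[OF C.sub[OF that] Y_F[OF that]])
  define A where "A = integrated_variance Y t"
  have A_lim: "AE \<omega> in M. (\<lambda>k. \<Sum>i<m k. (Y (\<gamma> k i) \<omega>)\<^sup>2 * (gap (\<gamma> k) i)) \<longlonglongrightarrow> A \<omega>"
    using Yc
  proof eventually_elim
    case (elim \<omega>)
    then have "continuous_on {0..T} (\<lambda>s. (Y s \<omega>)\<^sup>2)" by (intro continuous_intros)
    then show ?case unfolding A_def integrated_variance_def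
      by (intro grid_riemann_limit[where N=N and T=T]) (use g mesh t' in auto)
  qed
  have A_meas: "A \<in> borel_measurable M"
  proof (rule borel_measurable_AE_eq)
    show "(\<lambda>\<omega>. lim (\<lambda>k. \<Sum>i<m k. (Y (\<gamma> k i) \<omega>)\<^sup>2 * (gap (\<gamma> k) i))) \<in> borel_measurable M"
      using gT g(4)
      by (intro borel_measurable_lim_metric borel_measurable_sum borel_measurable_times borel_measurable_power YM borel_measurable_const)
        (meson lessThan_iff less_imp_le_nat order_trans)+
    show "AE \<omega> in M. lim (\<lambda>k. \<Sum>i<m k. (Y (\<gamma> k i) \<omega>)\<^sup>2 * (gap (\<gamma> k) i)) = A \<omega>"
      using A_lim by eventually_elim (rule limI)
  qed
  interpret S: sv_limit_pos M T F W Z \<rho> \<gamma> m "\<lambda>k. T / real (Suc k)" x0 "X t" "IZ t" A Y \<xi> \<zeta>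
  proof (unfold_locales)
    show "\<gamma> k i < \<gamma> k (Suc i)" if "i < m k" for k i using g(1,4)[of k] that by (meson less_le_trans g(1))
    show "\<gamma> k 0 = 0" "\<gamma> k (m k) \<le> T" for k using g t' by auto
    show "gap (\<gamma> k) i \<le> T / real (Suc k)" if "i < m k" for k i using mesh g(4)[of k] that by (meson less_le_trans)
    show "0 \<le> T / real (Suc k)" for k using C.T by simp
    show "(\<lambda>k. T / real (Suc k)) \<longlonglongrightarrow> 0" by (rule LIMSEQ_Suc[OF lim_const_over_n])
    show "X t \<in> borel_measurable M" "IZ t \<in> borel_measurable M"
      using Xad IZad t' by (auto simp: adapted_def intro!: measurable_from_subalg[OF C.sub[of t]])
    show "A \<in> borel_measurable M" by (rule A_meas)
    \<comment> \<open>True at every \<open>\<omega>\<close>, as a path whose square is not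
      integrable gets the integral 0 by convention.\<close>
    show "0 \<le> A \<omega>" for \<omega> by (simp add: A_def integrated_variance_def set_lebesgue_integral_def)
    show "Y s \<in> borel_measurable (F s)" if "0 \<le> s" "s \<le> T" for s using Y_F that .
    show "Y s \<in> borel_measurable (augmented_natural_filtration M Z T)" if "0 \<le> s" "s \<le> T" for s
      by (rule measurable_augmented_natural_filtration_mono[of _ _ _ s]) (use Yad that in \<open>auto simp: adapted_def intro: C.Z_measurable\<close>)
    show "AE \<omega> in M. \<exists>K. \<forall>s\<in>{0..T}. \<bar>Y s \<omega>\<bar> \<le> K"
      using Yc
    proof eventually_elim
      case (elim \<omega>)
      have "bounded ((\<lambda>s. Y s \<omega>) ` {0..T})" by (intro compact_imp_bounded compact_continuous_image elim) simp
      then show ?case by (auto simp: bounded_iff)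
    qed
    show "\<xi> k i \<in> borel_measurable (F (\<gamma> k i))" "\<zeta> k i \<in> borel_measurable (F (\<gamma> k i))" if "i < m k" for k i
      using \<xi>[of i k] \<zeta>[of i k] g(4)[of k] that by auto
    show "AE \<omega> in M. (\<lambda>k. x0 + (\<Sum>j<m k. \<xi> k j \<omega> * (incr W (\<gamma> k) j \<omega>))) \<longlonglongrightarrow> X t \<omega>"
      using uX
    proof eventually_elim
      case (elim \<omega>)
      have "(\<lambda>k. simple_integral (nX k) (\<tau>X k) (\<xi>X k) W t \<omega>) \<longlonglongrightarrow> X t \<omega> - x0"
        using tendsto_uniform_limitI[OF elim, of t] t' by simp
      then have "(\<lambda>k. x0 + simple_integral (nX k) (\<tau>X k) (\<xi>X k) W (\<gamma> k (m k)) \<omega>) \<longlonglongrightarrow> x0 + (X t \<omega> - x0)"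
        unfolding g(5) by (intro tendsto_intros)
      then show ?case by (simp add: \<xi>_int[OF g(4)])
    qed
    show "AE \<omega> in M. (\<lambda>k. \<Sum>j<m k. \<zeta> k j \<omega> * (incr Z (\<gamma> k) j \<omega>)) \<longlonglongrightarrow> IZ t \<omega>"
      using uZ
    proof eventually_elim
      case (elim \<omega>)
      have "(\<lambda>k. simple_integral (nZ k) (\<tau>Z k) (\<xi>Z k) Z (\<gamma> k (m k)) \<omega>) \<longlonglongrightarrow> IZ t \<omega>"
        unfolding g(5) using tendsto_uniform_limitI[OF elim, of t] t' by simp
      then show ?case by (simp add: \<zeta>_int[OF g(4)])
    qed
    show "AE \<omega> in M. (\<lambda>k. \<Sum>i<m k. (\<zeta> k i \<omega> - Y (\<gamma> k i) \<omega>)\<^sup>2 * (gap (\<gamma> k) i)) \<longlonglongrightarrow> 0"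
      using Yc L2Z
    proof eventually_elim
      case (elim \<omega>)
      show ?case
      proof (rule grid_L2_limit[where N=N and T=T and \<phi>="\<lambda>s. Y s \<omega>" and \<psi>="\<lambda>k s. simple_process (nZ k) (\<tau>Z k) (\<xi>Z k) s \<omega>"])
        fix e :: real assume "0 < e"
        then show "\<forall>\<^sub>F k in sequentially. \<forall>j<N k. \<forall>s. \<gamma> k j \<le> s \<longrightarrow> s \<le> \<gamma> k (Suc j) \<longrightarrow> \<bar>Y s \<omega> - Y (\<gamma> k j) \<omega>\<bar> \<le> e"
          by (intro grid_oscillation[OF _ _ _ _ elim(1)]) (use g mesh in auto)
      qed (use g elim C.T \<zeta>_proc in auto)
    qed
    show "AE \<omega> in M. (\<lambda>k. \<Sum>i<m k. (\<xi> k i \<omega> - Y (\<gamma> k i) \<omega> * (x0 + (\<Sum>j<i. \<xi> k j \<omega> * (incr W (\<gamma> k) j \<omega>))))\<^sup>2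
         * (gap (\<gamma> k) i)) \<longlonglongrightarrow> 0"
      using Yc Xc L2X uX
    proof eventually_elim
      case (elim \<omega>)
      have cont: "continuous_on {0..T} (\<lambda>s. Y s \<omega> * X s \<omega>)" using elim by (intro continuous_intros)
      have "bounded ((\<lambda>s. Y s \<omega>) ` {0..T})" by (intro compact_imp_bounded compact_continuous_image elim) simp
      then obtain K where K: "0 < K" "\<And>s. s \<in> {0..T} \<Longrightarrow> \<bar>Y s \<omega>\<bar> \<le> K"
        by (auto simp: bounded_pos)
      show ?case
      proof (rule grid_L2_limit[where N=N and T=T and \<phi>="\<lambda>s. Y s \<omega> * X s \<omega>" and \<psi>="\<lambda>k s. simple_process (nX k) (\<tau>X k) (\<xi>X k) s \<omega>"])
        \<comment> \<open>The reference value contains the sum \<open>S\<close> instead of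
          \<open>X\<close>. Half of \<open>e\<close> pays for
          \<open>\<bar>Y\<bar> * \<bar>X - S\<bar>\<close>, with
          \<open>\<bar>Y\<bar> \<le> K\<close> and the convergence of the simple integrals uniform
          in time, hence at all grid points at once; the other half pays for the oscillation of
          \<open>Y * X\<close>.\<close>
        fix e :: real assume e: "0 < e"
        have "\<forall>\<^sub>F k in sequentially. \<forall>s\<in>{0..T}. dist (simple_integral (nX k) (\<tau>X k) (\<xi>X k) W s \<omega>) (X s \<omega> - x0) < e / (2 * K)"
          using e K by (intro uniform_limitD[OF elim(4)]) auto
        moreover have "\<forall>\<^sub>F k in sequentially. \<forall>j<N k. \<forall>s. \<gamma> k j \<le> s \<longrightarrow> s \<le> \<gamma> k (Suc j) \<longrightarrow>
            \<bar>Y s \<omega> * X s \<omega> - Y (\<gamma> k j) \<omega> * X (\<gamma> k j) \<omega>\<bar> \<le> e / 2"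
          by (intro grid_oscillation[OF _ _ _ _ cont]) (use e g mesh in auto)
        ultimately show "\<forall>\<^sub>F k in sequentially. \<forall>j<N k. \<forall>s. \<gamma> k j \<le> s \<longrightarrow> s \<le> \<gamma> k (Suc j) \<longrightarrow>
            \<bar>Y s \<omega> * X s \<omega> - Y (\<gamma> k j) \<omega> * (x0 + (\<Sum>j<j. \<xi> k j \<omega> * (incr W (\<gamma> k) j \<omega>)))\<bar> \<le> e"
        proof eventually_elim
          case (elim k)
          show ?case
          proof (intro allI impI)
            fix j s assume j: "j < N k" and s: "\<gamma> k j \<le> s" "s \<le> \<gamma> k (Suc j)"
            define S where "S = x0 + (\<Sum>i<j. \<xi> k i \<omega> * (incr W (\<gamma> k) i \<omega>))"
            have r: "\<gamma> k j \<in> {0..T}" using gT[of j k] j by auto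
            have "S = x0 + simple_integral (nX k) (\<tau>X k) (\<xi>X k) W (\<gamma> k j) \<omega>" using \<xi>_int[of j k] j by (simp add: S_def)
            moreover have "\<bar>simple_integral (nX k) (\<tau>X k) (\<xi>X k) W (\<gamma> k j) \<omega> - (X (\<gamma> k j) \<omega> - x0)\<bar> < e / (2 * K)"
              using elim(1) r by (simp add: dist_real_def)
            ultimately have "\<bar>X (\<gamma> k j) \<omega> - S\<bar> \<le> e / (2 * K)" by simp
            then have "\<bar>Y (\<gamma> k j) \<omega>\<bar> * \<bar>X (\<gamma> k j) \<omega> - S\<bar> \<le> K * (e / (2 * K))"
              using K r by (intro mult_mono) auto
            then have "\<bar>Y (\<gamma> k j) \<omega> * X (\<gamma> k j) \<omega> - Y (\<gamma> k j) \<omega> * S\<bar> \<le> e / 2"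
              using K by (simp add: abs_mult[symmetric] right_diff_distrib)
            moreover have "\<bar>Y s \<omega> * X s \<omega> - Y (\<gamma> k j) \<omega> * X (\<gamma> k j) \<omega>\<bar> \<le> e / 2" using elim(2) j s by blast
            ultimately have "\<bar>Y s \<omega> * X s \<omega> - Y (\<gamma> k j) \<omega> * S\<bar> \<le> e" by linarith
            then show "\<bar>Y s \<omega> * X s \<omega> - Y (\<gamma> k j) \<omega> * (x0 + (\<Sum>j<j. \<xi> k j \<omega> * (incr W (\<gamma> k) j \<omega>)))\<bar> \<le> e"
              by (simp only: S_def)
          qed
        qed
      qed (use g cont elim C.T \<xi>_proc in auto)
    qed
    show "AE \<omega> in M. (\<lambda>k. \<Sum>i<m k. (Y (\<gamma> k i) \<omega>)\<^sup>2 * (gap (\<gamma> k) i)) \<longlonglongrightarrow> A \<omega>" by (rule A_lim)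
    show "0 < x0" by (rule x0)
    show "AE \<omega> in M. 0 < A \<omega>"
      using Yc Ypos unfolding A_def integrated_variance_def
      by eventually_elim (intro integral_square_pos[of T] t', auto)
  qed
  have mean: "mu_Z \<rho> IZ Y t = S.mean"
    by (simp add: fun_eq_iff mu_Z_def S.mean_def A_def[symmetric])
  have sdev: "sigma_Z \<rho> Y t = S.sdev"
    by (simp add: fun_eq_iff sigma_Z_def S.sdev_def A_def[symmetric])
  have dens: "density_X M \<rho> x0 IZ Y t = (\<lambda>r. \<integral>\<^sup>+\<omega>. S.dens r \<omega> \<partial>M)"
    unfolding density_X_def[abs_def] S.dens_def mean sdev ..
  show ?thesis
    unfolding mean sdev dens A_def[symmetric]
    using S.prob_X_le S.distributed_X S.density_finite S.continuous_density by blast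
qed

end
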